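(* Let $\Omega\in\mathbb R$ be given. There exist infinitely many infinite-dimensional vector spaces (linear subspaces of $V$) that are invariant under $$\frac{du}{dt}+Au+B(u,u)+\Omega Su=0, \qquad( ** )$$ and each of these spaces is not a subspace of any of the others.
   Context: Function spaces. Let $L_1,L_2,L_3>0$ with $\max\{L_1,L_2,L_3\}=2\pi$, and $\mathbb T_{\mathbf L}=(\mathbb R/L_1\mathbb Z)\times(\mathbb R/L_2\mathbb Z)\times(\mathbb R/L_3\mathbb Z)$. For $\mathbf k\in\mathbb Z^3$ let $\check{\mathbf k}=2\pi(k_1/L_1,k_2/L_2,k_3/L_3)$; for $\mathbf k\ne\mathbf 0$ let $X_{\mathbf k}=\{\mathbf z\in\mathbb C^3:\mathbf z\cdot\check{\mathbf k}=0\}$, where $\mathbf x\cdot\mathbf y=\mathbf x^{\rm T}\mathbf y$. $\sum'$ is the sum over $\mathbf k\in\mathbb Z^3\setminus\{\mathbf 0\}$. $\mathcal V$ is the real vector space of all $u=\sum'\widehat{\mathbf u}_{\mathbf k}e^{i\check{\mathbf k}\cdot\mathbf x}$ with $\widehat{\mathbf u}_{\mathbf k}\in X_{\mathbf k}$, $\widehat{\mathbf u}_{-\mathbf k}=\overline{\widehat{\mathbf u}_{\mathbf k}}$ and only finitely many nonzero coefficients. $H$ and $V$ are the closures of $\mathcal V$ in $L^2(\mathbb T_{\mathbf L})^3$ and $H^1(\mathbb T_{\mathbf L})^3$; $V\subset H=H'\subset V'$; $H_{\rm w}$ is $H$ with its weak topology. $\langle\cdot,\cdot\rangle$, $|\cdot|$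 are the $L^2$ inner product and norm; $\langle\!\langle u,v\rangle\!\rangle=\sum_{j=1}^3\langle\partial_{x_j}u,\partial_{x_j}v\rangle$, $\|u\|=|\nabla u|$. $\mathcal P$ is the orthogonal (Leray) projection of $L^2(\mathbb T_{\mathbf L})^3$ onto $H$. Operators. $Au=\sum'|\check{\mathbf k}|^2\widehat{\mathbf u}_{\mathbf k}e^{i\check{\mathbf k}\cdot\mathbf x}$ (Stokes operator), $\mathcal D(A)=V\cap H^2(\mathbb T_{\mathbf L})^3$. $b(u,v,w)=\int_{\mathbb T_{\mathbf L}}((u\cdot\nabla)v)\cdot w\,d\mathbf x$ and $B:V\times V\to V'$ is given by $\langle B(u,v),w\rangle_{V',V}=b(u,v,w)$. $J\mathbf z=\mathbf e_3\times\mathbf z$, $S=\mathcal PJ\mathcal P$. Solutions. A Leray-Hopf weak solution of $( ** )$ is $u:[0,\infty)\to H$ with $u\in C([0,\infty),H_{\rm w})\cap L^2_{\rm loc}([0,\infty),V)$, $u'\in L^{4/3}_{\rm loc}([0,\infty),V')$, such that for all $w\in V$, $\frac{d}{dt}\langle u(t),w\rangle+\langle\!\langle u(t),w\rangle\!\rangle+b(u(t),u(t),w)+\Omega\langle Su(t),w\rangle=0$ in the distribution sense on $(0,\infty)$, and $\frac12|u(t)|^2+\int_{t_0}^t\|u(\tau)\|^2d\tau\le\frac12|u(t_0)|^2$ holds for $t_0=0$ and almost all $t_0\in(0,\infty)$, and all $t\ge t_0$. A global regular solution is a Leray-Hopf weak solution with $u\in C([0,\infty),V)\cap L^2_{\rm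 loc}([0,\infty),\mathcal D(A))$ and $u'\in L^2_{\rm loc}([0,\infty),H)$. Invariance. A linear subspace $W\subset V$ is invariant under $( ** )$ if for every $u_0\in W$ the problem $( ** )$ with $u(0)=u_0$ has a unique global regular solution $u$, and $u(t)\in W$ for all $t\ge0$. *)

theory Defs
  imports "HOL-Analysis.Analysis"
begin

section \<open>Vector fields modulo null sets\<close>

text \<open>
  Lebesgue measurable maps from \<open>\<real>\<^sup>3\<close> to \<open>\<real>\<^sup>3\<close> modulo equality almost everywhere. Fields on the
  torus are the elements of this type that are periodic, see \<open>L2\<close> below; two periodic fields agree
  almost everywhere on \<open>\<real>\<^sup>3\<close> iff they agree almost everywhere on a period cell.
\<close>

definition ae_eq :: "(real^3 \<Rightarrow> real^3) \<Rightarrow> (real^3 \<Rightarrow> real^3) \<Rightarrow> bool" where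
  "ae_eq f g \<longleftrightarrow> f \<in> borel_measurable lebesgue \<and> g \<in> borel_measurable lebesgue \<and>
     (AE x in lebesgue. f x = g x)"

lemma part_equivp_ae_eq: "part_equivp ae_eq"
proof (rule part_equivpI)
  show "\<exists>f. ae_eq f f"
    by (rule exI[of _ "\<lambda>_. 0"]) (simp add: ae_eq_def)
  show "symp ae_eq"
    by (auto simp: symp_def ae_eq_def elim: AE_mp)
  show "transp ae_eq"
    unfolding transp_def ae_eq_def by (auto elim: AE_mp)
qed

quotient_type vfield = "real^3 \<Rightarrow> real^3" / partial: ae_eq
  by (rule part_equivp_ae_eq)

instantiation vfield :: real_vector
begin

lift_definition zero_vfield :: vfield is "\<lambda>_. 0"
  by (simp add: ae_eq_def)

lift_definition plus_vfield :: "vfield \<Rightarrow> vfield \<Rightarrow> vfield" is "\<lambda>f g x. f x + g x"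
  unfolding ae_eq_def by (auto elim: AE_mp)

lift_definition minus_vfield :: "vfield \<Rightarrow> vfield \<Rightarrow> vfield" is "\<lambda>f g x. f x - g x"
  unfolding ae_eq_def by (auto elim: AE_mp)

lift_definition uminus_vfield :: "vfield \<Rightarrow> vfield" is "\<lambda>f x. - f x"
  unfolding ae_eq_def by (auto elim: AE_mp)

lift_definition scaleR_vfield :: "real \<Rightarrow> vfield \<Rightarrow> vfield" is "\<lambda>a f x. a *\<^sub>R f x"
  unfolding ae_eq_def by (auto elim: AE_mp)

instance
  by (standard; transfer; auto simp: ae_eq_def algebra_simps)

end

section \<open>The torus and its Fourier coefficients\<close>

text \<open>
  The vector \<open>L\<close> collects the three periods. Integrals over the torus are integrals over the period
  cell \<open>cbox 0 L\<close>; they do not depend on the representative chosen by \<open>rep_vfield\<close>.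
\<close>

definition L2 :: "real^3 \<Rightarrow> vfield set" where
  "L2 L = {u. (\<forall>j. AE x in lebesgue. rep_vfield u (x + axis j (L $ j)) = rep_vfield u x) \<and>
              set_integrable lebesgue (cbox 0 L) (\<lambda>x. (norm (rep_vfield u x))\<^sup>2)}"

definition L2_inner :: "real^3 \<Rightarrow> vfield \<Rightarrow> vfield \<Rightarrow> real" where
  "L2_inner L u v = (LINT x:cbox 0 L|lebesgue. rep_vfield u x \<bullet> rep_vfield v x)"

definition L2_norm :: "real^3 \<Rightarrow> vfield \<Rightarrow> real" where
  "L2_norm L u = sqrt (L2_inner L u u)"

definition wave :: "real^3 \<Rightarrow> int^3 \<Rightarrow> real^3" where
  "wave L k = (\<chi> j. 2 * pi * of_int (k $ j) / L $ j)"

definition fourier :: "real^3 \<Rightarrow> vfield \<Rightarrow> int^3 \<Rightarrow> complex^3" where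
  "fourier L u k = (\<chi> i. complex_of_real (1 / (\<Prod>j\<in>UNIV. L $ j)) *
     (LINT x:cbox 0 L|lebesgue.
        complex_of_real (rep_vfield u x $ i) * exp (- \<i> * complex_of_real (wave L k \<bullet> x))))"

text \<open>
  The weak derivative on the torus, with the exponentials as test functions.
\<close>

definition has_pd :: "real^3 \<Rightarrow> 3 \<Rightarrow> vfield \<Rightarrow> vfield \<Rightarrow> bool" where
  "has_pd L j u g \<longleftrightarrow> g \<in> L2 L \<and>
     (\<forall>k. fourier L g k = (\<chi> i. \<i> * complex_of_real (wave L k $ j) * fourier L u k $ i))"

definition pd :: "real^3 \<Rightarrow> 3 \<Rightarrow> vfield \<Rightarrow> vfield" where
  "pd L j u = (THE g. has_pd L j u g)"

definition H1 :: "real^3 \<Rightarrow> vfield set" where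
  "H1 L = {u \<in> L2 L. \<forall>j. \<exists>g. has_pd L j u g}"

definition H2 :: "real^3 \<Rightarrow> vfield set" where
  "H2 L = {u \<in> H1 L. \<forall>j. pd L j u \<in> H1 L}"

definition grad_inner :: "real^3 \<Rightarrow> vfield \<Rightarrow> vfield \<Rightarrow> real" where
  "grad_inner L u v = (\<Sum>j\<in>UNIV. L2_inner L (pd L j u) (pd L j v))"

definition grad_norm :: "real^3 \<Rightarrow> vfield \<Rightarrow> real" where
  "grad_norm L u = sqrt (grad_inner L u u)"

definition H1_norm :: "real^3 \<Rightarrow> vfield \<Rightarrow> real" where
  "H1_norm L u = sqrt ((L2_norm L u)\<^sup>2 + (grad_norm L u)\<^sup>2)"

section \<open>Solenoidal fields with mean zero\<close>

definition Xspace :: "real^3 \<Rightarrow> int^3 \<Rightarrow> (complex^3) set" where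
  "Xspace L k = {z. (\<Sum>j\<in>UNIV. z $ j * complex_of_real (wave L k $ j)) = 0}"

definition trig_field :: "real^3 \<Rightarrow> (int^3 \<Rightarrow> complex^3) \<Rightarrow> (real^3 \<Rightarrow> real^3) \<Rightarrow> bool" where
  "trig_field L c f \<longleftrightarrow>
     finite {k. c k \<noteq> 0} \<and> c 0 = 0 \<and>
     (\<forall>k. k \<noteq> 0 \<longrightarrow> c k \<in> Xspace L k) \<and>
     (\<forall>k j. c (- k) $ j = cnj (c k $ j)) \<and>
     (\<forall>x j. complex_of_real (f x $ j) =
        (\<Sum>k | c k \<noteq> 0. c k $ j * exp (\<i> * complex_of_real (wave L k \<bullet> x))))"

definition trig_space :: "real^3 \<Rightarrow> vfield set" where
  "trig_space L = {abs_vfield f | f. \<exists>c. trig_field L c f}"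

definition closure_in :: "'a::minus set \<Rightarrow> ('a \<Rightarrow> real) \<Rightarrow> 'a set \<Rightarrow> 'a set" where
  "closure_in X N S = {u \<in> X. \<forall>\<epsilon>>0. \<exists>v\<in>S. N (u - v) < \<epsilon>}"

definition Hspace :: "real^3 \<Rightarrow> vfield set" where
  "Hspace L = closure_in (L2 L) (L2_norm L) (trig_space L)"

definition Vspace :: "real^3 \<Rightarrow> vfield set" where
  "Vspace L = closure_in (H1 L) (H1_norm L) (trig_space L)"

text \<open>
  The dual of \<open>Vspace L\<close>. Functionals are set to zero outside \<open>Vspace L\<close>, so that equality of
  functionals is equality on \<open>Vspace L\<close>. On \<open>Vspace L\<close> the norm is \<open>grad_norm L\<close>, which is
  equivalent to \<open>H1_norm L\<close> there, because the mean is zero.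
\<close>

definition Vdual :: "real^3 \<Rightarrow> (vfield \<Rightarrow> real) set" where
  "Vdual L = {\<phi>. (\<forall>v\<in>Vspace L. \<forall>w\<in>Vspace L. \<phi> (v + w) = \<phi> v + \<phi> w) \<and>
                 (\<forall>a. \<forall>v\<in>Vspace L. \<phi> (a *\<^sub>R v) = a * \<phi> v) \<and>
                 (\<exists>C. \<forall>v\<in>Vspace L. \<bar>\<phi> v\<bar> \<le> C * grad_norm L v) \<and>
                 (\<forall>v. v \<notin> Vspace L \<longrightarrow> \<phi> v = 0)}"

definition Vdual_norm :: "real^3 \<Rightarrow> (vfield \<Rightarrow> real) \<Rightarrow> real" where
  "Vdual_norm L \<phi> = Sup {\<bar>\<phi> v\<bar> | v. v \<in> Vspace L \<and> grad_norm L v \<le> 1}"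

section \<open>Operators\<close>

definition leray :: "real^3 \<Rightarrow> vfield \<Rightarrow> vfield" where
  "leray L u = (THE v. v \<in> Hspace L \<and> (\<forall>w\<in>Hspace L. L2_inner L (u - v) w = 0))"

lift_definition Jop :: "vfield \<Rightarrow> vfield" is "\<lambda>f x. cross3 (axis 3 1) (f x)"
proof -
  fix f g :: "real^3 \<Rightarrow> real^3"
  assume fg: "ae_eq f g"
  have "(\<lambda>z::real^3. cross3 (axis 3 1) z) \<in> borel_measurable borel"
    by (intro borel_measurable_continuous_onI continuous_on_cross continuous_intros)
  with fg show "ae_eq (\<lambda>x. cross3 (axis 3 1) (f x)) (\<lambda>x. cross3 (axis 3 1) (g x))"
    unfolding ae_eq_def by (auto elim: AE_mp intro: measurable_compose)
qed

definition Sop :: "real^3 \<Rightarrow> vfield \<Rightarrow> vfield" where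
  "Sop L u = leray L (Jop (leray L u))"

definition stokes_dom :: "real^3 \<Rightarrow> vfield set" where
  "stokes_dom L = Vspace L \<inter> H2 L"

definition stokes :: "real^3 \<Rightarrow> vfield \<Rightarrow> vfield" where
  "stokes L u = (THE v. v \<in> Hspace L \<and>
     (\<forall>k. k \<noteq> 0 \<longrightarrow> fourier L v k = (\<chi> i. complex_of_real ((norm (wave L k))\<^sup>2) * fourier L u k $ i)))"

definition bform :: "real^3 \<Rightarrow> vfield \<Rightarrow> vfield \<Rightarrow> vfield \<Rightarrow> real" where
  "bform L u v w = (LINT x:cbox 0 L|lebesgue.
     (\<Sum>i\<in>UNIV. (rep_vfield u x $ i) *\<^sub>R rep_vfield (pd L i v) x) \<bullet> rep_vfield w x)"

section \<open>Functions of time\<close>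

text \<open>
  Bochner measurability and local \<open>L\<^sup>p\<close> spaces on the half line \<open>[0,\<infinity>)\<close>, with values in a space
  given by a carrier \<open>X\<close> and a norm \<open>N\<close>.
\<close>

definition bochner_measurable :: "'a::minus set \<Rightarrow> ('a \<Rightarrow> real) \<Rightarrow> (real \<Rightarrow> 'a) \<Rightarrow> bool" where
  "bochner_measurable X N f \<longleftrightarrow>
     (\<exists>s :: nat \<Rightarrow> real \<Rightarrow> 'a.
        (\<forall>n. finite (s n ` {0..}) \<and> s n ` {0..} \<subseteq> X \<and>
             (\<forall>a. {t. 0 \<le> t \<and> s n t = a} \<in> sets lebesgue)) \<and>
        (AE t in lebesgue. 0 \<le> t \<longrightarrow> (\<lambda>n. N (s n t - f t)) \<longlonglongrightarrow> 0))"

definition Lp_loc :: "real \<Rightarrow> 'a::minus set \<Rightarrow> ('a \<Rightarrow> real) \<Rightarrow> (real \<Rightarrow> 'a) \<Rightarrow> bool" where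
  "Lp_loc p X N f \<longleftrightarrow>
     (AE t in lebesgue. 0 \<le> t \<longrightarrow> f t \<in> X) \<and> bochner_measurable X N f \<and>
     (\<forall>T>0. set_integrable lebesgue {0..T} (\<lambda>t. N (f t) powr p))"

definition test_function :: "(real \<Rightarrow> real) \<Rightarrow> bool" where
  "test_function \<phi> \<longleftrightarrow>
     (\<forall>n t. (deriv ^^ n) \<phi> field_differentiable (at t)) \<and>
     (\<exists>a b. 0 < a \<and> a \<le> b \<and> (\<forall>t. t \<notin> {a..b} \<longrightarrow> \<phi> t = 0))"

text \<open>The identity \<open>df/dt = g\<close> for locally integrable functions, as distributions on \<open>(0,\<infinity>)\<close>.\<close>

definition distr_deriv :: "(real \<Rightarrow> real) \<Rightarrow> (real \<Rightarrow> real) \<Rightarrow> bool" where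
  "distr_deriv f g \<longleftrightarrow>
     (\<forall>a b. 0 < a \<and> a \<le> b \<longrightarrow>
        set_integrable lebesgue {a..b} f \<and> set_integrable lebesgue {a..b} g) \<and>
     (\<forall>\<phi>. test_function \<phi> \<longrightarrow>
        (LINT t:{0<..}|lebesgue. f t * deriv \<phi> t) = - (LINT t:{0<..}|lebesgue. g t * \<phi> t))"

section \<open>Solutions and invariant subspaces\<close>

text \<open>
  The derivatives \<open>u'\<close> are distributional derivatives with values in \<open>V'\<close> and \<open>H\<close>; identities between
  (locally integrable) vector valued functions are tested against elements of \<open>V\<close> and \<open>H\<close>.
\<close>

definition leray_hopf :: "real^3 \<Rightarrow> real \<Rightarrow> (real \<Rightarrow> vfield) \<Rightarrow> bool" where
  "leray_hopf L \<Omega> u \<longleftrightarrow>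
     (\<forall>t\<ge>0. u t \<in> Hspace L) \<and>
     (\<forall>w\<in>Hspace L. continuous_on {0..} (\<lambda>t. L2_inner L (u t) w)) \<and>
     Lp_loc 2 (Vspace L) (grad_norm L) u \<and>
     (\<exists>u'. Lp_loc (4/3) (Vdual L) (Vdual_norm L) u' \<and>
        (\<forall>w\<in>Vspace L. distr_deriv (\<lambda>t. L2_inner L (u t) w) (\<lambda>t. u' t w))) \<and>
     (\<forall>w\<in>Vspace L. distr_deriv (\<lambda>t. L2_inner L (u t) w)
        (\<lambda>t. - (grad_inner L (u t) w + bform L (u t) (u t) w + \<Omega> * L2_inner L (Sop L (u t)) w))) \<and>
     (let energy_ineq = (\<lambda>t\<^sub>0. \<forall>t\<ge>t\<^sub>0.
            (L2_norm L (u t))\<^sup>2 / 2 + (LINT \<tau>:{t\<^sub>0..t}|lebesgue. (grad_norm L (u \<tau>))\<^sup>2)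
              \<le> (L2_norm L (u t\<^sub>0))\<^sup>2 / 2)
      in energy_ineq 0 \<and> (AE t\<^sub>0 in lebesgue. 0 < t\<^sub>0 \<longrightarrow> energy_ineq t\<^sub>0))"

definition global_regular :: "real^3 \<Rightarrow> real \<Rightarrow> (real \<Rightarrow> vfield) \<Rightarrow> bool" where
  "global_regular L \<Omega> u \<longleftrightarrow>
     leray_hopf L \<Omega> u \<and>
     (\<forall>t\<ge>0. u t \<in> Vspace L) \<and>
     (\<forall>t\<ge>0. ((\<lambda>s. grad_norm L (u s - u t)) \<longlongrightarrow> 0) (at t within {0..})) \<and>
     Lp_loc 2 (stokes_dom L) (\<lambda>v. L2_norm L (stokes L v)) u \<and>
     (\<exists>u'. Lp_loc 2 (Hspace L) (L2_norm L) u' \<and>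
        (\<forall>w\<in>Hspace L. distr_deriv (\<lambda>t. L2_inner L (u t) w) (\<lambda>t. L2_inner L (u' t) w)))"

text \<open>
  Only the values \<open>u t\<close> with \<open>t \<ge> 0\<close> matter, so uniqueness means equality on \<open>[0,\<infinity>)\<close>.
\<close>

definition invariant_subspace :: "real^3 \<Rightarrow> real \<Rightarrow> vfield set \<Rightarrow> bool" where
  "invariant_subspace L \<Omega> W \<longleftrightarrow>
     subspace W \<and> W \<subseteq> Vspace L \<and>
     (\<forall>u\<^sub>0\<in>W. \<exists>u. global_regular L \<Omega> u \<and> u 0 = u\<^sub>0 \<and> (\<forall>t\<ge>0. u t \<in> W) \<and>
        (\<forall>v. global_regular L \<Omega> v \<and> v 0 = u\<^sub>0 \<longrightarrow> (\<forall>t\<ge>0. v t = u t)))"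

definition infinite_dimensional :: "'a::real_vector set \<Rightarrow> bool" where
  "infinite_dimensional W \<longleftrightarrow> \<not> (\<exists>B. finite B \<and> span B = W)"

end

theory Submission
  imports Defs
begin

text \<open>
  A vertical shear flow \<open>\<phi>(x\<^sub>1) e\<^sub>3\<close> satisfies \<open>(u \<cdot> \<nabla>)u = 0\<close> and \<open>J u = 0\<close>, so the equation reduces to the
  heat equation, which damps every mode \<open>w\<^sub>m = cos (2 \<pi> m x\<^sub>1 / L\<^sub>1) e\<^sub>3\<close> separately. Hence the span of
  \<open>{w\<^sub>m | m \<in> S}\<close> is invariant for every set \<open>S\<close> of positive integers, and disjoint infinite sets \<open>S\<close>
  give incomparable spaces.

  Uniqueness is weak-strong uniqueness: for a solution \<open>v\<close> and the explicit solution \<open>u\<close> with the same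
  initial value, the energy inequality of \<open>v\<close>, the energy equality of \<open>u\<close> and the weak equation of \<open>v\<close>
  tested with \<open>u\<close> bound \<open>|v - u|\<^sup>2 / 2\<close> by the integral of \<open>b(v,v,u) - \<parallel>v - u\<parallel>\<^sup>2\<close>. With \<open>w = v - u\<close>,
  \<open>b(v,v,u) = b(w,w,u)\<close>: the other terms pair \<open>w\<^sub>1\<close> and \<open>\<partial>\<^sub>3 w\<^sub>3\<close> with functions of \<open>x\<^sub>1\<close> alone, and these
  pairings vanish because \<open>w\<close> is solenoidal with mean zero and because of periodicity in \<open>x\<^sub>3\<close>.
  Gronwall's argument concludes.
\<close>

section \<open>Smooth functions and distributional derivatives\<close>

text \<open>The existence half is elementary because the spaces are algebraic spans: every solution
  is a finite sum with exponentials in time as coefficients, and its time derivatives are classical.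
  The obstacle is uniqueness, where the competitor \<open>v\<close> is an arbitrary field known only
  through the weak formulation. \<open>pd\<close> and \<open>leray\<close> are definite
  descriptions, so even using them for \<open>v\<close> requires that Fourier coefficients determine
  a field (completeness of the exponentials) and that the projection onto \<open>Hspace L\<close>
  exists (completeness of L2). The weak equation of \<open>v\<close> holds only in the distribution
  sense in time and must be turned into an increment formula. The rotation term disappears for
  \<open>v\<close> as well, since J v is horizontal and the test fields are vertical. The nonlinear
  term survives as b(w,w,u), in which u is not differentiated: the amplitude bound A = sum of |a_m|,
  valid at all times by damping, lets Young's inequality absorb the gradient and leaves A^2/4
  |w|^2.\<close>

lemma borel_measurable_lebesgueI:
  fixes f :: "'a::euclidean_space \<Rightarrow> 'b::topological_space"
  assumes "f \<in> borel_measurable borel" shows "f \<in> borel_measurable lebesgue"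
  using measurable_completion[of f lborel borel] assms by simp

text \<open>The regularity clause of \<open>test_function\<close>, isolated from the support
  condition.\<close>

definition smooth :: "(real \<Rightarrow> real) \<Rightarrow> bool" where
  "smooth f \<longleftrightarrow> (\<forall>n t. (deriv ^^ n) f field_differentiable (at t))"

text \<open>A class of functions closed under differentiation contains all iterated derivatives of
  its members. Proving smoothness thus means exhibiting such a class, with no formula for the n-th
  derivative.\<close>

lemma smooth_coinduct:
  assumes F: "\<And>f. f \<in> F \<Longrightarrow> \<exists>g\<in>F. \<forall>t. (f has_real_derivative g t) (at t)" and "f \<in> F"
  shows "smooth f"
proof -
  have "(deriv ^^ n) f \<in> F" for n
  proof (induction n)
    case (Suc n)
    then obtain g where g: "g \<in> F" "\<And>t. ((deriv ^^ n) f has_real_derivative g t) (at t)"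
      using F by blast
    then have "deriv ((deriv ^^ n) f) = g" by (auto intro!: ext DERIV_imp_deriv)
    with g show ?case by simp
  qed (use \<open>f \<in> F\<close> in simp)
  then show ?thesis
    using F unfolding smooth_def field_differentiable_def by meson
qed

lemma smooth_deriv: "smooth f \<Longrightarrow> smooth (deriv f)"
  unfolding smooth_def by (metis funpow_Suc_right o_apply)

lemma smooth_DERIV: "smooth f \<Longrightarrow> (f has_real_derivative deriv f t) (at t)"
  unfolding smooth_def using DERIV_deriv_iff_field_differentiable by (metis funpow_0)

lemma smooth_continuous: "smooth f \<Longrightarrow> continuous_on A f"
  by (meson DERIV_isCont continuous_at_imp_continuous_on smooth_DERIV)

lemma smooth_antideriv:
  assumes "smooth g" "\<And>t. (f has_real_derivative g t) (at t)"
  shows "smooth f"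
proof (rule smooth_coinduct[where F="insert f {g. smooth g}"])
  fix h assume "h \<in> insert f {g. smooth g}"
  then show "\<exists>g\<in>insert f {g. smooth g}. \<forall>t. (h has_real_derivative g t) (at t)"
    using assms smooth_DERIV smooth_deriv by blast
qed simp

lemma smooth_const: "smooth (\<lambda>_. c)"
  by (rule smooth_coinduct[where F="range (\<lambda>c _. c)"]) (auto intro!: exI[of _ 0])

lemma smooth_affine:
  assumes "smooth f" shows "smooth (\<lambda>x. f (a * x + b))"
proof (rule smooth_coinduct[where F="{\<lambda>x. c * f (a * x + b) | c f. smooth f}"])
  fix h assume "h \<in> {\<lambda>x. c * f (a * x + b) | c f. smooth f}"
  then obtain c f where f: "smooth f" and h: "h = (\<lambda>x. c * f (a * x + b))" by auto
  have "(h has_real_derivative (c * a) * deriv f (a * t + b)) (at t)" for t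
    unfolding h by (rule derivative_eq_intros DERIV_chain2[OF smooth_DERIV[OF f]] refl | simp)+
  then show "\<exists>g\<in>{\<lambda>x. c * f (a * x + b) | c f. smooth f}. \<forall>t. (h has_real_derivative g t) (at t)"
    using smooth_deriv[OF f] by (intro bexI[where x="\<lambda>t. (c * a) * deriv f (a * t + b)"]) auto
next
  show "(\<lambda>x. f (a * x + b)) \<in> {\<lambda>x. c * f (a * x + b) | c f. smooth f}"
    using assms by (auto intro!: exI[of _ 1] exI[of _ f])
qed

text \<open>Products alone are not closed under differentiation: the Leibniz rule turns one product
  into a sum of two, so sums are built into the class handed to
  \<open>smooth_coinduct\<close>.\<close>

inductive_set sums_of_products :: "(real \<Rightarrow> real) set" where
  prod: "smooth f \<Longrightarrow> smooth g \<Longrightarrow> (\<lambda>x. f x * g x) \<in> sums_of_products"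
| add: "p \<in> sums_of_products \<Longrightarrow> q \<in> sums_of_products \<Longrightarrow> (\<lambda>x. p x + q x) \<in> sums_of_products"

lemma smooth_sums_of_products:
  assumes "p \<in> sums_of_products" shows "smooth p"
proof (rule smooth_coinduct[OF _ assms])
  fix f assume "f \<in> sums_of_products"
  then show "\<exists>g\<in>sums_of_products. \<forall>t. (f has_real_derivative g t) (at t)"
  proof induction
    case (prod f g)
    then have "((\<lambda>x. f x * g x) has_real_derivative deriv f t * g t + f t * deriv g t) (at t)" for t
      by (auto intro!: derivative_eq_intros smooth_DERIV)
    moreover have "(\<lambda>t. deriv f t * g t + f t * deriv g t) \<in> sums_of_products"
      using prod smooth_deriv by (intro sums_of_products.intros) auto
    ultimately show ?case by (intro bexI[where x="\<lambda>t. deriv f t * g t + f t * deriv g t"]) auto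
  next
    case (add p q)
    then obtain p' q' where "p' \<in> sums_of_products" "\<And>t. (p has_real_derivative p' t) (at t)"
      "q' \<in> sums_of_products" "\<And>t. (q has_real_derivative q' t) (at t)" by blast
    then show ?case
      by (intro bexI[of _ "\<lambda>x. p' x + q' x"]) (auto intro: DERIV_add sums_of_products.add)
  qed
qed

lemma smooth_mult: "smooth f \<Longrightarrow> smooth g \<Longrightarrow> smooth (\<lambda>x. f x * g x)"
  by (rule smooth_sums_of_products[OF sums_of_products.prod])

lemma smooth_add:
  assumes "smooth f" "smooth g" shows "smooth (\<lambda>x. f x + g x)"
  using smooth_sums_of_products[OF sums_of_products.add
      [OF sums_of_products.prod[OF assms(1) smooth_const[of 1]]
          sums_of_products.prod[OF assms(2) smooth_const[of 1]]]] by simp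

lemma smooth_diff:
  assumes "smooth f" "smooth g" shows "smooth (\<lambda>x. f x - g x)"
  using smooth_add[OF assms(1) smooth_mult[OF smooth_const[of "-1"] assms(2)]] by simp

lemma smooth_exp: "smooth (\<lambda>x. exp (c * x))"
proof (rule smooth_coinduct[where F="{\<lambda>x. a * exp (c * x) | a. True}"])
  fix h assume "h \<in> {\<lambda>x. a * exp (c * x) | a. True}"
  then obtain a where h: "h = (\<lambda>x. a * exp (c * x))" by auto
  have "(h has_real_derivative (a * c) * exp (c * t)) (at t)" for t
    unfolding h by (auto intro!: derivative_eq_intros)
  then show "\<exists>g\<in>{\<lambda>x. a * exp (c * x) | a. True}. \<forall>t. (h has_real_derivative g t) (at t)"
    by (intro bexI[where x="\<lambda>t. (a * c) * exp (c * t)"]) auto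
qed (auto intro: exI[of _ 1])

section \<open>A smooth step function built from exp(-1/x)\<close>

definition flat_exp :: "real poly \<Rightarrow> real \<Rightarrow> real" where
  "flat_exp p x = (if x > 0 then poly p (inverse x) * exp (- inverse x) else 0)"

lemma poly_exp_tendsto_0: "((\<lambda>y::real. poly p y * exp (- y)) \<longlongrightarrow> 0) at_top"
proof -
  have "((\<lambda>y::real. \<Sum>i\<le>degree p. coeff p i * (y ^ i / exp y)) \<longlongrightarrow> (\<Sum>i\<le>degree p. coeff p i * 0)) at_top"
    by (intro tendsto_intros tendsto_power_div_exp_0)
  then show ?thesis
    by (simp add: poly_altdef sum_distrib_right exp_minus divide_inverse mult.assoc)
qed

text \<open>In y = 1/x the function is p(y) exp(-y), and d/dx = -y^2 d/dy gives y^2 (p - p')(y)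
  exp(-y); \<open>monom 1 2\<close> is the factor y^2. Carrying the polynomial as an index makes the
  family closed under differentiation, as \<open>smooth_coinduct\<close> requires.\<close>

lemma flat_exp_DERIV:
  "(flat_exp p has_real_derivative flat_exp (monom 1 2 * (p - pderiv p)) x) (at x)"
proof -
  consider "x > 0" | "x < 0" | "x = 0" by linarith
  then show ?thesis
  proof cases
    case 1
    have "((\<lambda>x. poly p (inverse x) * exp (- inverse x)) has_real_derivative
        flat_exp (monom 1 2 * (p - pderiv p)) x) (at x)"
      using 1 by (auto intro!: derivative_eq_intros DERIV_chain2[OF poly_DERIV]
          simp: flat_exp_def poly_monom field_simps power2_eq_square)
    then show ?thesis
      by (rule has_field_derivative_transform_within_open[of _ _ _ "{0<..}"])
         (use 1 in \<open>auto simp: flat_exp_def\<close>)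
  next
    case 2
    have "((\<lambda>x. 0) has_real_derivative flat_exp (monom 1 2 * (p - pderiv p)) x) (at x)"
      using 2 by (simp add: flat_exp_def)
    then show ?thesis
      by (rule has_field_derivative_transform_within_open[of _ _ _ "{..<0}"])
         (use 2 in \<open>auto simp: flat_exp_def\<close>)
  next
    case 3
    \<comment> \<open>The difference quotient at 0 is p(1/y) exp(-1/y) / y; \<open>pCons 0 p\<close>
      is p multiplied by the variable, which accounts for the factor 1/y.\<close>
    have "((\<lambda>y. poly (pCons 0 p) (inverse y) * exp (- inverse y)) \<longlongrightarrow> 0) (at_right (0::real))"
      using filterlim_compose[OF poly_exp_tendsto_0 filterlim_inverse_at_top_right] .
    then have R: "((\<lambda>y. flat_exp p y / y) \<longlongrightarrow> 0) (at_right 0)"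
      by (rule Lim_transform_eventually)
         (auto simp: eventually_at_right_field flat_exp_def field_simps intro!: exI[of _ 1])
    have L: "((\<lambda>y. flat_exp p y / y) \<longlongrightarrow> 0) (at_left 0)"
      by (rule tendsto_eventually)
         (auto simp: eventually_at_left_field flat_exp_def intro!: exI[of _ "-1"])
    have "((\<lambda>y. flat_exp p y / y) \<longlongrightarrow> 0) (at 0)"
      using L R by (simp add: filterlim_at_split)
    then show ?thesis
      using 3 by (simp add: has_field_derivative_iff flat_exp_def)
  qed
qed

lemma smooth_flat_exp: "smooth (flat_exp p)"
  by (rule smooth_coinduct[where F="range flat_exp"]) (use flat_exp_DERIV in blast)+

text \<open>The normalized antiderivative of a bump that is positive exactly on (0,1). Rescaled
  copies will approximate indicators of half-lines, and their nonnegative derivatives will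
  approximate point masses.\<close>

lemma smooth_step_exists:
  "\<exists>\<Phi>. smooth \<Phi> \<and> (\<forall>x\<le>0. \<Phi> x = 0) \<and> (\<forall>x\<ge>1. \<Phi> x = 1) \<and> (\<forall>x. deriv \<Phi> x \<ge> 0)"
proof -
  \<comment> \<open>The product of exp(-1/x) and its reflection. The argument 1 - x is written as
    \<open>-1 * x + 1\<close> to match \<open>smooth_affine\<close>.\<close>
  define \<rho> where "\<rho> x = flat_exp 1 x * flat_exp 1 (-1 * x + 1)" for x
  have sm: "smooth \<rho>"
    unfolding \<rho>_def by (intro smooth_mult smooth_affine smooth_flat_exp)
  have "\<exists>F. \<forall>x. -\<infinity> < ereal x \<longrightarrow> ereal x < \<infinity> \<longrightarrow> (F has_vector_derivative \<rho> x) (at x)"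
    by (rule einterval_antiderivative)
       (use smooth_DERIV[OF sm] in \<open>auto intro: DERIV_isCont\<close>)
  then obtain F where F: "\<And>x. (F has_real_derivative \<rho> x) (at x)"
    by (auto simp: has_real_derivative_iff_has_vector_derivative)
  have \<rho>0: "\<rho> x = 0" if "x \<le> 0 \<or> x \<ge> 1" for x using that by (auto simp: \<rho>_def flat_exp_def)
  have \<rho>_pos: "\<rho> x > 0" if "0 < x" "x < 1" for x using that by (auto simp: \<rho>_def flat_exp_def)
  have cont: "continuous_on A F" for A
    using F by (meson DERIV_isCont continuous_at_imp_continuous_on)
  have const: "F y = F x" if "x \<le> y" "y \<le> 0 \<or> 1 \<le> x" for x y
  proof (cases "x = y")
    case False
    have "(F has_real_derivative 0) (at t)" if "x < t" "t < y" for t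
    proof -
      have "t \<le> 0 \<or> 1 \<le> t"
        using that \<open>y \<le> 0 \<or> 1 \<le> x\<close> by linarith
      then have "\<rho> t = 0" by (rule \<rho>0)
      then show ?thesis using F[of t] by simp
    qed
    then show ?thesis
      using False \<open>x \<le> y\<close> by (intro DERIV_isconst_end cont) auto
  qed simp
  have F0: "F x = F 0" if "x \<le> 0" for x using const[of x 0] that by simp
  have F1: "F x = F 1" if "x \<ge> 1" for x using const[of 1 x] that by simp
  have less: "F 0 < F 1"
    by (rule DERIV_pos_imp_increasing_open[of 0 1 F]) (use F \<rho>_pos cont in auto)
  define \<Phi> where "\<Phi> x = (F x - F 0) / (F 1 - F 0)" for x
  have D: "(\<Phi> has_real_derivative inverse (F 1 - F 0) * \<rho> x) (at x)" for x
    using DERIV_cdivide[OF DERIV_diff[OF F[of x] DERIV_const[of "F 0"]], of "F 1 - F 0"]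
    by (simp add: \<Phi>_def[abs_def] divide_inverse mult.commute)
  have "smooth \<Phi>"
    by (rule smooth_antideriv[OF _ D]) (intro smooth_mult smooth_const sm)
  moreover have "deriv \<Phi> x \<ge> 0" for x
    using less \<rho>_pos[of x] \<rho>0[of x] unfolding DERIV_imp_deriv[OF D]
    by (cases "0 < x \<and> x < 1") auto
  ultimately show ?thesis
  proof (intro exI[of _ \<Phi>] conjI allI impI)
    fix x :: real
    show "x \<le> 0 \<Longrightarrow> \<Phi> x = 0" using F0[of x] by (simp only: \<Phi>_def) simp
    show "x \<ge> 1 \<Longrightarrow> \<Phi> x = 1" using F1[of x] less by (simp only: \<Phi>_def) simp
  qed
qed

section \<open>Distributional derivatives on the open half-line\<close>

lemma test_function_iff:
  "test_function \<phi> \<longleftrightarrow> smooth \<phi> \<and> (\<exists>a b. 0 < a \<and> a \<le> b \<and> (\<forall>t. t \<notin> {a..b} \<longrightarrow> \<phi> t = 0))"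
  by (simp add: test_function_def smooth_def)

lemma set_lebesgue_integral_eqI_support:
  assumes "\<And>t. t \<in> A \<Longrightarrow> t \<notin> B \<Longrightarrow> f t = 0" "B \<subseteq> A"
  shows "(LINT t:A|M. f t) = (LINT t:B|M. (f t :: real))"
  unfolding set_lebesgue_integral_def
  by (intro Bochner_Integration.integral_cong refl) (use assms in \<open>auto simp: indicator_def\<close>)

lemma set_integrable_lebesgue_continuous:
  fixes h :: "real \<Rightarrow> real"
  assumes "continuous_on {a..b} h" shows "set_integrable lebesgue {a..b} h"
  using absolutely_integrable_continuous_real[OF assms] .

lemma set_integral_FTC:
  fixes F f :: "real \<Rightarrow> real"
  assumes "a \<le> b" "\<And>t. t \<in> {a..b} \<Longrightarrow> (F has_real_derivative f t) (at t)" "continuous_on {a..b} f"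
  shows "(LINT t:{a..b}|lebesgue. f t) = F b - F a"
proof -
  have "(f has_integral (F b - F a)) {a..b}"
    by (rule fundamental_theorem_of_calculus)
       (use assms in \<open>auto simp: has_real_derivative_iff_has_vector_derivative[symmetric] intro: has_field_derivative_at_within\<close>)
  then show ?thesis
    using set_lebesgue_integral_eq_integral(2)[OF set_integrable_lebesgue_continuous[OF assms(3)]]
    by (simp add: integral_unique)
qed

lemma deriv_eq_0_outside:
  fixes \<phi> :: "real \<Rightarrow> real"
  assumes "\<And>t. t \<notin> {a..b} \<Longrightarrow> \<phi> t = 0" "t \<notin> {a..b}"
  shows "deriv \<phi> t = 0"
proof (rule DERIV_imp_deriv)
  show "(\<phi> has_real_derivative 0) (at t)"
    by (rule has_field_derivative_transform_within_open[OF DERIV_const, of "- {a..b}"])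
       (use assms in \<open>auto simp: open_Compl\<close>)
qed

lemma distr_deriv_of_DERIV:
  fixes f g :: "real \<Rightarrow> real"
  assumes f: "\<And>t. (f has_real_derivative g t) (at t)" and g: "continuous_on UNIV g"
  shows "distr_deriv f g"
proof -
  have fc: "continuous_on A f" for A
    using f by (meson DERIV_isCont continuous_at_imp_continuous_on)
  have gc: "continuous_on A g" for A
    using g continuous_on_subset by blast
  show ?thesis
    unfolding distr_deriv_def
  proof (intro conjI allI impI set_integrable_lebesgue_continuous fc gc)
    fix \<phi> assume "test_function \<phi>"
    then obtain a b where sm: "smooth \<phi>" and ab: "0 < a" "a \<le> b" "\<And>t. t \<notin> {a..b} \<Longrightarrow> \<phi> t = 0"
      unfolding test_function_iff by blast
    note d0 = deriv_eq_0_outside[of a b \<phi>, OF ab(3)]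
    \<comment> \<open>Both endpoints lie outside the support interval [a,b], so the boundary terms
      of f \<phi> vanish, and a/2 > 0 keeps the interval inside the half-line.\<close>
    let ?I = "{a/2..b+1}"
    have c: "continuous_on ?I (\<lambda>t. f t * deriv \<phi> t)" "continuous_on ?I (\<lambda>t. g t * \<phi> t)"
      by (intro continuous_intros fc gc smooth_continuous smooth_deriv sm)+
    have "(LINT t:?I|lebesgue. f t * deriv \<phi> t + g t * \<phi> t) = f (b+1) * \<phi> (b+1) - f (a/2) * \<phi> (a/2)"
      using ab by (intro set_integral_FTC continuous_intros c)
        (auto intro!: derivative_eq_intros f smooth_DERIV[OF sm])
    also have "\<dots> = 0" using ab by auto
    finally have "(LINT t:?I|lebesgue. f t * deriv \<phi> t) = - (LINT t:?I|lebesgue. g t * \<phi> t)"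
      using set_integral_add(2)[OF c[THEN set_integrable_lebesgue_continuous]] by simp
    moreover have "(LINT t:{0<..}|lebesgue. f t * deriv \<phi> t) = (LINT t:?I|lebesgue. f t * deriv \<phi> t)"
      by (rule set_lebesgue_integral_eqI_support) (use ab d0 in auto)
    moreover have "(LINT t:{0<..}|lebesgue. g t * \<phi> t) = (LINT t:?I|lebesgue. g t * \<phi> t)"
      by (rule set_lebesgue_integral_eqI_support) (use ab in auto)
    ultimately show "(LINT t:{0<..}|lebesgue. f t * deriv \<phi> t) = - (LINT t:{0<..}|lebesgue. g t * \<phi> t)"
      by simp
  qed
qed

lemma set_integrable_mult_continuous:
  fixes f h :: "real \<Rightarrow> real"
  assumes f: "set_integrable lebesgue {a..b} f" and h: "continuous_on {a..b} h"
  shows "set_integrable lebesgue {a..b} (\<lambda>t. f t * h t)"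
  using absolutely_integrable_bounded_measurable_product_real[OF _ _ _ f, of h]
    compact_imp_bounded[OF compact_continuous_image[OF h compact_Icc]]
    continuous_imp_measurable_on_sets_lebesgue[OF h]
  by (simp add: mult.commute)

text \<open>The exponential is moved onto the test function: \<psi> = exp(c t) \<phi> is again a
  test function, and \<psi>' = exp(c t) (\<phi>' + c \<phi>) splits off the term c f.\<close>

lemma distr_deriv_mult_exp:
  assumes fg: "distr_deriv f g"
  shows "distr_deriv (\<lambda>t. f t * exp (c * t)) (\<lambda>t. (g t + c * f t) * exp (c * t))"
  unfolding distr_deriv_def
proof (intro conjI allI impI)
  have I: "set_integrable lebesgue {a..b} f" "set_integrable lebesgue {a..b} g" if "0 < a" "a \<le> b" for a b
    using fg that unfolding distr_deriv_def by auto
  fix a b :: real assume ab: "0 < a \<and> a \<le> b"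
  show "set_integrable lebesgue {a..b} (\<lambda>t. f t * exp (c * t))"
    "set_integrable lebesgue {a..b} (\<lambda>t. (g t + c * f t) * exp (c * t))"
    using ab by (auto intro!: set_integrable_mult_continuous continuous_intros I set_integral_add set_integrable_mult_right)
next
  fix \<phi> assume "test_function \<phi>"
  then obtain a b where sm: "smooth \<phi>" and ab: "0 < a" "a \<le> b" "\<And>t. t \<notin> {a..b} \<Longrightarrow> \<phi> t = 0"
    unfolding test_function_iff by blast
  note d0 = deriv_eq_0_outside[of a b \<phi>, OF ab(3)]
  have I: "set_integrable lebesgue {a..b} f" "set_integrable lebesgue {a..b} g"
    using fg ab unfolding distr_deriv_def by auto
  define \<psi> where "\<psi> t = exp (c * t) * \<phi> t" for t
  have sm\<psi>: "smooth \<psi>" unfolding \<psi>_def by (intro smooth_mult smooth_exp sm)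
  then have "test_function \<psi>" unfolding test_function_iff using ab by (auto simp: \<psi>_def)
  then have eq: "(LINT t:{0<..}|lebesgue. f t * deriv \<psi> t) = - (LINT t:{0<..}|lebesgue. g t * \<psi> t)"
    using fg unfolding distr_deriv_def by blast
  have D: "deriv \<psi> t = exp (c * t) * (deriv \<phi> t + c * \<phi> t)" for t
    unfolding \<psi>_def by (rule DERIV_imp_deriv)
      (auto intro!: derivative_eq_intros smooth_DERIV[OF sm] simp: algebra_simps)
  have R: "(LINT t:{0<..}|lebesgue. h t) = (LINT t:{a..b}|lebesgue. h t)"
    if "\<And>t. t \<notin> {a..b} \<Longrightarrow> h t = 0" for h :: "real \<Rightarrow> real"
    by (rule set_lebesgue_integral_eqI_support) (use ab that in auto)
  have i1: "set_integrable lebesgue {a..b} (\<lambda>t. f t * (exp (c * t) * deriv \<phi> t))"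
    and i2: "set_integrable lebesgue {a..b} (\<lambda>t. f t * (c * exp (c * t) * \<phi> t))"
    and i3: "set_integrable lebesgue {a..b} (\<lambda>t. g t * (exp (c * t) * \<phi> t))"
    by (intro set_integrable_mult_continuous I continuous_intros smooth_continuous smooth_deriv sm)+
  have "(LINT t:{a..b}|lebesgue. f t * (exp (c * t) * deriv \<phi> t)) + (LINT t:{a..b}|lebesgue. f t * (c * exp (c * t) * \<phi> t))
      = (LINT t:{a..b}|lebesgue. f t * deriv \<psi> t)"
    by (subst set_integral_add(2)[OF i1 i2, symmetric]) (simp add: D algebra_simps)
  also have "\<dots> = - (LINT t:{a..b}|lebesgue. g t * (exp (c * t) * \<phi> t))"
  proof -
    have "(LINT t:{0<..}|lebesgue. f t * deriv \<psi> t) = (LINT t:{a..b}|lebesgue. f t * deriv \<psi> t)"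
      "(LINT t:{0<..}|lebesgue. g t * \<psi> t) = (LINT t:{a..b}|lebesgue. g t * \<psi> t)"
      using ab(3) d0 by (intro R; simp add: D \<psi>_def)+
    then show ?thesis using eq by (simp add: \<psi>_def)
  qed
  finally have "(LINT t:{a..b}|lebesgue. f t * (exp (c * t) * deriv \<phi> t)) =
     - ((LINT t:{a..b}|lebesgue. g t * (exp (c * t) * \<phi> t)) + (LINT t:{a..b}|lebesgue. f t * (c * exp (c * t) * \<phi> t)))"
    by simp
  also have "\<dots> = - (LINT t:{a..b}|lebesgue. (g t + c * f t) * exp (c * t) * \<phi> t)"
    by (subst set_integral_add(2)[OF i3 i2, symmetric]) (simp add: algebra_simps)
  finally have *: "(LINT t:{a..b}|lebesgue. f t * (exp (c * t) * deriv \<phi> t)) =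
     - (LINT t:{a..b}|lebesgue. (g t + c * f t) * exp (c * t) * \<phi> t)" .
  show "(LINT t:{0<..}|lebesgue. f t * exp (c * t) * deriv \<phi> t) =
    - (LINT t:{0<..}|lebesgue. (g t + c * f t) * exp (c * t) * \<phi> t)"
  proof -
    have "(LINT t:{0<..}|lebesgue. f t * exp (c * t) * deriv \<phi> t) = (LINT t:{a..b}|lebesgue. f t * exp (c * t) * deriv \<phi> t)"
      "(LINT t:{0<..}|lebesgue. (g t + c * f t) * exp (c * t) * \<phi> t) = (LINT t:{a..b}|lebesgue. (g t + c * f t) * exp (c * t) * \<phi> t)"
      using ab(3) d0 by (intro R; simp)+
    then show ?thesis
      using * by (simp add: mult.assoc)
  qed
qed

text \<open>Testing with smooth approximations of the indicator of (s,t]: on one side their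
  derivatives concentrate at \<open>s\<close> and \<open>t\<close>, and continuity of
  \<open>f\<close> recovers its values there; on the other side dominated convergence gives the
  integral of \<open>g\<close>. Continuity is what turns a relation between classes of functions
  into one between point values.\<close>

lemma distr_deriv_FTC:
  assumes fg: "distr_deriv f g" and f: "continuous_on {0<..} f" and st: "0 < s" "s \<le> t"
  shows "f t - f s = (LINT \<tau>:{s..t}|lebesgue. g \<tau>)"
proof -
  obtain \<Phi> where sm: "smooth \<Phi>" and \<Phi>0: "\<And>x. x \<le> 0 \<Longrightarrow> \<Phi> x = 0" and \<Phi>1: "\<And>x. x \<ge> 1 \<Longrightarrow> \<Phi> x = 1"
    and pos: "\<And>x. deriv \<Phi> x \<ge> 0"
    using smooth_step_exists by blast
  have bd: "0 \<le> \<Phi> x \<and> \<Phi> x \<le> 1" for x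
  proof -
    have mono: "\<Phi> a \<le> \<Phi> b" if "a \<le> b" for a b
      by (rule DERIV_nonneg_imp_nondecreasing[OF that]) (use smooth_DERIV[OF sm] pos in blast)
    show ?thesis
      using mono[of "min x 0" x] mono[of x "max x 1"] \<Phi>0[of "min x 0"] \<Phi>1[of "max x 1"] by auto
  qed
  \<comment> \<open>\<open>h n r\<close> is 0 up to r and 1 from r + 1/(n+1) on. The transition lies
    to the right of r, which is why the working interval below is [s,t+1].\<close>
  define h where "h n r x = \<Phi> (real (Suc n) * x + - (real (Suc n) * r))" for n r x
  have smh: "smooth (h n r)" for n r unfolding h_def by (intro smooth_affine sm)
  have Dh: "deriv (h n r) x \<ge> 0" for n r x
  proof -
    have "(h n r has_real_derivative real (Suc n) * deriv \<Phi> (real (Suc n) * x + - (real (Suc n) * r))) (at x)"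
    proof -
      have "((\<lambda>x. real (Suc n) * x + - (real (Suc n) * r)) has_real_derivative real (Suc n)) (at x)"
        by (auto intro!: derivative_eq_intros)
      from DERIV_chain2[OF smooth_DERIV[OF sm] this] show ?thesis
        unfolding h_def by (simp only: mult.commute)
    qed
    then show ?thesis using DERIV_imp_deriv pos by (metis mult_nonneg_nonneg of_nat_0_le_iff)
  qed
  have h0: "h n r x = 0" if "x \<le> r" for n r x
    unfolding h_def by (rule \<Phi>0) (use that in \<open>simp add: mult_left_mono\<close>)
  have h1: "h n r x = 1" if "x \<ge> r + 1 / real (Suc n)" for n r x
  proof -
    have "real (Suc n) * (r + 1 / real (Suc n)) \<le> real (Suc n) * x"
      using that by (intro mult_left_mono) auto
    also have "real (Suc n) * (r + 1 / real (Suc n)) = real (Suc n) * r + 1" by (simp add: field_simps)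
    finally show ?thesis unfolding h_def by (intro \<Phi>1) linarith
  qed
  have hbd: "0 \<le> h n r x \<and> h n r x \<le> 1" for n r x unfolding h_def by (rule bd)
  have lim_h: "(\<lambda>n. h n r x) \<longlonglongrightarrow> (if r < x then 1 else 0)" for r x
  proof (cases "r < x")
    case True
    have "\<forall>\<^sub>F n in sequentially. 1 / real (Suc n) < x - r"
      using True order_tendstoD(2)[OF LIMSEQ_Suc[OF lim_1_over_n]] by (metis diff_gt_0_iff_gt)
    then have "\<forall>\<^sub>F n in sequentially. h n r x = 1"
      by eventually_elim (rule h1, linarith)
    then show ?thesis using True by (simp add: tendsto_eventually)
  qed (use h0 in auto)
  have inv1: "1 / real (Suc n) \<le> 1" for n by simp
  have Dout: "deriv (h n r) x = 0" if "x \<notin> {r..r + 1 / real (Suc n)}" for n r x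
  proof (rule DERIV_imp_deriv)
    show "(h n r has_real_derivative 0) (at x)"
    proof (cases "x < r")
      case True
      show ?thesis
        by (rule has_field_derivative_transform_within_open[OF DERIV_const[of 0], of "{..<r}"])
           (use True h0 in auto)
    next
      case False
      show ?thesis
        by (rule has_field_derivative_transform_within_open[OF DERIV_const[of 1], of "{r + 1 / real (Suc n)<..}"])
           (use False that h1 in auto)
    qed
  qed
  have intf: "set_integrable lebesgue {s..t+1} f" and intg: "set_integrable lebesgue {s..t+1} g"
    using fg st unfolding distr_deriv_def by auto
  have id: "(LINT \<tau>:{s..t+1}|lebesgue. f \<tau> * deriv (h n s) \<tau>) - (LINT \<tau>:{s..t+1}|lebesgue. f \<tau> * deriv (h n t) \<tau>) =
    - (LINT \<tau>:{s..t+1}|lebesgue. g \<tau> * (h n s \<tau> - h n t \<tau>))" for n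
  proof -
    let ?\<phi> = "\<lambda>\<tau>. h n s \<tau> - h n t \<tau>"
    have s\<phi>: "smooth ?\<phi>" by (intro smooth_diff smh)
    have sp: "?\<phi> \<tau> = 0" if "\<tau> \<notin> {s..t+1}" for \<tau>
    proof (cases "\<tau> < s")
      case False
      then have "\<tau> \<ge> s + 1 / real (Suc n)" "\<tau> \<ge> t + 1 / real (Suc n)"
        using that inv1[of n] st unfolding atLeastAtMost_iff by linarith+
      then show ?thesis using h1[of s n \<tau>] h1[of t n \<tau>] by simp
    qed (use h0 st in auto)
    have "test_function ?\<phi>"
      unfolding test_function_iff using s\<phi> sp st by (intro conjI exI[of _ s] exI[of _ "t+1"]) auto
    then have "(LINT \<tau>:{0<..}|lebesgue. f \<tau> * deriv ?\<phi> \<tau>) = - (LINT \<tau>:{0<..}|lebesgue. g \<tau> * ?\<phi> \<tau>)"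
      using fg unfolding distr_deriv_def by blast
    moreover have "(LINT \<tau>:{0<..}|lebesgue. f \<tau> * deriv ?\<phi> \<tau>) = (LINT \<tau>:{s..t+1}|lebesgue. f \<tau> * deriv ?\<phi> \<tau>)"
      by (rule set_lebesgue_integral_eqI_support)
         (use st deriv_eq_0_outside[of s "t+1" ?\<phi>, OF sp] in auto)
    moreover have "(LINT \<tau>:{0<..}|lebesgue. g \<tau> * ?\<phi> \<tau>) = (LINT \<tau>:{s..t+1}|lebesgue. g \<tau> * ?\<phi> \<tau>)"
      by (rule set_lebesgue_integral_eqI_support) (use st sp in auto)
    moreover have "deriv ?\<phi> \<tau> = deriv (h n s) \<tau> - deriv (h n t) \<tau>" for \<tau>
      by (rule DERIV_imp_deriv) (intro DERIV_diff smooth_DERIV smh)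
    moreover have "set_integrable lebesgue {s..t+1} (\<lambda>\<tau>. f \<tau> * deriv (h n r) \<tau>)" for r
      by (intro set_integrable_mult_continuous intf smooth_continuous smooth_deriv smh)
    ultimately show ?thesis by (simp add: right_diff_distrib)
  qed
  \<comment> \<open>\<open>deriv (h n r)\<close> is nonnegative, has integral 1 and lives on
    [r, r + 1/(n+1)], so it acts as an approximate point mass at r.\<close>
  have lim_f: "(\<lambda>n. (LINT \<tau>:{s..t+1}|lebesgue. f \<tau> * deriv (h n r) \<tau>)) \<longlonglongrightarrow> f r" if r: "s \<le> r" "r \<le> t" for r
  proof (rule LIMSEQ_I)
    fix e :: real assume e: "e > 0"
    have "continuous_on {0<..} f" "r \<in> {0<..}" using f r st by auto
    then obtain d where d: "d > 0" "\<And>x. x \<in> {0<..} \<Longrightarrow> dist x r < d \<Longrightarrow> dist (f x) (f r) < e / 2"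
      using e unfolding continuous_on_iff by (meson half_gt_zero)
    obtain N where N: "1 / real (Suc N) < d" using nat_approx_posE[OF d(1)] by (metis inverse_eq_divide)
    have "norm ((LINT \<tau>:{s..t+1}|lebesgue. f \<tau> * deriv (h n r) \<tau>) - f r) < e" if n: "n \<ge> N" for n
    proof -
      let ?D = "deriv (h n r)"
      have nd: "1 / real (Suc n) < d"
        using N n by (smt (verit) frac_le of_nat_0_less_iff of_nat_mono Suc_le_mono zero_less_Suc)
      have iD: "set_integrable lebesgue {s..t+1} ?D"
        by (intro set_integrable_lebesgue_continuous smooth_continuous smooth_deriv smh)
      have ifD: "set_integrable lebesgue {s..t+1} (\<lambda>\<tau>. f \<tau> * ?D \<tau>)"
        by (intro set_integrable_mult_continuous intf smooth_continuous smooth_deriv smh)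
      have D1: "(LINT \<tau>:{s..t+1}|lebesgue. ?D \<tau>) = 1"
      proof -
        have "(LINT \<tau>:{s..t+1}|lebesgue. ?D \<tau>) = h n r (t+1) - h n r s"
          using st by (intro set_integral_FTC smooth_continuous smooth_deriv smh smooth_DERIV) auto
        also have "\<dots> = 1" using h0[of s r n] h1[of r n "t+1"] r inv1[of n] by (simp del: of_nat_Suc)
        finally show ?thesis .
      qed
      have le: "\<bar>f \<tau> * ?D \<tau> - f r * ?D \<tau>\<bar> \<le> e / 2 * ?D \<tau>" if \<tau>: "\<tau> \<in> {s..t+1}" for \<tau>
      proof (cases "\<tau> \<in> {r..r + 1 / real (Suc n)}")
        case True
        then have "\<bar>f \<tau> - f r\<bar> \<le> e / 2"
          using d(2)[of \<tau>] nd \<tau> st by (auto simp: dist_real_def)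
        then have "\<bar>f \<tau> - f r\<bar> * \<bar>?D \<tau>\<bar> \<le> e / 2 * ?D \<tau>"
          using Dh[of n r \<tau>] by (simp only: abs_of_nonneg mult_right_mono)
        then show ?thesis
          by (simp only: left_diff_distrib[symmetric] abs_mult)
      qed (simp add: Dout)
      have "\<bar>(LINT \<tau>:{s..t+1}|lebesgue. f \<tau> * ?D \<tau>) - f r\<bar>
        = \<bar>LINT \<tau>:{s..t+1}|lebesgue. f \<tau> * ?D \<tau> - f r * ?D \<tau>\<bar>"
        using ifD iD D1 by simp
      also have "\<dots> \<le> (LINT \<tau>:{s..t+1}|lebesgue. \<bar>f \<tau> * ?D \<tau> - f r * ?D \<tau>\<bar>)"
        using set_integral_norm_bound[of lebesgue "{s..t+1}" "\<lambda>\<tau>. f \<tau> * ?D \<tau> - f r * ?D \<tau>"] ifD iD by auto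
      also have "\<dots> \<le> (LINT \<tau>:{s..t+1}|lebesgue. e / 2 * ?D \<tau>)"
        using le ifD iD by (intro set_integral_mono set_integrable_abs) auto
      also have "\<dots> = e / 2" using D1 by simp
      finally show ?thesis using e by simp
    qed
    then show "\<exists>no. \<forall>n\<ge>no. norm ((LINT \<tau>:{s..t+1}|lebesgue. f \<tau> * deriv (h n r) \<tau>) - f r) < e" by blast
  qed
  have "(\<lambda>x. (if s < x then 1 else 0) - (if t < x then 1 else 0 :: real)) \<in> borel_measurable borel"
    by measurable
  then have step: "(\<lambda>x. (if s < x then 1 else 0) - (if t < x then 1 else 0 :: real)) \<in> borel_measurable lebesgue"
    by (rule borel_measurable_lebesgueI)
  have lim_g: "(\<lambda>n. LINT \<tau>:{s..t+1}|lebesgue. g \<tau> * (h n s \<tau> - h n t \<tau>))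
    \<longlonglongrightarrow> (LINT \<tau>:{s..t+1}|lebesgue. g \<tau> * ((if s < \<tau> then 1 else 0) - (if t < \<tau> then 1 else 0)))"
    unfolding set_lebesgue_integral_def
  proof (rule integral_dominated_convergence[where w="\<lambda>\<tau>. norm (indicator {s..t+1} \<tau> *\<^sub>R g \<tau>)"])
    show "integrable lebesgue (\<lambda>\<tau>. norm (indicator {s..t+1} \<tau> *\<^sub>R g \<tau>))"
      using intg by (auto simp: set_integrable_def)
    show "(\<lambda>\<tau>. indicator {s..t+1} \<tau> *\<^sub>R (g \<tau> * (h n s \<tau> - h n t \<tau>))) \<in> borel_measurable lebesgue" for n
      by (rule borel_measurable_integrable, fold set_integrable_def)
         (intro set_integrable_mult_continuous intg continuous_intros smooth_continuous smh)
    have "(\<lambda>\<tau>. (indicator {s..t+1} \<tau> *\<^sub>R g \<tau>) * ((if s < \<tau> then 1 else 0) - (if t < \<tau> then 1 else 0))) \<in> borel_measurable lebesgue"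
      using intg step by (intro borel_measurable_times) (simp_all add: set_integrable_def borel_measurable_integrable)
    then show "(\<lambda>\<tau>. indicator {s..t+1} \<tau> *\<^sub>R (g \<tau> * ((if s < \<tau> then 1 else 0) - (if t < \<tau> then 1 else 0)))) \<in> borel_measurable lebesgue"
      by (simp add: mult.assoc)
    show "AE \<tau> in lebesgue. (\<lambda>n. indicator {s..t+1} \<tau> *\<^sub>R (g \<tau> * (h n s \<tau> - h n t \<tau>))) \<longlonglongrightarrow>
       indicator {s..t+1} \<tau> *\<^sub>R (g \<tau> * ((if s < \<tau> then 1 else 0) - (if t < \<tau> then 1 else 0)))"
      by (intro AE_I2 tendsto_intros lim_h)
    have "\<bar>h n s \<tau> - h n t \<tau>\<bar> \<le> 1" for n \<tau> using hbd[of n s \<tau>] hbd[of n t \<tau>] by linarith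
    then show "AE \<tau> in lebesgue. norm (indicator {s..t+1} \<tau> *\<^sub>R (g \<tau> * (h n s \<tau> - h n t \<tau>))) \<le> norm (indicator {s..t+1} \<tau> *\<^sub>R g \<tau>)" for n
      by (intro AE_I2) (auto simp: abs_mult indicator_def intro: mult_left_le)
  qed
  have "(\<lambda>n. - (LINT \<tau>:{s..t+1}|lebesgue. g \<tau> * (h n s \<tau> - h n t \<tau>))) \<longlonglongrightarrow> f s - f t"
    unfolding id[symmetric] using st by (intro tendsto_diff lim_f) auto
  from LIMSEQ_unique[OF this tendsto_minus[OF lim_g]]
  have "f t - f s = (LINT \<tau>:{s..t+1}|lebesgue. g \<tau> * ((if s < \<tau> then 1 else 0) - (if t < \<tau> then 1 else 0)))"
    by simp
  also have "\<dots> = (LINT \<tau>:{s..t}|lebesgue. g \<tau>)"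
    unfolding set_lebesgue_integral_def
  proof (rule integral_cong_AE)
    have "(\<lambda>\<tau>. (indicator {s..t+1} \<tau> *\<^sub>R g \<tau>) * ((if s < \<tau> then 1 else 0) - (if t < \<tau> then 1 else 0))) \<in> borel_measurable lebesgue"
      using intg step by (intro borel_measurable_times) (simp_all add: set_integrable_def borel_measurable_integrable)
    then show "(\<lambda>\<tau>. indicator {s..t+1} \<tau> *\<^sub>R (g \<tau> * ((if s < \<tau> then 1 else 0) - (if t < \<tau> then 1 else 0)))) \<in> borel_measurable lebesgue"
      by (simp add: mult.assoc)
    show "(\<lambda>\<tau>. indicator {s..t} \<tau> *\<^sub>R g \<tau>) \<in> borel_measurable lebesgue"
      using fg st unfolding distr_deriv_def set_integrable_def by blast
    \<comment> \<open>The limit weight is the indicator of (s,t], which differs from that of [s,t]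
      only at s.\<close>
    have "AE \<tau> in lebesgue. \<tau> \<noteq> s" by (rule AE_completion) (rule AE_lborel_singleton)
    then show "AE \<tau> in lebesgue. indicator {s..t+1} \<tau> *\<^sub>R (g \<tau> * ((if s < \<tau> then 1 else 0) - (if t < \<tau> then 1 else 0)))
       = indicator {s..t} \<tau> *\<^sub>R g \<tau>"
      by eventually_elim (use st in \<open>auto simp: indicator_def\<close>)
  qed
  finally show ?thesis .
qed

section \<open>Semi-inner products and Bochner measurability\<close>

text \<open>Shared by the L2 form, the gradient form and their sum. The carrier is explicit because
  the type \<open>vfield\<close> also holds fields that are neither periodic nor square integrable,
  and the form is only semidefinite because the gradient form vanishes on constant fields.\<close>

locale semi_inner =
  fixes X :: "'a::real_vector set" and I :: "'a \<Rightarrow> 'a \<Rightarrow> real"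
  assumes subspace: "subspace X"
    and commute: "x \<in> X \<Longrightarrow> y \<in> X \<Longrightarrow> I x y = I y x"
    and add_left: "x \<in> X \<Longrightarrow> y \<in> X \<Longrightarrow> z \<in> X \<Longrightarrow> I (x + y) z = I x z + I y z"
    and scale_left: "x \<in> X \<Longrightarrow> z \<in> X \<Longrightarrow> I (a *\<^sub>R x) z = a * I x z"
    and nonneg: "x \<in> X \<Longrightarrow> 0 \<le> I x x"
begin

lemmas closed = subspace_0[OF subspace] subspace_add[OF subspace] subspace_diff[OF subspace]
  subspace_scale[OF subspace] subspace_neg[OF subspace] subspace_sum[OF subspace]

lemma add_right: "x \<in> X \<Longrightarrow> y \<in> X \<Longrightarrow> z \<in> X \<Longrightarrow> I z (x + y) = I z x + I z y"
  using commute add_left closed by metis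

lemma scale_right: "x \<in> X \<Longrightarrow> z \<in> X \<Longrightarrow> I z (a *\<^sub>R x) = a * I z x"
  using commute scale_left closed by metis

lemma diff_left: "x \<in> X \<Longrightarrow> y \<in> X \<Longrightarrow> z \<in> X \<Longrightarrow> I (x - y) z = I x z - I y z"
  using add_left[of x "- 1 *\<^sub>R y" z] scale_left[of y z "-1"] closed by simp

lemma diff_right: "x \<in> X \<Longrightarrow> y \<in> X \<Longrightarrow> z \<in> X \<Longrightarrow> I z (x - y) = I z x - I z y"
  using commute diff_left closed by metis

lemma zero_left: "z \<in> X \<Longrightarrow> I 0 z = 0"
  using scale_left[of 0 z 0] closed by simp

lemma sum_left:
  assumes "\<And>m. m \<in> M \<Longrightarrow> w m \<in> X" "z \<in> X"
  shows "I (\<Sum>m\<in>M. c m *\<^sub>R w m) z = (\<Sum>m\<in>M. c m * I (w m) z)"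
  using assms(1)
proof (induction M rule: infinite_finite_induct)
  case (insert x F)
  then have "(\<Sum>m\<in>F. c m *\<^sub>R w m) \<in> X" "w x \<in> X" by (auto intro!: closed)
  then show ?case using insert assms(2) by (simp add: add_left scale_left closed)
qed (simp_all add: zero_left assms(2))

lemma sum_right:
  assumes "\<And>m. m \<in> M \<Longrightarrow> w m \<in> X" "z \<in> X"
  shows "I z (\<Sum>m\<in>M. c m *\<^sub>R w m) = (\<Sum>m\<in>M. c m * I z (w m))"
proof -
  have "(\<Sum>m\<in>M. c m *\<^sub>R w m) \<in> X" using assms by (auto intro!: closed)
  then have "I z (\<Sum>m\<in>M. c m *\<^sub>R w m) = (\<Sum>m\<in>M. c m * I (w m) z)"
    using commute[OF assms(2)] sum_left[OF assms] by simp
  also have "\<dots> = (\<Sum>m\<in>M. c m * I z (w m))"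
    using assms commute by (intro sum.cong) auto
  finally show ?thesis .
qed

definition nrm :: "'a \<Rightarrow> real" where "nrm x = sqrt (I x x)"

lemma nrm_nonneg: "x \<in> X \<Longrightarrow> 0 \<le> nrm x"
  by (simp add: nrm_def nonneg)

lemma nrm_sq: "x \<in> X \<Longrightarrow> (nrm x)\<^sup>2 = I x x"
  by (simp add: nrm_def nonneg)

lemma nrm_zero: "nrm 0 = 0"
  using zero_left closed by (simp add: nrm_def)

lemma nrm_scale: "x \<in> X \<Longrightarrow> nrm (a *\<^sub>R x) = \<bar>a\<bar> * nrm x"
  using closed by (simp add: nrm_def scale_left scale_right real_sqrt_mult flip: mult.assoc)

lemma Cauchy_Schwarz:
  assumes x: "x \<in> X" and y: "y \<in> X"
  shows "\<bar>I x y\<bar> \<le> nrm x * nrm y"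
proof -
  have pos: "0 \<le> I x x + 2 * t * I x y + t\<^sup>2 * I y y" for t
  proof -
    have "0 \<le> I (x + t *\<^sub>R y) (x + t *\<^sub>R y)" using x y closed by (intro nonneg) auto
    also have "\<dots> = I x x + 2 * t * I x y + t\<^sup>2 * I y y"
      using x y closed commute[OF x y]
      by (simp add: add_left add_right scale_left scale_right power2_eq_square algebra_simps)
    finally show ?thesis .
  qed
  have "(I x y)\<^sup>2 \<le> I x x * I y y"
  \<comment> \<open>For a degenerate \<open>y\<close> the nonnegative quadratic in \<open>t\<close>
    is affine, so its slope must vanish; otherwise its minimum at t = - I x y / I y y gives the
    inequality.\<close>
  proof (cases "I y y = 0")
    case True
    have "I x y = 0"
    proof (rule ccontr)
      assume "I x y \<noteq> 0"
      then have "I x x + 2 * (- (I x x + 1) / (2 * I x y)) * I x y = -1" by (simp add: field_simps)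
      then show False using pos[of "- (I x x + 1) / (2 * I x y)"] True by simp
    qed
    then show ?thesis using True by simp
  next
    case False
    then have p: "I y y > 0" using nonneg[OF y] by simp
    have "0 \<le> I x x - (I x y)\<^sup>2 / I y y"
      using pos[of "- I x y / I y y"] p by (simp add: field_simps power2_eq_square)
    then show ?thesis using p by (simp add: field_simps)
  qed
  then show ?thesis
    by (metis nrm_def real_sqrt_abs real_sqrt_le_mono real_sqrt_mult)
qed

lemma nrm_triangle:
  assumes x: "x \<in> X" and y: "y \<in> X"
  shows "nrm (x + y) \<le> nrm x + nrm y"
proof -
  have "(nrm (x + y))\<^sup>2 = I x x + 2 * I x y + I y y"
    using x y closed commute[OF x y] by (simp add: nrm_sq add_left add_right)
  also have "\<dots> \<le> (nrm x)\<^sup>2 + 2 * (nrm x * nrm y) + (nrm y)\<^sup>2"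
    using Cauchy_Schwarz[OF x y] x y by (simp add: nrm_sq)
  also have "\<dots> = (nrm x + nrm y)\<^sup>2" by (simp add: power2_eq_square algebra_simps)
  finally show ?thesis using nrm_nonneg x y by (meson add_nonneg_nonneg power2_le_imp_le)
qed

lemma nrm_minus: "x \<in> X \<Longrightarrow> nrm (- x) = nrm x"
  using nrm_scale[of x "-1"] by simp

lemma nrm_sum:
  assumes "\<And>m. m \<in> M \<Longrightarrow> w m \<in> X"
  shows "nrm (\<Sum>m\<in>M. c m *\<^sub>R w m) \<le> (\<Sum>m\<in>M. \<bar>c m\<bar> * nrm (w m))"
  using assms
proof (induction M rule: infinite_finite_induct)
  case (insert x F)
  then have "(\<Sum>m\<in>F. c m *\<^sub>R w m) \<in> X" "c x *\<^sub>R w x \<in> X" "w x \<in> X" by (auto intro!: closed)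
  then show ?case using insert nrm_triangle[of "c x *\<^sub>R w x" "\<Sum>m\<in>F. c m *\<^sub>R w m"]
    by (simp add: nrm_scale)
qed (simp_all add: nrm_zero)

lemma nrm_sum_tendsto:
  assumes w: "\<And>m. m \<in> M \<Longrightarrow> w m \<in> X" and c: "\<And>m. m \<in> M \<Longrightarrow> (c m \<longlongrightarrow> c m t) F"
  shows "((\<lambda>s. nrm ((\<Sum>m\<in>M. c m s *\<^sub>R w m) - (\<Sum>m\<in>M. c m t *\<^sub>R w m))) \<longlongrightarrow> 0) F"
proof (rule tendsto_sandwich)
  have eq: "(\<Sum>m\<in>M. c m s *\<^sub>R w m) - (\<Sum>m\<in>M. c m t *\<^sub>R w m) = (\<Sum>m\<in>M. (c m s - c m t) *\<^sub>R w m)" for s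
    by (simp add: sum_subtractf scaleR_left_diff_distrib)
  show "\<forall>\<^sub>F s in F. 0 \<le> nrm ((\<Sum>m\<in>M. c m s *\<^sub>R w m) - (\<Sum>m\<in>M. c m t *\<^sub>R w m))"
    using w by (intro always_eventually allI nrm_nonneg closed) auto
  show "\<forall>\<^sub>F s in F. nrm ((\<Sum>m\<in>M. c m s *\<^sub>R w m) - (\<Sum>m\<in>M. c m t *\<^sub>R w m)) \<le> (\<Sum>m\<in>M. \<bar>c m s - c m t\<bar> * nrm (w m))"
    unfolding eq using w by (intro always_eventually allI nrm_sum)
  have "((\<lambda>s. \<Sum>m\<in>M. \<bar>c m s - c m t\<bar> * nrm (w m)) \<longlongrightarrow> (\<Sum>m\<in>M. \<bar>c m t - c m t\<bar> * nrm (w m))) F"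
    by (intro tendsto_intros c)
  then show "((\<lambda>s. \<Sum>m\<in>M. \<bar>c m s - c m t\<bar> * nrm (w m)) \<longlongrightarrow> 0) F" by simp
qed simp

lemma nrm_sum_continuous:
  assumes w: "\<And>m. m \<in> M \<Longrightarrow> w m \<in> X" and c: "\<And>m. m \<in> M \<Longrightarrow> continuous_on T (c m)"
  shows "continuous_on T (\<lambda>t. nrm (\<Sum>m\<in>M. c m t *\<^sub>R w m))"
proof -
  have "I (\<Sum>m\<in>M. c m t *\<^sub>R w m) (\<Sum>m\<in>M. c m t *\<^sub>R w m) = (\<Sum>m\<in>M. c m t * (\<Sum>l\<in>M. c l t * I (w m) (w l)))" for t
    using w by (subst sum_left) (auto intro!: sum.cong closed simp: sum_right)
  then show ?thesis
    unfolding nrm_def by (auto intro!: continuous_intros c)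
qed

lemma subspace_closure_in:
  assumes "subspace S" "S \<subseteq> X"
  shows "subspace (closure_in X nrm S)"
  unfolding subspace_def
proof (intro conjI ballI allI)
  show "0 \<in> closure_in X nrm S"
    using closed subspace_0[OF assms(1)] by (force simp: closure_in_def nrm_zero intro!: bexI[of _ 0])
next
  fix x y assume "x \<in> closure_in X nrm S" "y \<in> closure_in X nrm S"
  then have X: "x \<in> X" "y \<in> X" and e: "\<And>e. e > 0 \<Longrightarrow> \<exists>v\<in>S. nrm (x - v) < e" "\<And>e. e > 0 \<Longrightarrow> \<exists>v\<in>S. nrm (y - v) < e"
    by (auto simp: closure_in_def)
  show "x + y \<in> closure_in X nrm S"
    unfolding closure_in_def
  proof (intro CollectI conjI allI impI closed X)
    fix e :: real assume "e > 0"
    then obtain v w where vw: "v \<in> S" "w \<in> S" "nrm (x - v) < e / 2" "nrm (y - w) < e / 2"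
      using e half_gt_zero by metis
    have "nrm (x + y - (v + w)) \<le> nrm (x - v) + nrm (y - w)"
      using nrm_triangle[of "x - v" "y - w"] X vw assms closed(3)
      by (metis add_diff_add subsetD)
    then show "\<exists>v\<in>S. nrm (x + y - v) < e"
      using vw subspace_add[OF assms(1)] by (intro bexI[of _ "v + w"]) auto
  qed
next
  fix a :: real and x assume "x \<in> closure_in X nrm S"
  then have X: "x \<in> X" and e: "\<And>e. e > 0 \<Longrightarrow> \<exists>v\<in>S. nrm (x - v) < e"
    by (auto simp: closure_in_def)
  show "a *\<^sub>R x \<in> closure_in X nrm S"
    unfolding closure_in_def
  proof (intro CollectI conjI allI impI closed X)
    fix d :: real assume d: "d > 0"
    \<comment> \<open>The added 1 keeps the quotient meaningful when a = 0.\<close>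
    then obtain v where v: "v \<in> S" "nrm (x - v) < d / (\<bar>a\<bar> + 1)"
      using e[of "d / (\<bar>a\<bar> + 1)"] by (auto simp: field_simps)
    have "nrm (a *\<^sub>R x - a *\<^sub>R v) = \<bar>a\<bar> * nrm (x - v)"
      using nrm_scale[of "x - v" a] X v assms closed(3) by (auto simp: scaleR_diff_right)
    also have "\<dots> \<le> \<bar>a\<bar> * (d / (\<bar>a\<bar> + 1))" using v by (intro mult_left_mono) auto
    also have "\<dots> < d" using d by (simp add: field_simps)
    finally show "\<exists>v\<in>S. nrm (a *\<^sub>R x - v) < d"
      using v subspace_scale[OF assms(1)] by (intro bexI[of _ "a *\<^sub>R v"]) auto
  qed
qed

text \<open>Continuity of the form, in the shape of Cauchy-Schwarz. Orthogonality relations for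
  \<open>Hspace L\<close> thereby reduce to trigonometric fields, where they are statements about
  finitely many coefficients.\<close>

lemma closure_in_orthogonal:
  assumes "x \<in> closure_in X nrm S" "S \<subseteq> X" "z \<in> X" "\<And>v. v \<in> S \<Longrightarrow> I v z = 0"
  shows "I x z = 0"
proof (rule ccontr)
  assume nz: "I x z \<noteq> 0"
  define e where "e = \<bar>I x z\<bar> / (nrm z + 1)"
  have "e > 0" using nz nrm_nonneg[OF assms(3)] by (simp add: e_def field_simps)
  then obtain v where v: "v \<in> S" "nrm (x - v) < e" and x: "x \<in> X"
    using assms(1) by (auto simp: closure_in_def)
  have "\<bar>I x z\<bar> = \<bar>I (x - v) z\<bar>"
    using v x assms by (simp add: diff_left subset_iff)
  also have "\<dots> \<le> nrm (x - v) * nrm z"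
    using v x assms closed by (intro Cauchy_Schwarz) auto
  also have "\<dots> \<le> e * nrm z"
    using v nrm_nonneg[OF assms(3)] by (intro mult_right_mono) auto
  also have "\<dots> < e * (nrm z + 1)" using \<open>e > 0\<close> by simp
  also have "\<dots> = \<bar>I x z\<bar>" using nrm_nonneg[OF assms(3)] by (simp add: e_def)
  finally show False by simp
qed

text \<open>Used to see that L2 limits of sequences in \<open>Hspace L\<close> stay there, which
  together with completeness of L2 makes the projection theorem applicable.\<close>

lemma closure_in_idem:
  assumes "x \<in> X" "S \<subseteq> X" "\<And>e. e > 0 \<Longrightarrow> \<exists>v\<in>closure_in X nrm S. nrm (x - v) < e"
  shows "x \<in> closure_in X nrm S"
  unfolding closure_in_def
proof (intro CollectI conjI allI impI assms(1))
  fix e :: real assume "e > 0"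
  then obtain v where v: "v \<in> closure_in X nrm S" "nrm (x - v) < e / 2" using assms(3) half_gt_zero by metis
  then have "\<forall>d>0. \<exists>w\<in>S. nrm (v - w) < d" by (simp add: closure_in_def)
  then obtain w where w: "w \<in> S" "nrm (v - w) < e / 2" using half_gt_zero[OF \<open>e > 0\<close>] by blast
  have "v \<in> X" using v by (simp add: closure_in_def)
  then have "nrm (x - w) \<le> nrm (x - v) + nrm (v - w)"
    using nrm_triangle[of "x - v" "v - w"] w assms(1,2) closed(3) by (auto simp: subset_iff)
  then show "\<exists>v\<in>S. nrm (x - v) < e" using v w by (intro bexI[of _ w]) auto
qed

lemma parallelogram:
  assumes "a \<in> X" "b \<in> X"
  shows "I (a - b) (a - b) = 2 * I a a + 2 * I b b - 4 * I ((1/2) *\<^sub>R (a + b)) ((1/2) *\<^sub>R (a + b))"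
proof -
  have "I ((1/2) *\<^sub>R (a + b)) ((1/2) *\<^sub>R (a + b)) = 1/4 * I (a + b) (a + b)"
    using assms closed(2)[OF assms] closed(4) by (simp add: scale_left scale_right)
  then show ?thesis
    using assms closed(2,3)[OF assms] by (simp add: add_left add_right diff_left diff_right)
qed

text \<open>A minimizing sequence is Cauchy by the parallelogram identity; completeness is only assumed for
  sequences in \<open>C\<close>.\<close>

lemma projection_exists:
  assumes C: "subspace C" "C \<subseteq> X" and x: "x \<in> X"
    and complete: "\<And>h. (\<And>n. h n \<in> C) \<Longrightarrow> (\<And>e. e > 0 \<Longrightarrow> \<exists>N. \<forall>m\<ge>N. \<forall>n\<ge>N. nrm (h m - h n) < e)
      \<Longrightarrow> \<exists>l\<in>C. (\<lambda>n. nrm (h n - l)) \<longlonglongrightarrow> 0"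
  shows "\<exists>p\<in>C. \<forall>h\<in>C. I (x - p) h = 0"
proof -
  define d where "d = Inf ((\<lambda>h. I (x - h) (x - h)) ` C)"
  have bdd: "bdd_below ((\<lambda>h. I (x - h) (x - h)) ` C)"
    using C x closed by (intro bdd_belowI[of _ 0]) (auto intro!: nonneg)
  have ne: "(\<lambda>h. I (x - h) (x - h)) ` C \<noteq> {}" using subspace_0[OF C(1)] by auto
  have d_le: "d \<le> I (x - h) (x - h)" if "h \<in> C" for h
    unfolding d_def using bdd that by (intro cINF_lower)
  have "\<exists>h\<in>C. I (x - h) (x - h) < d + 1 / real (Suc n)" for n
  proof -
    have "Inf ((\<lambda>h. I (x - h) (x - h)) ` C) < d + 1 / real (Suc n)" by (simp add: d_def)
    then show ?thesis using cInf_less_iff[OF ne bdd] by auto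
  qed
  then obtain h where hC: "\<And>n. h n \<in> C" and h: "\<And>n. I (x - h n) (x - h n) < d + 1 / real (Suc n)"
    by metis
  have hX: "h n \<in> X" for n using hC C by auto
  have cau: "\<exists>N. \<forall>m\<ge>N. \<forall>n\<ge>N. nrm (h m - h n) < e" if e: "e > 0" for e
  proof -
    \<comment> \<open>The squared distance of the midpoint is at least \<open>d\<close>, so the
      parallelogram identity leaves |h m - h n|^2 < 2/(m+1) + 2/(n+1) \<le> 4/(N+1).\<close>
    obtain N where N: "1 / real (Suc N) < e\<^sup>2 / 4"
      using nat_approx_posE[of "e\<^sup>2 / 4"] e by (metis inverse_eq_divide zero_less_divide_iff zero_less_numeral zero_less_power)
    have "nrm (h m - h n) < e" if mn: "m \<ge> N" "n \<ge> N" for m n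
    proof -
      let ?a = "x - h m" and ?b = "x - h n" and ?c = "x - (1/2) *\<^sub>R (h m + h n)"
      have "(1/2) *\<^sub>R (h m + h n) \<in> C"
        using hC C(1) by (intro subspace_scale subspace_add)
      then have 1: "d \<le> I ?c ?c" by (rule d_le)
      have in_X: "?a \<in> X" "?b \<in> X" "?c \<in> X" using hX x closed by auto
      have "?c = (1/2) *\<^sub>R (?b + ?a)" by (simp add: algebra_simps flip: scaleR_left_distrib)
      moreover have "h m - h n = ?b - ?a" by simp
      ultimately have "I (h m - h n) (h m - h n) = 2 * I ?a ?a + 2 * I ?b ?b - 4 * I ?c ?c"
        using parallelogram[OF in_X(2,1)] by (simp only: add.commute)
      moreover have "1 / real (Suc m) \<le> 1 / real (Suc N)" "1 / real (Suc n) \<le> 1 / real (Suc N)"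
        using mn by (auto intro!: frac_le)
      ultimately have "I (h m - h n) (h m - h n) < 4 * (1 / real (Suc N))"
        using 1 h[of m] h[of n] by linarith
      also have "\<dots> < e\<^sup>2" using N by simp
      finally have "(nrm (h m - h n))\<^sup>2 < e\<^sup>2" using hX closed by (simp add: nrm_sq)
      then show ?thesis using e by (simp add: power_less_imp_less_base)
    qed
    then show ?thesis by blast
  qed
  obtain p where p: "p \<in> C" and lim: "(\<lambda>n. nrm (h n - p)) \<longlonglongrightarrow> 0"
    using complete[OF hC cau] by blast
  have pX: "p \<in> X" using p C by auto
  have dle: "(nrm (x - p))\<^sup>2 \<le> d"
  proof -
    have "nrm (x - p) \<le> sqrt (d + 1 / real (Suc n)) + nrm (h n - p)" for n
    proof -
      have "nrm (x - p) \<le> nrm (x - h n) + nrm (h n - p)"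
        using nrm_triangle[of "x - h n" "h n - p"] hX pX x closed by simp
      also have "nrm (x - h n) \<le> sqrt (d + 1 / real (Suc n))"
        using h[of n] unfolding nrm_def by (intro real_sqrt_le_mono) simp
      finally show ?thesis by simp
    qed
    moreover have "(\<lambda>n. sqrt (d + 1 / real (Suc n)) + nrm (h n - p)) \<longlonglongrightarrow> sqrt (d + 0) + 0"
      by (intro tendsto_intros lim LIMSEQ_Suc[OF lim_1_over_n])
    ultimately have "nrm (x - p) \<le> sqrt d"
      by (intro LIMSEQ_le_const[of _ "sqrt d"]) auto
    moreover have "0 \<le> d"
      unfolding d_def using ne C x closed by (intro cINF_greatest) (auto intro!: nonneg)
    ultimately show ?thesis
      using nrm_nonneg[of "x - p"] pX x closed by (metis power_mono real_sqrt_pow2)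
  qed
  have "I (x - p) k = 0" if k: "k \<in> C" for k
  proof -
    have kX: "k \<in> X" and zX: "x - p \<in> X" using k C pX x closed by auto
    \<comment> \<open>First variation: moving from \<open>p\<close> along \<open>k\<close> stays in
      \<open>C\<close>, where the squared distance is at least \<open>d\<close>. A quadratic in
      \<open>t\<close> that is nonnegative everywhere and has no constant term has no linear term
      either.\<close>
    have ineq: "0 \<le> t\<^sup>2 * I k k - 2 * t * I (x - p) k" for t
    proof -
      have "d \<le> I (x - (p + t *\<^sub>R k)) (x - (p + t *\<^sub>R k))"
        using p k C(1) by (intro d_le subspace_add subspace_scale)
      also have "x - (p + t *\<^sub>R k) = (x - p) - t *\<^sub>R k" by simp
      also have "I ((x - p) - t *\<^sub>R k) ((x - p) - t *\<^sub>R k) = I (x - p) (x - p) - 2 * t * I (x - p) k + t\<^sup>2 * I k k"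
        using kX zX closed commute[OF kX zX]
        by (simp only: diff_left[OF zX] diff_right[OF zX] scale_left scale_right closed)
           (simp add: power2_eq_square algebra_simps)
      finally show ?thesis using dle zX by (simp add: nrm_sq)
    qed
    show ?thesis
    proof (cases "I k k = 0")
      case True
      have "I (x - p) k * I (x - p) k \<le> 0" using ineq[of "I (x - p) k"] True by simp
      then show ?thesis by (metis mult_eq_0_iff order_antisym zero_le_square)
    next
      case False
      then have "I k k > 0" using nonneg[OF kX] by simp
      then have "(I (x - p) k)\<^sup>2 \<le> 0"
        using ineq[of "I (x - p) k / I k k"] by (simp add: power2_eq_square field_simps)
      then show ?thesis by simp
    qed
  qed
  then show ?thesis using p by blast
qed

end

text \<open>The simple functions sample \<open>f\<close> on a time grid. \<open>N\<close> is an
  arbitrary function rather than a norm here, and \<open>lim\<close> is a punctured limit, so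
  \<open>N0\<close> takes care of times that are hit exactly by the grid.\<close>

lemma bochner_measurable_continuous:
  fixes f :: "real \<Rightarrow> 'a::minus"
  assumes X: "\<And>t. t \<ge> 0 \<Longrightarrow> f t \<in> X"
    and N0: "\<And>t. t \<ge> 0 \<Longrightarrow> N (f t - f t) = 0"
    and lim: "\<And>t. t \<ge> 0 \<Longrightarrow> ((\<lambda>s. N (f s - f t)) \<longlongrightarrow> 0) (at t within {0..})"
  shows "bochner_measurable X N f"
proof -
  \<comment> \<open>Index of the last point not after \<open>t\<close> on the grid of mesh 1/(n+1);
    truncation at (n+1)^2, that is at time n+1, makes the range finite.\<close>
  define q :: "nat \<Rightarrow> real \<Rightarrow> nat" where "q n t = min ((Suc n)\<^sup>2) (nat \<lfloor>real (Suc n) * t\<rfloor>)" for n t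
  define \<tau> where "\<tau> n t = real (q n t) / real (Suc n)" for n t
  have fin: "finite (range (q n))" for n
    by (rule finite_subset[of _ "{..(Suc n)\<^sup>2}"]) (auto simp: q_def)
  have \<tau>0: "\<tau> n t \<ge> 0" for n t by (simp add: \<tau>_def)
  have \<tau>lim: "(\<lambda>n. \<tau> n t) \<longlonglongrightarrow> t" if t: "t \<ge> 0" for t
  proof (rule tendsto_sandwich)
    have ev: "\<forall>\<^sub>F n in sequentially. t - 1 / real (Suc n) \<le> \<tau> n t \<and> \<tau> n t \<le> t"
      using eventually_ge_at_top[of "nat \<lceil>t\<rceil>"]
    proof eventually_elim
      case (elim n)
      then have "t \<le> real (Suc n)" by linarith
      then have "real (Suc n) * t \<le> real ((Suc n)\<^sup>2)"
        by (simp only: power2_eq_square of_nat_mult) (rule mult_left_mono, auto)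
      then have "\<lfloor>real (Suc n) * t\<rfloor> \<le> int ((Suc n)\<^sup>2)" by linarith
      then have q: "q n t = nat \<lfloor>real (Suc n) * t\<rfloor>" by (simp add: q_def nat_le_iff)
      have "0 \<le> real (Suc n) * t" using t by simp
      then have "real (q n t) = real_of_int \<lfloor>real (Suc n) * t\<rfloor>" unfolding q by (simp del: of_nat_Suc)
      then have "real (Suc n) * t - 1 \<le> real (q n t)" "real (q n t) \<le> real (Suc n) * t" by linarith+
      moreover have "t - 1 / real (Suc n) = (real (Suc n) * t - 1) / real (Suc n)" "t = (real (Suc n) * t) / real (Suc n)"
        by (simp_all add: field_simps)
      ultimately show ?case unfolding \<tau>_def by (metis divide_right_mono of_nat_0_le_iff)
    qed
    then show "\<forall>\<^sub>F n in sequentially. t - 1 / real (Suc n) \<le> \<tau> n t" "\<forall>\<^sub>F n in sequentially. \<tau> n t \<le> t"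
      by (auto elim: eventually_mono)
    have "(\<lambda>n. t - 1 / real (Suc n)) \<longlonglongrightarrow> t - 0" by (intro tendsto_intros LIMSEQ_Suc[OF lim_1_over_n])
    then show "(\<lambda>n. t - 1 / real (Suc n)) \<longlonglongrightarrow> t" by simp
  qed simp
  have meas: "{t. 0 \<le> t \<and> f (\<tau> n t) = a} \<in> sets lebesgue" for n a
  proof -
    have "q n \<in> measurable borel (count_space UNIV)" unfolding q_def[abs_def] by measurable
    then have "{t \<in> space borel. 0 \<le> t \<and> f (real (q n t) / real (Suc n)) = a} \<in> sets borel" by measurable
    then show ?thesis by (simp add: \<tau>_def sets_completionI_sets)
  qed
  show ?thesis
    unfolding bochner_measurable_def
  proof (intro exI[of _ "\<lambda>n t. f (\<tau> n t)"] conjI allI meas)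
    fix n
    show "finite ((\<lambda>t. f (\<tau> n t)) ` {0..})"
      by (rule finite_subset[of _ "(\<lambda>j. f (real j / real (Suc n))) ` range (q n)"]) (use fin in \<open>auto simp: \<tau>_def\<close>)
    show "(\<lambda>t. f (\<tau> n t)) ` {0..} \<subseteq> X" using X \<tau>0 by auto
  next
    have "(\<lambda>n. N (f (\<tau> n t) - f t)) \<longlonglongrightarrow> 0" if t: "0 \<le> t" for t
    proof (rule LIMSEQ_I)
      fix e :: real assume e: "e > 0"
      have "\<forall>\<^sub>F s in at t within {0..}. norm (N (f s - f t)) < e"
        using tendstoD[OF lim[OF t] e] by (simp add: dist_norm)
      then obtain d where d: "d > 0" "\<And>s. s \<ge> 0 \<Longrightarrow> s \<noteq> t \<Longrightarrow> dist s t < d \<Longrightarrow> norm (N (f s - f t)) < e"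
        unfolding eventually_at by auto
      obtain n0 where n0: "\<And>n. n \<ge> n0 \<Longrightarrow> dist (\<tau> n t) t < d"
        using \<tau>lim[OF t] d(1) unfolding LIMSEQ_def by blast
      show "\<exists>no. \<forall>n\<ge>no. norm (N (f (\<tau> n t) - f t) - 0) < e"
        using n0 d(2) \<tau>0 N0[OF t] e by (metis diff_zero norm_zero)
    qed
    then show "AE t in lebesgue. 0 \<le> t \<longrightarrow> (\<lambda>n. N (f (\<tau> n t) - f t)) \<longlonglongrightarrow> 0"
      by (intro AE_I2) auto
  qed
qed

lemma Lp_loc_continuous:
  fixes f :: "real \<Rightarrow> 'a::minus"
  assumes p: "p > 0" and X: "\<And>t. t \<ge> 0 \<Longrightarrow> f t \<in> X"
    and N0: "\<And>t. t \<ge> 0 \<Longrightarrow> N (f t - f t) = 0"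
    and lim: "\<And>t. t \<ge> 0 \<Longrightarrow> ((\<lambda>s. N (f s - f t)) \<longlongrightarrow> 0) (at t within {0..})"
    and cont: "continuous_on {0..} (\<lambda>t. N (f t))" and nonneg: "\<And>t. t \<ge> 0 \<Longrightarrow> N (f t) \<ge> 0"
  shows "Lp_loc p X N f"
  unfolding Lp_loc_def
proof (intro conjI allI impI)
  show "AE t in lebesgue. 0 \<le> t \<longrightarrow> f t \<in> X" using X by auto
  show "bochner_measurable X N f" using X N0 lim by (rule bochner_measurable_continuous)
  fix T :: real
  have "continuous_on {0..T} (\<lambda>t. N (f t) powr p)"
    using continuous_on_subset[OF cont] p nonneg by (intro continuous_on_powr') (auto intro!: continuous_intros)
  then show "set_integrable lebesgue {0..T} (\<lambda>t. N (f t) powr p)"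
    by (rule absolutely_integrable_continuous_real)
qed

section \<open>Square-integrable periodic fields\<close>

lemma rep_abs_vfield: "f \<in> borel_measurable lebesgue \<Longrightarrow> AE x in lebesgue. rep_vfield (abs_vfield f) x = f x"
  using Quotient3_rep_abs[OF Quotient3_vfield, of f] by (simp add: ae_eq_def)

lemma measurable_rep_vfield [measurable]: "rep_vfield u \<in> borel_measurable lebesgue"
  using Quotient3_rep_reflp[OF Quotient3_vfield, of u] by (simp add: ae_eq_def)

lemma vfield_eqI: "AE x in lebesgue. rep_vfield u x = rep_vfield v x \<Longrightarrow> u = v"
  using Quotient3_rel_rep[OF Quotient3_vfield, of u v] by (simp add: ae_eq_def)

lemma rep_zero_vfield: "AE x in lebesgue. rep_vfield 0 x = 0"
  unfolding zero_vfield_def by (rule rep_abs_vfield) simp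

lemma rep_plus_vfield: "AE x in lebesgue. rep_vfield (u + v) x = rep_vfield u x + rep_vfield v x"
  unfolding plus_vfield_def by (simp, rule rep_abs_vfield) simp

lemma rep_diff_vfield: "AE x in lebesgue. rep_vfield (u - v) x = rep_vfield u x - rep_vfield v x"
  unfolding minus_vfield_def by (simp, rule rep_abs_vfield) simp

lemma rep_scaleR_vfield: "AE x in lebesgue. rep_vfield (a *\<^sub>R u) x = a *\<^sub>R rep_vfield u x"
  unfolding scaleR_vfield_def by (simp, rule rep_abs_vfield) simp

lemma AE_lebesgue_translate:
  fixes a :: "'a::euclidean_space"
  assumes "AE x in lebesgue. P x" shows "AE x in lebesgue. P (x + a)"
proof -
  obtain N where N: "N \<in> null_sets lebesgue" "{x. \<not> P x} \<subseteq> N"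
    using assms unfolding eventually_ae_filter by auto
  have "negligible ((+) (- a) ` N)"
    using N negligible_iff_null_sets negligible_translation by blast
  moreover have "{x. \<not> P (x + a)} \<subseteq> (+) (- a) ` N"
  proof
    fix x assume "x \<in> {x. \<not> P (x + a)}"
    then have "x + a \<in> N" using N by auto
    then show "x \<in> (+) (- a) ` N" by (intro image_eqI[of _ _ "x + a"]) auto
  qed
  ultimately show ?thesis
    unfolding eventually_ae_filter using negligible_iff_null_sets by auto
qed

abbreviation cell :: "real^3 \<Rightarrow> (real^3) measure" where "cell L \<equiv> lebesgue_on (cbox 0 L)"

lemma AE_cell: "AE x in lebesgue. P x \<Longrightarrow> AE x in cell L. P x"
  by (auto simp: AE_restrict_space_iff elim: eventually_mono)

lemma finite_measure_cell: "finite_measure (cell L)"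
  by (rule finite_measure_lebesgue_on) simp

lemma measurable_cell: "f \<in> borel_measurable lebesgue \<Longrightarrow> f \<in> borel_measurable (cell L)"
  by (rule measurable_restrict_space1)

lemma measurable_rep_cell [measurable]: "rep_vfield u \<in> borel_measurable (cell L)"
  by (rule measurable_cell) simp

lemma set_integrable_cell:
  fixes f :: "real^3 \<Rightarrow> 'b::{banach, second_countable_topology}"
  shows "set_integrable lebesgue (cbox 0 L) f \<longleftrightarrow> integrable (cell L) f"
  by (simp add: set_integrable_def integrable_restrict_space)

lemma set_integral_cell:
  fixes f :: "real^3 \<Rightarrow> 'b::{banach, second_countable_topology}"
  shows "(LINT x:cbox 0 L|lebesgue. f x) = (\<integral>x. f x \<partial>cell L)"
  by (simp add: set_lebesgue_integral_def integral_restrict_space)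

lemma integrable_cell_continuous:
  fixes f :: "real^3 \<Rightarrow> 'b::euclidean_space"
  assumes "continuous_on (cbox 0 L) f" shows "integrable (cell L) f"
  using absolutely_integrable_continuous[OF assms] by (simp add: set_integrable_cell)

lemma L2_inner_eq: "L2_inner L u v = (\<integral>x. rep_vfield u x \<bullet> rep_vfield v x \<partial>cell L)"
  by (simp add: L2_inner_def set_integral_cell)

text \<open>The codomain is a type variable so that predicates can be periodic too, as in
  \<open>AE_periodic\<close>.\<close>

definition periodic :: "real^3 \<Rightarrow> (real^3 \<Rightarrow> 'b) \<Rightarrow> bool" where
  "periodic L f \<longleftrightarrow> (\<forall>j. AE x in lebesgue. f (x + axis j (L $ j)) = f x)"

lemma L2_iff: "u \<in> L2 L \<longleftrightarrow> periodic L (rep_vfield u) \<and> integrable (cell L) (\<lambda>x. (norm (rep_vfield u x))\<^sup>2)"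
  by (simp add: L2_def periodic_def set_integrable_cell)

lemma periodic_cong:
  assumes "AE x in lebesgue. f x = g x" "periodic L g" shows "periodic L f"
  unfolding periodic_def
proof
  fix j
  have "AE x in lebesgue. f (x + axis j (L $ j)) = g (x + axis j (L $ j))"
    by (rule AE_lebesgue_translate[OF assms(1)])
  moreover have "AE x in lebesgue. g (x + axis j (L $ j)) = g x"
    using assms(2) by (simp add: periodic_def)
  ultimately show "AE x in lebesgue. f (x + axis j (L $ j)) = f x"
    using assms(1) by eventually_elim simp
qed

lemma periodic_compose2:
  assumes "periodic L f" "periodic L g" shows "periodic L (\<lambda>x. h (f x) (g x))"
  unfolding periodic_def
proof
  fix j
  have "AE x in lebesgue. f (x + axis j (L $ j)) = f x" "AE x in lebesgue. g (x + axis j (L $ j)) = g x"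
    using assms by (auto simp: periodic_def)
  then show "AE x in lebesgue. h (f (x + axis j (L $ j))) (g (x + axis j (L $ j))) = h (f x) (g x)"
    by eventually_elim simp
qed

lemma L2_I:
  assumes "AE x in lebesgue. rep_vfield u x = f x" "periodic L f" "integrable (cell L) (\<lambda>x. (norm (f x))\<^sup>2)"
  shows "u \<in> L2 L"
  unfolding L2_iff
proof
  show "periodic L (rep_vfield u)" using assms periodic_cong by blast
  have "AE x in cell L. (norm (f x))\<^sup>2 = (norm (rep_vfield u x))\<^sup>2"
    using AE_cell[OF assms(1)] by eventually_elim simp
  then show "integrable (cell L) (\<lambda>x. (norm (rep_vfield u x))\<^sup>2)"
    using assms(3) by (rule integrable_cong_AE_imp[rotated 2]) simp
qed

lemma integrable_rep_inner:
  assumes "u \<in> L2 L" "v \<in> L2 L"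
  shows "integrable (cell L) (\<lambda>x. rep_vfield u x \<bullet> rep_vfield v x)"
proof (rule Bochner_Integration.integrable_bound)
  show "integrable (cell L) (\<lambda>x. (norm (rep_vfield u x))\<^sup>2 + (norm (rep_vfield v x))\<^sup>2)"
    using assms by (auto simp: L2_iff)
  have "\<bar>a \<bullet> b\<bar> \<le> (norm a)\<^sup>2 + (norm b)\<^sup>2" for a b :: "real^3"
    using Cauchy_Schwarz_ineq2[of a b] sum_squares_bound[of "norm a" "norm b"]
      zero_le_power2[of "norm a"] zero_le_power2[of "norm b"] by linarith
  then show "AE x in cell L. norm (rep_vfield u x \<bullet> rep_vfield v x) \<le> norm ((norm (rep_vfield u x))\<^sup>2 + (norm (rep_vfield v x))\<^sup>2)"
    by (intro AE_I2) (simp add: abs_of_nonneg)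
qed simp

lemma subspace_L2: "subspace (L2 L)"
  unfolding subspace_def
proof (intro conjI ballI allI)
  show "0 \<in> L2 L" by (rule L2_I[OF rep_zero_vfield]) (auto simp: periodic_def)
next
  fix u v assume uv: "u \<in> L2 L" "v \<in> L2 L"
  show "u + v \<in> L2 L"
  proof (rule L2_I[OF rep_plus_vfield])
    show "periodic L (\<lambda>x. rep_vfield u x + rep_vfield v x)"
      using uv by (auto simp: L2_iff intro: periodic_compose2[where h="(+)"])
    have "(norm (a + b))\<^sup>2 = (norm a)\<^sup>2 + 2 * (a \<bullet> b) + (norm b)\<^sup>2" for a b :: "real^3"
      by (simp add: power2_norm_eq_inner inner_add_left inner_add_right inner_commute)
    then show "integrable (cell L) (\<lambda>x. (norm (rep_vfield u x + rep_vfield v x))\<^sup>2)"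
      using uv integrable_rep_inner[OF uv] by (simp add: L2_iff)
  qed
next
  fix a :: real and u assume u: "u \<in> L2 L"
  show "a *\<^sub>R u \<in> L2 L"
  proof (rule L2_I[OF rep_scaleR_vfield])
    show "periodic L (\<lambda>x. a *\<^sub>R rep_vfield u x)"
      using u periodic_compose2[of L "rep_vfield u" "rep_vfield u" "\<lambda>x y. a *\<^sub>R x"] by (simp add: L2_iff)
    show "integrable (cell L) (\<lambda>x. (norm (a *\<^sub>R rep_vfield u x))\<^sup>2)"
      using u by (simp add: L2_iff power_mult_distrib)
  qed
qed

lemma L2_inner_cong:
  assumes "AE x in lebesgue. rep_vfield u x = f x" "AE x in lebesgue. rep_vfield v x = g x"
    and [measurable]: "f \<in> borel_measurable lebesgue" "g \<in> borel_measurable lebesgue"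
  shows "L2_inner L u v = (\<integral>x. f x \<bullet> g x \<partial>cell L)"
  unfolding L2_inner_eq
proof (rule integral_cong_AE)
  show "(\<lambda>x. f x \<bullet> g x) \<in> borel_measurable (cell L)"
    by (rule measurable_cell) simp
  show "AE x in cell L. rep_vfield u x \<bullet> rep_vfield v x = f x \<bullet> g x"
    using AE_cell[OF assms(1)] AE_cell[OF assms(2)] by eventually_elim simp
qed simp

locale torus =
  fixes L :: "real^3"
  assumes pos: "L $ j > 0"
begin

text \<open>The shifts under which \<open>P\<close> is invariant almost everywhere form an additive
  group containing the three periods, hence the whole lattice. The lattice is countable, so a single
  null set serves all shifts, and outside it every point can be moved into the cell.\<close>

lemma AE_periodic:
  assumes P: "periodic L P" and cell: "AE x in cell L. P x"
  shows "AE x in lebesgue. P x"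
proof -
  define S where "S = {a. AE x in lebesgue. P (x + a) = P x}"
  have add: "a + b \<in> S" if "a \<in> S" "b \<in> S" for a b
  proof -
    have "AE x in lebesgue. P (x + a + b) = P (x + a)"
      using that AE_lebesgue_translate[of "\<lambda>x. P (x + b) = P x" a] by (simp add: S_def)
    moreover have "AE x in lebesgue. P (x + a) = P x" using that by (simp add: S_def)
    ultimately show ?thesis unfolding S_def mem_Collect_eq
      by eventually_elim (simp add: add.assoc)
  qed
  have neg: "- a \<in> S" if "a \<in> S" for a
    using that AE_lebesgue_translate[of "\<lambda>x. P (x + a) = P x" "- a"] by (auto simp: S_def eq_commute)
  have zero: "0 \<in> S" by (simp add: S_def)
  have nmul: "real n *\<^sub>R a \<in> S" if "a \<in> S" for n a
    by (induction n) (auto simp: zero algebra_simps intro!: add that)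
  have imul: "of_int n *\<^sub>R a \<in> S" if "a \<in> S" for n :: int and a
    using nmul[OF that, of "nat n"] neg[OF nmul[OF that, of "nat (- n)"]]
    by (cases "n \<ge> 0") auto
  have ax: "axis j (L $ j) \<in> S" for j
    using P by (simp add: S_def periodic_def)
  define sh where "sh n = (\<Sum>j\<in>UNIV. of_int (n $ j) *\<^sub>R axis j (L $ j))" for n :: "int^3"
  have sh_S: "sh n \<in> S" for n
    unfolding sh_def UNIV_3 by (auto intro!: add imul ax)
  have "AE x in lebesgue. \<forall>n. P (x + sh n) = P x"
    using sh_S by (simp add: AE_all_countable S_def)
  moreover have "AE x in lebesgue. \<forall>n. x + sh n \<in> cbox 0 L \<longrightarrow> P (x + sh n)"
    using cell AE_lebesgue_translate[of "\<lambda>x. x \<in> cbox 0 L \<longrightarrow> P x"]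
    by (auto simp: AE_all_countable AE_restrict_space_iff)
  ultimately show ?thesis
  proof eventually_elim
    case (elim x)
    define n where "n = (\<chi> j. - \<lfloor>x $ j / L $ j\<rfloor>)"
    have sh: "sh n $ j = - (of_int \<lfloor>x $ j / L $ j\<rfloor> * L $ j)" for j
      using exhaust_3[of j] by (auto simp: sh_def n_def axis_def sum_3)
    have "0 \<le> x $ j + sh n $ j \<and> x $ j + sh n $ j \<le> L $ j" for j
    proof -
      have "of_int \<lfloor>x $ j / L $ j\<rfloor> * L $ j \<le> (x $ j / L $ j) * L $ j"
        "(x $ j / L $ j) * L $ j \<le> (of_int \<lfloor>x $ j / L $ j\<rfloor> + 1) * L $ j"
        using pos[of j] by (intro mult_right_mono; linarith)+
      then show ?thesis using pos[of j] unfolding sh by (simp add: algebra_simps)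
    qed
    then have "x + sh n \<in> cbox 0 L" by (simp add: mem_box_cart)
    then show "P x" using elim by blast
  qed
qed

sublocale L2: semi_inner "L2 L" "L2_inner L"
  rewrites "semi_inner.nrm (L2_inner L) = L2_norm L"
proof -
  show *: "semi_inner (L2 L) (L2_inner L)"
  proof
    show "subspace (L2 L)" by (rule subspace_L2)
    show "L2_inner L x y = L2_inner L y x" for x y by (simp add: L2_inner_eq inner_commute)
    show "L2_inner L (x + y) z = L2_inner L x z + L2_inner L y z"
      if "x \<in> L2 L" "y \<in> L2 L" "z \<in> L2 L" for x y z
    proof -
      have "L2_inner L (x + y) z = (\<integral>t. (rep_vfield x t + rep_vfield y t) \<bullet> rep_vfield z t \<partial>cell L)"
        by (rule L2_inner_cong[OF rep_plus_vfield]) simp_all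
      then show ?thesis
        using that by (simp add: inner_add_left L2_inner_eq integrable_rep_inner)
    qed
    show "L2_inner L (a *\<^sub>R x) z = a * L2_inner L x z" for a x z
    proof -
      have "L2_inner L (a *\<^sub>R x) z = (\<integral>t. (a *\<^sub>R rep_vfield x t) \<bullet> rep_vfield z t \<partial>cell L)"
        by (rule L2_inner_cong[OF rep_scaleR_vfield]) simp_all
      then show ?thesis by (simp add: L2_inner_eq)
    qed
    show "0 \<le> L2_inner L x x" for x by (simp add: L2_inner_eq)
  qed
  show "semi_inner.nrm (L2_inner L) = L2_norm L"
    by (rule ext) (simp add: semi_inner.nrm_def[OF *] L2_norm_def)
qed

lemma AE_cell_imp_eq:
  assumes "u \<in> L2 L" "v \<in> L2 L" "AE x in cell L. rep_vfield u x = rep_vfield v x"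
  shows "u = v"
proof (rule vfield_eqI, rule AE_periodic)
  show "periodic L (\<lambda>x. rep_vfield u x = rep_vfield v x)"
    using assms by (auto simp: L2_iff intro: periodic_compose2[where h="(=)"])
qed (rule assms)

lemma L2_norm_eq_0:
  assumes "u \<in> L2 L" "L2_norm L u = 0" shows "u = 0"
proof (rule AE_cell_imp_eq[OF assms(1) L2.closed(1)])
  have "(\<integral>x. (norm (rep_vfield u x))\<^sup>2 \<partial>cell L) = 0"
    using assms(2) by (simp add: L2_norm_def L2_inner_eq power2_norm_eq_inner)
  then have "AE x in cell L. (norm (rep_vfield u x))\<^sup>2 = 0"
    using assms(1) by (subst (asm) integral_nonneg_eq_0_iff_AE) (auto simp: L2_iff)
  then show "AE x in cell L. rep_vfield u x = rep_vfield 0 x"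
    using AE_cell[OF rep_zero_vfield] by eventually_elim simp
qed

end

section \<open>Completeness of the space of square-integrable periodic fields\<close>

context torus
begin

lemma L2_norm_diff_sq:
  assumes "u \<in> L2 L" "v \<in> L2 L"
  shows "(L2_norm L (u - v))\<^sup>2 = (\<integral>x. (norm (rep_vfield u x - rep_vfield v x))\<^sup>2 \<partial>cell L)"
proof -
  have "L2_inner L (u - v) (u - v) = (\<integral>x. (rep_vfield u x - rep_vfield v x) \<bullet> (rep_vfield u x - rep_vfield v x) \<partial>cell L)"
    by (rule L2_inner_cong[OF rep_diff_vfield rep_diff_vfield]) simp_all
  then show ?thesis
    using L2.nrm_sq[OF L2.closed(3)[OF assms]] by (simp add: power2_norm_eq_inner)
qed

lemma nn_integral_L2_norm_diff:
  assumes "u \<in> L2 L" "v \<in> L2 L"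
  shows "(\<integral>\<^sup>+x. ennreal ((norm (rep_vfield u x - rep_vfield v x))\<^sup>2) \<partial>cell L) = ennreal ((L2_norm L (u - v))\<^sup>2)"
proof -
  have int: "integrable (cell L) (\<lambda>x. (norm (rep_vfield (u - v) x))\<^sup>2)"
    using L2.closed(3)[OF assms] by (simp add: L2_iff)
  have "AE x in cell L. (norm (rep_vfield (u - v) x))\<^sup>2 = (norm (rep_vfield u x - rep_vfield v x))\<^sup>2"
    using AE_cell[OF rep_diff_vfield[of u v]] by eventually_elim simp
  then have "integrable (cell L) (\<lambda>x. (norm (rep_vfield u x - rep_vfield v x))\<^sup>2)"
    by (rule integrable_cong_AE_imp[OF int, rotated]) simp
  then show ?thesis
    unfolding L2_norm_diff_sq[OF assms] by (intro nn_integral_eq_integral) auto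
qed

text \<open>Riesz-Fischer: a fast subsequence converges almost everywhere, and Fatou's lemma applied
  to its distances from a fixed \<open>h n\<close> shows that the whole sequence converges in norm
  to that pointwise limit.\<close>

lemma L2_complete:
  assumes h: "\<And>n. h n \<in> L2 L"
    and Cauchy: "\<And>e. e > 0 \<Longrightarrow> \<exists>N. \<forall>m\<ge>N. \<forall>n\<ge>N. L2_norm L (h m - h n) < e"
  shows "\<exists>l\<in>L2 L. (\<lambda>n. L2_norm L (h n - l)) \<longlonglongrightarrow> 0"
proof -
  have "\<exists>N. \<forall>m\<ge>N. \<forall>n\<ge>N. L2_norm L (h m - h n) < (1/2)^k" for k
    by (rule Cauchy) simp
  then obtain N where N: "\<And>k m n. m \<ge> N k \<Longrightarrow> n \<ge> N k \<Longrightarrow> L2_norm L (h m - h n) < (1/2)^k"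
    by metis
  \<comment> \<open>Summing the thresholds makes \<open>r k\<close> at least as large as every
    \<open>N j\<close> with j \<le> k.\<close>
  define r where "r k = (\<Sum>i\<le>k. N i)" for k
  have rN: "N j \<le> r k" if "j \<le> k" for j k
    unfolding r_def using that by (intro member_le_sum) auto
  define F where "F k = rep_vfield (h (r k))" for k
  have Fm[measurable]: "F k \<in> borel_measurable lebesgue" "F k \<in> borel_measurable (cell L)" for k
    by (simp_all add: F_def)
  \<comment> \<open>The squared increments have integral at most 4^-k, which leaves room for the
    weight 2^k. The weight is what allows passing from squares to the increments themselves, via d
    \<le> 2^k d^2 + 2^-k.\<close>
  have nn: "(\<integral>\<^sup>+x. ennreal (2^k * (norm (F (Suc k) x - F k x))\<^sup>2) \<partial>cell L) \<le> ennreal ((1/2)^k)" for k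
  proof -
    have "(\<integral>\<^sup>+x. ennreal (2^k * (norm (F (Suc k) x - F k x))\<^sup>2) \<partial>cell L) =
        ennreal (2^k) * (\<integral>\<^sup>+x. ennreal ((norm (F (Suc k) x - F k x))\<^sup>2) \<partial>cell L)"
      by (subst nn_integral_cmult[symmetric]) (simp_all add: ennreal_mult)
    also have "\<dots> = ennreal (2^k) * ennreal ((L2_norm L (h (r (Suc k)) - h (r k)))\<^sup>2)"
      unfolding F_def by (subst nn_integral_L2_norm_diff) (simp_all add: h)
    also have "\<dots> = ennreal (2^k * (L2_norm L (h (r (Suc k)) - h (r k)))\<^sup>2)"
      by (simp add: ennreal_mult)
    also have "\<dots> \<le> ennreal (2^k * ((1/2)^k)\<^sup>2)"
      using N[of k "r (Suc k)" "r k"] rN[of k k] rN[of k "Suc k"] L2.nrm_nonneg[OF L2.closed(3)[OF h h]]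
      by (intro ennreal_leI mult_left_mono power_mono) auto
    also have "2^k * ((1/2)^k)\<^sup>2 = (1/2::real)^k"
      by (simp add: power2_eq_square power_divide)
    finally show ?thesis .
  qed
  have "(\<integral>\<^sup>+x. (\<Sum>k. ennreal (2^k * (norm (F (Suc k) x - F k x))\<^sup>2)) \<partial>cell L)
      = (\<Sum>k. \<integral>\<^sup>+x. ennreal (2^k * (norm (F (Suc k) x - F k x))\<^sup>2) \<partial>cell L)"
    by (intro nn_integral_suminf) simp
  also have "\<dots> \<le> (\<Sum>k. ennreal ((1/2)^k))"
    by (intro suminf_le nn) auto
  also have "\<dots> = ennreal (\<Sum>k. (1/2)^k)"
    by (intro suminf_ennreal2) auto
  also have "\<dots> < \<infinity>" by simp
  finally have "(\<integral>\<^sup>+x. (\<Sum>k. ennreal (2^k * (norm (F (Suc k) x - F k x))\<^sup>2)) \<partial>cell L) \<noteq> \<infinity>"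
    by (rule less_imp_neq)
  then have "AE x in cell L. (\<Sum>k. ennreal (2^k * (norm (F (Suc k) x - F k x))\<^sup>2)) \<noteq> \<infinity>"
    by (intro nn_integral_noteq_infinite) simp_all
  then have conv: "AE x in cell L. convergent (\<lambda>k. F k x)"
  proof eventually_elim
    case (elim x)
    let ?d = "\<lambda>k. norm (F (Suc k) x - F k x)"
    have s: "summable (\<lambda>k. 2^k * (?d k)\<^sup>2)"
      by (rule summable_suminf_not_top) (use elim in \<open>auto simp: top_ennreal_def\<close>)
    have "summable (\<lambda>k. 2^k * (?d k)\<^sup>2 + (1/2)^k)"
      by (intro summable_add s summable_geometric) simp
    moreover have "?d k \<le> 2^k * (?d k)\<^sup>2 + (1/2)^k" for k
    proof -
      have "0 \<le> (2^k * ?d k - 1)\<^sup>2" by simp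
      then have "2 * (2^k * ?d k) \<le> 2^k * (2^k * (?d k)\<^sup>2 + (1/2)^k)"
        by (simp add: power2_eq_square algebra_simps power_divide)
      then have "2 * ?d k \<le> 2^k * (?d k)\<^sup>2 + (1/2)^k"
        by (simp only: mult.left_commute[of 2] mult_le_cancel_left_pos zero_less_power zero_less_numeral)
      then show ?thesis using norm_ge_zero[of "F (Suc k) x - F k x"] by linarith
    qed
    ultimately have "summable ?d"
      by (intro summable_comparison_test'[where N=0 and f="?d"]) auto
    then have "summable (\<lambda>k. F (Suc k) x - F k x)" by (rule summable_norm_cancel)
    then have "(\<lambda>n. F 0 x + (\<Sum>k<n. F (Suc k) x - F k x)) \<longlonglongrightarrow> F 0 x + (\<Sum>k. F (Suc k) x - F k x)"
      by (intro tendsto_intros summable_LIMSEQ)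
    moreover have "F 0 x + (\<Sum>k<n. F (Suc k) x - F k x) = F n x" for n
      using sum_lessThan_telescope[of "\<lambda>k. F k x" n] by simp
    ultimately show ?case by (auto simp: convergent_def)
  qed
  define f where "f x = lim (\<lambda>k. F k x)" for x
  have fm[measurable]: "f \<in> borel_measurable lebesgue" "f \<in> borel_measurable (cell L)"
    unfolding f_def[abs_def] by (intro borel_measurable_lim_metric Fm)+
  have per: "periodic L f"
    unfolding periodic_def
  proof
    fix j
    have "AE x in lebesgue. \<forall>k. F k (x + axis j (L $ j)) = F k x"
      using h by (simp add: AE_all_countable F_def L2_iff periodic_def)
    then show "AE x in lebesgue. f (x + axis j (L $ j)) = f x"
      by eventually_elim (simp add: f_def)
  qed
  have bound: "(\<integral>\<^sup>+x. ennreal ((norm (rep_vfield (h n) x - f x))\<^sup>2) \<partial>cell L) \<le> ennreal (((1/2)^j)\<^sup>2)"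
    if n: "n \<ge> N j" for n j
  proof -
    have "AE x in cell L. ennreal ((norm (rep_vfield (h n) x - f x))\<^sup>2)
        = liminf (\<lambda>k. ennreal ((norm (rep_vfield (h n) x - F k x))\<^sup>2))"
      using conv
    proof eventually_elim
      case (elim x)
      then have "(\<lambda>k. F k x) \<longlonglongrightarrow> f x" by (simp add: f_def convergent_LIMSEQ_iff)
      then have "(\<lambda>k. ennreal ((norm (rep_vfield (h n) x - F k x))\<^sup>2)) \<longlonglongrightarrow> ennreal ((norm (rep_vfield (h n) x - f x))\<^sup>2)"
        by (intro tendsto_intros tendsto_ennrealI)
      then show ?case by (intro lim_imp_Liminf[symmetric]) auto
    qed
    then have "(\<integral>\<^sup>+x. ennreal ((norm (rep_vfield (h n) x - f x))\<^sup>2) \<partial>cell L)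
      = (\<integral>\<^sup>+x. liminf (\<lambda>k. ennreal ((norm (rep_vfield (h n) x - F k x))\<^sup>2)) \<partial>cell L)"
      by (rule nn_integral_cong_AE)
    also have "\<dots> \<le> liminf (\<lambda>k. \<integral>\<^sup>+x. ennreal ((norm (rep_vfield (h n) x - F k x))\<^sup>2) \<partial>cell L)"
      by (intro nn_integral_liminf) simp
    also have "\<dots> = liminf (\<lambda>k. ennreal ((L2_norm L (h n - h (r k)))\<^sup>2))"
      unfolding F_def by (simp add: nn_integral_L2_norm_diff h)
    also have "\<dots> \<le> liminf (\<lambda>k. ennreal (((1/2)^j)\<^sup>2))"
    proof (rule Liminf_mono)
      show "\<forall>\<^sub>F k in sequentially. ennreal ((L2_norm L (h n - h (r k)))\<^sup>2) \<le> ennreal (((1/2)^j)\<^sup>2)"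
        using eventually_ge_at_top[of j]
      proof eventually_elim
        case (elim k)
        show ?case
          using N[of j n "r k"] rN[OF elim] n L2.nrm_nonneg[OF L2.closed(3)[OF h h], of n "r k"]
          by (intro ennreal_leI power_mono) auto
      qed
    qed
    also have "\<dots> = ennreal (((1/2)^j)\<^sup>2)" by (simp add: Liminf_const)
    finally show ?thesis .
  qed
  define l where "l = abs_vfield f"
  have l: "AE x in lebesgue. rep_vfield l x = f x"
    unfolding l_def by (rule rep_abs_vfield) (rule fm)
  have hl: "AE x in lebesgue. rep_vfield (h n - l) x = rep_vfield (h n) x - f x" for n
    using l rep_diff_vfield[of "h n" l] by eventually_elim simp
  have int: "integrable (cell L) (\<lambda>x. (norm (rep_vfield (h n) x - f x))\<^sup>2)" if "n \<ge> N j" for n j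
  proof (rule integrableI_bounded)
    have "(\<integral>\<^sup>+x. ennreal ((norm (rep_vfield (h n) x - f x))\<^sup>2) \<partial>cell L) < \<infinity>"
      using le_less_trans[OF bound[OF that]] by simp
    then show "(\<integral>\<^sup>+x. ennreal (norm ((norm (rep_vfield (h n) x - f x))\<^sup>2)) \<partial>cell L) < \<infinity>" by simp
  qed simp
  have hlL2: "h n - l \<in> L2 L" if "n \<ge> N j" for n j
    by (rule L2_I[OF hl _ int[OF that]])
       (use h per in \<open>auto simp: L2_iff intro: periodic_compose2[where h="(-)"]\<close>)
  have lL2: "l \<in> L2 L"
    using L2.closed(3)[OF h[of "N 0"] hlL2[of 0 "N 0"]] by simp
  have le: "L2_norm L (h n - l) \<le> (1/2)^j" if n: "n \<ge> N j" for n j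
  proof -
    have "ennreal ((L2_norm L (h n - l))\<^sup>2) = (\<integral>\<^sup>+x. ennreal ((norm (rep_vfield (h n) x - rep_vfield l x))\<^sup>2) \<partial>cell L)"
      by (simp add: nn_integral_L2_norm_diff h lL2)
    also have "\<dots> = (\<integral>\<^sup>+x. ennreal ((norm (rep_vfield (h n) x - f x))\<^sup>2) \<partial>cell L)"
    proof (rule nn_integral_cong_AE)
      show "AE x in cell L. ennreal ((norm (rep_vfield (h n) x - rep_vfield l x))\<^sup>2) = ennreal ((norm (rep_vfield (h n) x - f x))\<^sup>2)"
        using AE_cell[OF l, of L] by eventually_elim simp
    qed
    also have "\<dots> \<le> ennreal (((1/2)^j)\<^sup>2)" by (rule bound[OF n])
    finally have "(L2_norm L (h n - l))\<^sup>2 \<le> ((1/2)^j)\<^sup>2" by (simp add: ennreal_le_iff)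
    then show ?thesis by (rule power2_le_imp_le) simp
  qed
  have "(\<lambda>n. L2_norm L (h n - l)) \<longlonglongrightarrow> 0"
  proof (rule LIMSEQ_I)
    fix e :: real assume "e > 0"
    then obtain j where j: "(1/2)^j < e" using real_arch_pow_inv[of e "1/2"] by auto
    have "norm (L2_norm L (h n - l) - 0) < e" if "n \<ge> N j" for n
      using le[OF that] j L2.nrm_nonneg[OF hlL2[OF that]] by simp
    then show "\<exists>no. \<forall>n\<ge>no. norm (L2_norm L (h n - l) - 0) < e" by blast
  qed
  then show ?thesis using lL2 by blast
qed

end

section \<open>Completeness of the exponentials\<close>

abbreviation char :: "real^3 \<Rightarrow> int^3 \<Rightarrow> real^3 \<Rightarrow> complex" where
  "char L k x \<equiv> exp (\<i> * complex_of_real (wave L k \<bullet> x))"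

lemma wave_add: "wave L (k + l) = wave L k + wave L l"
  by (simp add: wave_def vec_eq_iff add_divide_distrib ring_distribs)

lemma wave_minus: "wave L (- k) = - wave L k"
  by (simp add: wave_def vec_eq_iff)

lemma wave_zero: "wave L 0 = 0"
  by (simp add: wave_def vec_eq_iff)

lemma char_mult: "char L k x * char L l x = char L (k + l) x"
  by (simp add: wave_add inner_add_left exp_add[symmetric] algebra_simps)

lemma cnj_char: "cnj (char L k x) = char L (- k) x"
  by (simp add: exp_cnj wave_minus)

lemma continuous_on_char [continuous_intros]: "continuous_on S (char L k)"
  by (intro continuous_intros)

lemma measurable_char [measurable]: "char L k \<in> borel_measurable (cell L)"
  by (intro measurable_cell borel_measurable_lebesgueI borel_measurable_continuous_onI continuous_on_char)

lemma integrable_mult_bounded: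
  fixes f g :: "'a \<Rightarrow> 'b::{real_normed_algebra, banach, second_countable_topology}"
  assumes f: "integrable M f" and g: "g \<in> borel_measurable M" and B: "\<And>x. x \<in> space M \<Longrightarrow> norm (g x) \<le> B"
  shows "integrable M (\<lambda>x. f x * g x)"
proof (rule Bochner_Integration.integrable_bound)
  show "integrable M (\<lambda>x. B * norm (f x))" using f by simp
  show "(\<lambda>x. f x * g x) \<in> borel_measurable M" using f g by simp
  have "norm (f x * g x) \<le> norm (B * norm (f x))" if "x \<in> space M" for x
  proof -
    have "norm (f x * g x) \<le> norm (f x) * norm (g x)" by (rule norm_mult_ineq)
    also have "\<dots> \<le> norm (f x) * B" using B[OF that] by (intro mult_left_mono) auto
    also have "\<dots> \<le> norm (B * norm (f x))" by (simp add: abs_mult mult.commute mult_right_mono)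
    finally show ?thesis .
  qed
  then show "AE x in M. norm (f x * g x) \<le> norm (B * norm (f x))" by (rule AE_I2)
qed

lemma measurable_rep_component [measurable]: "(\<lambda>x. rep_vfield u x $ i) \<in> borel_measurable (cell L)"
  by (simp add: cart_eq_inner_axis)

lemma integrable_rep_component:
  assumes "u \<in> L2 L" shows "integrable (cell L) (\<lambda>x. rep_vfield u x $ i)"
proof (rule Bochner_Integration.integrable_bound)
  interpret finite_measure "cell L" by (rule finite_measure_cell)
  show "integrable (cell L) (\<lambda>x. 1 + (norm (rep_vfield u x))\<^sup>2)"
    using assms by (auto simp: L2_iff)
  have "\<bar>a $ i\<bar> \<le> 1 + (norm a)\<^sup>2" for a :: "real^3"
    using component_le_norm_cart[of a i] sum_squares_bound[of 1 "norm a"] norm_ge_zero[of a]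
    by (simp add: power2_eq_square)
  then show "AE x in cell L. norm (rep_vfield u x $ i) \<le> norm (1 + (norm (rep_vfield u x))\<^sup>2)"
    by (intro AE_I2) simp
qed simp

lemma integrable_component_char:
  assumes "u \<in> L2 L" shows "integrable (cell L) (\<lambda>x. complex_of_real (rep_vfield u x $ i) * char L k x)"
  by (rule integrable_mult_bounded[where B=1]) (use assms in \<open>auto intro!: integrable_rep_component\<close>)

inductive_set trig_polys :: "real^3 \<Rightarrow> (real^3 \<Rightarrow> complex) set" for L where
  char: "(\<lambda>x. c * char L k x) \<in> trig_polys L"
| add: "p \<in> trig_polys L \<Longrightarrow> q \<in> trig_polys L \<Longrightarrow> (\<lambda>x. p x + q x) \<in> trig_polys L"

lemma trig_polys_mult_char: "q \<in> trig_polys L \<Longrightarrow> (\<lambda>x. (c * char L k x) * q x) \<in> trig_polys L"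
proof (induction rule: trig_polys.induct)
  case (char d l)
  have "(\<lambda>x. (c * char L k x) * (d * char L l x)) = (\<lambda>x. (c * d) * char L (k + l) x)"
    by (simp add: char_mult[symmetric] mult_ac)
  then show ?case using trig_polys.char by metis
next
  case (add p q)
  show ?case unfolding distrib_left by (intro trig_polys.add add.IH)
qed

lemma trig_polys_mult: "p \<in> trig_polys L \<Longrightarrow> q \<in> trig_polys L \<Longrightarrow> (\<lambda>x. p x * q x) \<in> trig_polys L"
proof (induction rule: trig_polys.induct)
  case (char c k)
  then show ?case by (rule trig_polys_mult_char)
next
  case (add p1 p2)
  show ?case unfolding distrib_right by (intro trig_polys.add add.IH add.prems)
qed

lemma trig_polys_const: "(\<lambda>x. c) \<in> trig_polys L"
  using trig_polys.char[of c L 0] by (simp add: wave_zero)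

text \<open>The embedding of the torus into R^6. Polynomials pull back to trigonometric polynomials,
  so Stone-Weierstrass can be applied on a ball of the ambient space and the quotient torus is never
  formed.\<close>

definition cos_sin :: "real^3 \<Rightarrow> real^3 \<Rightarrow> (real^3) \<times> (real^3)" where
  "cos_sin L x = (\<chi> j. cos (2 * pi * x $ j / L $ j), \<chi> j. sin (2 * pi * x $ j / L $ j))"

lemma trig_polys_cos_sin:
  "(\<lambda>x. complex_of_real (cos (2 * pi * x $ j / L $ j))) \<in> trig_polys L"
  "(\<lambda>x. complex_of_real (sin (2 * pi * x $ j / L $ j))) \<in> trig_polys L"
proof -
  have w: "wave L (axis j 1) \<bullet> x = 2 * pi * x $ j / L $ j" for x
    using exhaust_3[of j] by (auto simp: wave_def axis_def inner_vec_def sum_3)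
  have "(\<lambda>x. complex_of_real (cos (2 * pi * x $ j / L $ j))) = (\<lambda>x. (1/2) * char L (axis j 1) x + (1/2) * char L (- axis j 1) x)"
    by (rule ext) (simp add: wave_minus w cos_exp_eq cos_of_real[symmetric] flip: distrib_left)
  then show "(\<lambda>x. complex_of_real (cos (2 * pi * x $ j / L $ j))) \<in> trig_polys L"
    by (simp only:) (rule trig_polys.add[OF trig_polys.char trig_polys.char])
  have "(\<lambda>x. complex_of_real (sin (2 * pi * x $ j / L $ j))) = (\<lambda>x. (1/(2*\<i>)) * char L (axis j 1) x + (- 1/(2*\<i>)) * char L (- axis j 1) x)"
    by (rule ext) (simp add: wave_minus w sin_exp_eq sin_of_real[symmetric] field_simps)
  then show "(\<lambda>x. complex_of_real (sin (2 * pi * x $ j / L $ j))) \<in> trig_polys L"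
    by (simp only:) (rule trig_polys.add[OF trig_polys.char trig_polys.char])
qed

lemma trig_polys_polynomial:
  "real_polynomial_function q \<Longrightarrow> (\<lambda>x. complex_of_real (q (cos_sin L x))) \<in> trig_polys L"
proof (induction rule: real_polynomial_function.induct)
  case (linear f)
  interpret bounded_linear f by fact
  have expand: "g a = (\<Sum>j\<in>UNIV. a $ j * g (axis j 1))" if "linear g" for g :: "real^3 \<Rightarrow> real" and a
  proof -
    have "a = (\<Sum>j\<in>UNIV. a $ j *\<^sub>R axis j 1)"
      by (simp add: vec_eq_iff forall_3 sum_3 axis_def)
    then have "g a = g (\<Sum>j\<in>UNIV. a $ j *\<^sub>R axis j 1)" by simp
    then show ?thesis by (simp add: linear_sum[OF that] linear_scale[OF that])
  qed
  have fab: "f (a, b) = (\<Sum>j\<in>UNIV. a $ j * f (axis j 1, 0)) + (\<Sum>j\<in>UNIV. b $ j * f (0, axis j 1))" for a b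
  proof -
    have "linear (\<lambda>a. f (a, 0))" "linear (\<lambda>b. f (0, b))"
      by (auto intro!: linearI simp: add[symmetric] scaleR[symmetric] simp del: real_scaleR_def)
    moreover have "f (a, b) = f (a, 0) + f (0, b)" by (simp add: add[symmetric])
    ultimately show ?thesis
      using expand[of "\<lambda>a. f (a, 0)" a] expand[of "\<lambda>b. f (0, b)" b] by simp
  qed
  have eq: "(\<lambda>x. complex_of_real (f (cos_sin L x))) = (\<lambda>x.
     (\<Sum>j\<in>UNIV. complex_of_real (cos (2 * pi * x $ j / L $ j)) * of_real (f (axis j 1, 0))) +
     (\<Sum>j\<in>UNIV. complex_of_real (sin (2 * pi * x $ j / L $ j)) * of_real (f (0, axis j 1))))"
    unfolding cos_sin_def
    by (rule ext, subst fab) (simp only: of_real_add of_real_sum of_real_mult vec_lambda_beta)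
  show ?case
    unfolding eq sum_3 by (intro trig_polys.add trig_polys_mult trig_polys_cos_sin trig_polys_const)
next
  case (const c)
  show ?case by (rule trig_polys_const)
next
  case (add f g)
  show ?case using trig_polys.add[OF add.IH] by simp
next
  case (mult f g)
  show ?case using trig_polys_mult[OF mult.IH] by simp
qed

lemma trig_polys_continuous: "p \<in> trig_polys L \<Longrightarrow> continuous_on S p"
  by (induction rule: trig_polys.induct) (auto intro!: continuous_intros)

lemma trig_polys_bounded: "p \<in> trig_polys L \<Longrightarrow> \<exists>B. \<forall>x. norm (p x) \<le> B"
proof (induction rule: trig_polys.induct)
  case (char c k)
  show ?case by (rule exI[of _ "norm c"]) (simp add: norm_mult)
next
  case (add p q)
  then obtain A B where "\<And>x. norm (p x) \<le> A" "\<And>x. norm (q x) \<le> B" by blast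
  then show ?case by (intro exI[of _ "A + B"]) (meson add_mono norm_triangle_ineq order_trans allI)
qed

lemma measurable_cell_continuous:
  fixes f :: "real^3 \<Rightarrow> 'b::topological_space"
  shows "continuous_on UNIV f \<Longrightarrow> f \<in> borel_measurable (cell L)"
  by (intro measurable_cell borel_measurable_lebesgueI borel_measurable_continuous_onI)

lemma norm_cos_sin_le: "norm (cos_sin L x) \<le> 6"
proof -
  have "norm (cos_sin L x) \<le> norm (fst (cos_sin L x)) + norm (snd (cos_sin L x))"
    by (metis norm_Pair_le prod.collapse)
  also have "norm (fst (cos_sin L x)) \<le> (\<Sum>j\<in>UNIV. \<bar>fst (cos_sin L x) $ j\<bar>)" by (rule norm_le_l1_cart)
  also have "norm (snd (cos_sin L x)) \<le> (\<Sum>j\<in>UNIV. \<bar>snd (cos_sin L x) $ j\<bar>)" by (rule norm_le_l1_cart)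
  also have "(\<Sum>j\<in>UNIV. \<bar>fst (cos_sin L x) $ j\<bar>) \<le> (\<Sum>j\<in>(UNIV::3 set). 1)"
    by (intro sum_mono) (simp add: cos_sin_def)
  also have "(\<Sum>j\<in>UNIV. \<bar>snd (cos_sin L x) $ j\<bar>) \<le> (\<Sum>j\<in>(UNIV::3 set). 1)"
    by (intro sum_mono) (simp add: cos_sin_def)
  finally show ?thesis by simp
qed

text \<open>A point of the circle lies in the arc with midpoint \<open>a\<close> and half-width
  \<open>r\<close> iff the cosine of its angular distance to the midpoint exceeds that of the
  half-width. The conditions r \<le> a and a + r \<le> l keep the arc from wrapping around: the
  angle \<open>y\<close> never exceeds 2 pi - d, beyond which the cosine would be larger than cos d
  again.\<close>

lemma arc_iff:
  fixes x a r l :: real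
  assumes "0 < l" "0 \<le> x" "x \<le> l" "0 < r" "r \<le> a" "a + r \<le> l"
  shows "cos (2 * pi * r / l) < cos (2 * pi * x / l - 2 * pi * a / l) \<longleftrightarrow> \<bar>x - a\<bar> < r"
proof -
  define y where "y = 2 * pi * \<bar>x - a\<bar> / l"
  define d where "d = 2 * pi * r / l"
  have c: "cos (2 * pi * x / l - 2 * pi * a / l) = cos y"
  proof -
    have "2 * pi * x / l - 2 * pi * a / l = 2 * pi * (x - a) / l" by (simp add: diff_divide_distrib algebra_simps)
    moreover have "\<bar>2 * pi * (x - a) / l\<bar> = y" using assms by (simp add: y_def abs_mult)
    ultimately show ?thesis by (metis cos_abs_real)
  qed
  have iff: "y < d \<longleftrightarrow> \<bar>x - a\<bar> < r"
    using assms by (simp add: y_def d_def divide_less_cancel)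
  have y0: "0 \<le> y" and d0: "0 < d" using assms by (auto simp: y_def d_def)
  have dpi: "d \<le> pi" using assms by (simp add: d_def field_simps)
  have "2 * pi * \<bar>x - a\<bar> \<le> 2 * pi * (l - r)"
    using assms by (intro mult_left_mono) auto
  then have ybd: "y \<le> 2 * pi - d" using assms by (simp add: y_def d_def field_simps)
  have "cos d < cos y \<longleftrightarrow> y < d"
  proof (cases "y < d")
    case True
    then show ?thesis using cos_monotone_0_pi[of y d] y0 dpi by simp
  next
    case False
    have "cos y \<le> cos d"
    proof (cases "y \<le> pi")
      case True
      then show ?thesis using cos_monotone_0_pi_le[of d y] False d0 by simp
    next
      case F: False
      have "cos y = cos (2 * pi - y)" by simp
      then show ?thesis using cos_monotone_0_pi_le[of d "2 * pi - y"] F d0 ybd by simp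
    qed
    then show ?thesis using False by simp
  qed
  then show ?thesis using c iff d_def by simp
qed

lemma tendsto_cutoff: "(\<lambda>n. min 1 (real n * max 0 y)) \<longlonglongrightarrow> (if 0 < y then 1 else 0 :: real)"
proof (cases "0 < y")
  case True
  have "\<forall>\<^sub>F n in sequentially. min 1 (real n * max 0 y) = 1"
    using eventually_ge_at_top[of "nat \<lceil>1 / y\<rceil>"]
  proof eventually_elim
    case (elim n)
    then have "1 / y \<le> real n" by linarith
    then show ?case using True by (simp add: field_simps min_def max_def)
  qed
  then show ?thesis using True by (simp add: tendsto_eventually)
qed (simp add: max_def)

context torus
begin

lemma continuous_on_cos_sin: "continuous_on S (cos_sin L)"
proof -
  have "L $ j \<noteq> 0" for j using pos[of j] by simp
  then show ?thesis
    unfolding cos_sin_def by (intro continuous_intros continuous_on_Pair continuous_on_vec_lambda) auto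
qed

section \<open>Integrable functions with vanishing Fourier coefficients\<close>

context
  fixes G :: "real^3 \<Rightarrow> real"
  assumes int: "integrable (cell L) G"
    and zero: "\<And>k. (\<integral>x. complex_of_real (G x) * char L k x \<partial>cell L) = 0"
begin

lemma orthogonal_trig_polys: "p \<in> trig_polys L \<Longrightarrow> (\<integral>x. complex_of_real (G x) * p x \<partial>cell L) = 0"
proof (induction rule: trig_polys.induct)
  case (char c k)
  have "(\<integral>x. complex_of_real (G x) * (c * char L k x) \<partial>cell L) = (\<integral>x. c * (complex_of_real (G x) * char L k x) \<partial>cell L)"
    by (simp add: mult_ac)
  then show ?case by (simp only: integral_mult_right_zero zero mult_zero_right)
next
  case (add p q)
  have "integrable (cell L) (\<lambda>x. complex_of_real (G x) * p x)" if "p \<in> trig_polys L" for p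
    using trig_polys_bounded[OF that] int
    by (auto intro!: integrable_mult_bounded measurable_cell_continuous trig_polys_continuous[OF that])
  then show ?case using add by (simp add: distrib_left)
qed

text \<open>Uniform approximation of \<open>H\<close> by polynomials on the ball containing the
  image of \<open>cos_sin L\<close> bounds the integral by e times the L1 norm of \<open>G\<close>
  for every e > 0.\<close>

lemma orthogonal_continuous:
  fixes H :: "(real^3) \<times> (real^3) \<Rightarrow> real"
  assumes H: "continuous_on UNIV H"
  shows "(\<integral>x. G x * H (cos_sin L x) \<partial>cell L) = 0"
proof -
  let ?S = "cball (0 :: (real^3) \<times> (real^3)) 6"
  have Hc: "continuous_on UNIV (\<lambda>x. H (cos_sin L x))"
    by (rule continuous_on_compose2[OF H continuous_on_cos_sin]) auto
  have inS: "cos_sin L x \<in> ?S" for x using norm_cos_sin_le by simp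
  have bd: "\<exists>B. \<forall>x. norm (f (cos_sin L x)) \<le> B" if "continuous_on ?S f" for f :: "(real^3) \<times> (real^3) \<Rightarrow> real"
    using compact_imp_bounded[OF compact_continuous_image[OF that compact_cball]] inS
    unfolding bounded_iff by (metis image_eqI)
  have i: "integrable (cell L) (\<lambda>x. G x * f (cos_sin L x))" if f: "continuous_on UNIV f" for f :: "(real^3) \<times> (real^3) \<Rightarrow> real"
  proof -
    obtain B where "\<And>x. norm (f (cos_sin L x)) \<le> B" using bd[OF continuous_on_subset[OF f]] by auto
    moreover have "continuous_on UNIV (\<lambda>x. f (cos_sin L x))"
      by (rule continuous_on_compose2[OF f continuous_on_cos_sin]) auto
    ultimately show ?thesis
      by (intro integrable_mult_bounded[OF int]) (auto intro: measurable_cell_continuous)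
  qed
  have small: "\<bar>\<integral>x. G x * H (cos_sin L x) \<partial>cell L\<bar> \<le> e * (\<integral>x. \<bar>G x\<bar> \<partial>cell L)" if e: "e > 0" for e
  proof -
    obtain q where q: "real_polynomial_function q" "\<And>z. z \<in> ?S \<Longrightarrow> \<bar>H z - q z\<bar> < e"
      using Stone_Weierstrass_real_polynomial_function[of ?S H e] e continuous_on_subset[OF H]
      by (metis compact_cball subset_UNIV)
    have qc: "continuous_on UNIV q"
      using q(1) by (simp add: real_polynomial_function_eq continuous_on_polymonial_function)
    have "complex_of_real (\<integral>x. G x * q (cos_sin L x) \<partial>cell L) = (\<integral>x. complex_of_real (G x) * complex_of_real (q (cos_sin L x)) \<partial>cell L)"
      by (simp flip: integral_complex_of_real)
    also have "\<dots> = 0" by (rule orthogonal_trig_polys[OF trig_polys_polynomial[OF q(1)]])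
    finally have "(\<integral>x. G x * q (cos_sin L x) \<partial>cell L) = 0" by simp
    then have "(\<integral>x. G x * H (cos_sin L x) \<partial>cell L) = (\<integral>x. G x * H (cos_sin L x) - G x * q (cos_sin L x) \<partial>cell L)"
      using i[OF H] i[OF qc] by simp
    also have "\<bar>\<dots>\<bar> \<le> (\<integral>x. e * \<bar>G x\<bar> \<partial>cell L)"
    proof -
      have "norm (\<integral>x. G x * H (cos_sin L x) - G x * q (cos_sin L x) \<partial>cell L) \<le> (\<integral>x. e * \<bar>G x\<bar> \<partial>cell L)"
      proof (rule Bochner_Integration.integral_norm_bound_integral)
        show "integrable (cell L) (\<lambda>x. G x * H (cos_sin L x) - G x * q (cos_sin L x))"
          using i[OF H] i[OF qc] by simp
        show "integrable (cell L) (\<lambda>x. e * \<bar>G x\<bar>)" using int by simp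
        show "norm (G x * H (cos_sin L x) - G x * q (cos_sin L x)) \<le> e * \<bar>G x\<bar>" for x
          using q(2)[OF inS[of x]] by (simp add: right_diff_distrib[symmetric] abs_mult mult.commute[of e] mult_left_mono less_imp_le)
      qed
      then show ?thesis by simp
    qed
    finally show ?thesis by simp
  qed
  show ?thesis
  proof (rule ccontr)
    assume nz: "(\<integral>x. G x * H (cos_sin L x) \<partial>cell L) \<noteq> 0"
    let ?I = "\<bar>\<integral>x. G x * H (cos_sin L x) \<partial>cell L\<bar>" and ?J = "\<integral>x. \<bar>G x\<bar> \<partial>cell L"
    have J: "0 \<le> ?J" by simp
    \<comment> \<open>With a the absolute value of the integral and b the L1 norm of
      \<open>G\<close>, the choice e = a / (2 (b + 1)) contradicts the bound; the added 1 covers b =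
      0.\<close>
    have arith: "a / (2 * (b + 1)) * b < a" "0 < a / (2 * (b + 1))" if "0 < a" "0 \<le> b" for a b :: real
      using that by (auto simp: field_simps intro!: add_nonneg_pos)
    have I: "0 < ?I" using nz by simp
    have "?I \<le> ?I / (2 * (?J + 1)) * ?J" using arith(2)[OF I J] by (rule small)
    also have "\<dots> < ?I" by (rule arith(1)[OF I J])
    finally show False by simp
  qed
qed

text \<open>On the cell the indicator of the box is a pointwise limit of continuous functions of
  \<open>cos_sin L\<close>, obtained by cutting off the positive parts of \<open>v\<close>; the
  absolute value of \<open>G\<close> dominates.\<close>

lemma orthogonal_box:
  assumes pq: "\<And>j. 0 \<le> p $ j \<and> p $ j < q $ j \<and> q $ j \<le> L $ j"
  shows "(\<integral>x. G x * indicator (box p q) x \<partial>cell L) = 0"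
proof -
  define a where "a j = (p $ j + q $ j) / 2" for j
  define r where "r j = (q $ j - p $ j) / 2" for j
  \<comment> \<open>The cosine of the angular distance to the midpoint minus the cosine of the
    half-width, expanded by the addition theorem so that it is affine in the cosine and sine
    coordinates.\<close>
  define v where "v j z = fst z $ j * cos (2 * pi * a j / L $ j) + snd z $ j * sin (2 * pi * a j / L $ j)
      - cos (2 * pi * r j / L $ j)" for j and z :: "(real^3) \<times> (real^3)"
  define H where "H n z = (\<Prod>j\<in>UNIV. min 1 (real n * max 0 (v j z)))" for n and z :: "(real^3) \<times> (real^3)"
  have Hc: "continuous_on UNIV (H n)" for n
    unfolding H_def v_def by (intro continuous_intros)
  have H01: "0 \<le> H n z \<and> H n z \<le> 1" for n z
    unfolding H_def by (intro conjI prod_nonneg prod_le_1) auto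
  have pos_iff: "0 < v j (cos_sin L x) \<longleftrightarrow> p $ j < x $ j \<and> x $ j < q $ j" if "x \<in> cbox 0 L" for j x
  proof -
    have "v j (cos_sin L x) = cos (2 * pi * x $ j / L $ j - 2 * pi * a j / L $ j) - cos (2 * pi * r j / L $ j)"
      by (simp add: v_def cos_sin_def cos_diff)
    moreover have "cos (2 * pi * r j / L $ j) < cos (2 * pi * x $ j / L $ j - 2 * pi * a j / L $ j) \<longleftrightarrow> \<bar>x $ j - a j\<bar> < r j"
      using pq[of j] pos[of j] that by (intro arc_iff) (auto simp: mem_box_cart a_def r_def field_simps)
    moreover have "\<bar>x $ j - a j\<bar> < r j \<longleftrightarrow> p $ j < x $ j \<and> x $ j < q $ j"
      by (auto simp: a_def r_def abs_less_iff field_simps)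
    ultimately show ?thesis by simp
  qed
  have lim: "(\<lambda>n. H n (cos_sin L x)) \<longlonglongrightarrow> indicator (box p q) x" if "x \<in> cbox 0 L" for x
  proof -
    have "(\<lambda>n. H n (cos_sin L x)) \<longlonglongrightarrow> (\<Prod>j\<in>UNIV. if 0 < v j (cos_sin L x) then 1 else 0)"
      unfolding H_def by (intro tendsto_prod tendsto_cutoff)
    also have "(\<Prod>j\<in>UNIV. if 0 < v j (cos_sin L x) then 1 else 0 :: real) = indicator (box p q) x"
      by (auto simp: pos_iff[OF that] indicator_def mem_box_cart)
    finally show ?thesis .
  qed
  have "(\<lambda>n. \<integral>x. G x * H n (cos_sin L x) \<partial>cell L) \<longlonglongrightarrow> (\<integral>x. G x * indicator (box p q) x \<partial>cell L)"
  proof (rule integral_dominated_convergence[where w="\<lambda>x. \<bar>G x\<bar>"])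
    have "indicator (box p q) \<in> borel_measurable (cell L)"
      by (intro measurable_cell borel_measurable_lebesgueI) simp
    then show "(\<lambda>x. G x * indicator (box p q) x) \<in> borel_measurable (cell L)"
      by (intro borel_measurable_times borel_measurable_integrable[OF int])
    show "(\<lambda>x. G x * H n (cos_sin L x)) \<in> borel_measurable (cell L)" for n
      by (rule borel_measurable_times[OF borel_measurable_integrable[OF int]],
          rule measurable_cell_continuous, rule continuous_on_compose2[OF Hc continuous_on_cos_sin]) auto
    show "AE x in cell L. (\<lambda>n. G x * H n (cos_sin L x)) \<longlonglongrightarrow> G x * indicator (box p q) x"
      by (intro AE_I2 tendsto_intros lim) simp
    show "AE x in cell L. norm (G x * H n (cos_sin L x)) \<le> \<bar>G x\<bar>" for n
      using H01 by (intro AE_I2) (simp add: abs_mult mult_left_le)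
  qed (use int in simp)
  then show ?thesis
    by (simp add: orthogonal_continuous[OF Hc] LIMSEQ_const_iff)
qed

text \<open>Dynkin's argument on the intersection-stable generator of open boxes. The complement
  step needs the integral of \<open>G\<close> over the cell to vanish, which is the hypothesis
  \<open>zero\<close> at k = 0.\<close>

lemma orthogonal_borel:
  assumes "A \<in> sets borel"
  shows "(\<integral>x. G x * indicator A x \<partial>cell L) = 0"
proof -
  have iA: "integrable (cell L) (\<lambda>x. G x * indicator A x)" if "A \<in> sets borel" for A
    using that by (intro integrable_mult_bounded[OF int, of _ 1] measurable_cell borel_measurable_lebesgueI)
      (auto simp: indicator_def)
  have "Int_stable (range (\<lambda>(a, b). box a b) :: (real^3) set set)"
    by (auto simp: Int_stable_def box_Int_box)
  moreover have "range (\<lambda>(a, b). box a b) \<subseteq> Pow (UNIV :: (real^3) set)" by auto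
  moreover have "A \<in> sigma_sets UNIV (range (\<lambda>(a, b). box a b))"
    using assms by (simp add: borel_eq_box)
  ultimately show ?thesis
  proof (induction rule: sigma_sets_induct_disjoint)
    case (basic A)
    then obtain a b where A: "A = box a b" by auto
    \<comment> \<open>Clipping the box to the cell changes the integrand only on the boundary of the
      cell, a null set, and the clipped box meets the hypotheses of \<open>orthogonal_box\<close>
      unless it is empty.\<close>
    define p where "p = (\<chi> j. max (a $ j) 0)"
    define q where "q = (\<chi> j. min (b $ j) (L $ j))"
    have neg: "AE x in cell L. x \<in> box 0 L"
    proof -
      have "cbox 0 L - box 0 L \<in> null_sets lebesgue"
        using negligible_frontier_interval negligible_iff_null_sets by blast
      then have "AE x in lebesgue. x \<notin> cbox 0 L - box 0 L" by (rule AE_not_in)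
      then show ?thesis by (auto simp: AE_restrict_space_iff elim: eventually_mono)
    qed
    have eq: "(\<integral>x. G x * indicator A x \<partial>cell L) = (\<integral>x. G x * indicator (box p q) x \<partial>cell L)"
    proof (rule integral_cong_AE)
      show "AE x in cell L. G x * indicator A x = G x * indicator (box p q) x"
        using neg
      proof eventually_elim
        case (elim x)
        then have "x \<in> A \<longleftrightarrow> x \<in> box p q" by (auto simp: A p_def q_def mem_box_cart)
        then show ?case by (simp add: indicator_def)
      qed
    qed (use iA[of A] iA[of "box p q"] A in auto)
    show ?case
    proof (cases "\<forall>j. p $ j < q $ j")
      case True
      show ?thesis unfolding eq by (rule orthogonal_box) (use True in \<open>auto simp: p_def q_def\<close>)
    next
      case False
      then have "box p q = {}" by (auto simp: mem_box_cart) (meson less_trans)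
      then show ?thesis unfolding eq by simp
    qed
  next
    case empty
    show ?case by simp
  next
    case (compl A)
    have A: "A \<in> sets borel" using compl by (simp add: borel_eq_box)
    have "complex_of_real (\<integral>x. G x \<partial>cell L) = 0"
      using zero[of 0] by (simp add: wave_zero)
    then have "(\<integral>x. G x \<partial>cell L) = 0" by simp
    moreover have "(\<integral>x. G x * indicator (UNIV - A) x \<partial>cell L) = (\<integral>x. G x - G x * indicator A x \<partial>cell L)"
      by (intro Bochner_Integration.integral_cong refl) (simp add: indicator_def)
    ultimately show ?case using int iA[OF A] compl by simp
  next
    case (union A)
    have A: "A i \<in> sets borel" for i using union by (auto simp: borel_eq_box)
    have fin: "(\<integral>x. G x * indicator (\<Union>i<n. A i) x \<partial>cell L) = 0" for n
    proof -
      have "disjoint_family_on A {..<n}"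
        using union.hyps(1) by (rule disjoint_family_on_mono[rotated]) simp
      then have "(\<integral>x. G x * indicator (\<Union>i<n. A i) x \<partial>cell L) = (\<integral>x. (\<Sum>i<n. G x * indicator (A i) x) \<partial>cell L)"
        by (simp add: indicator_UN_disjoint sum_distrib_left)
      also have "\<dots> = (\<Sum>i<n. \<integral>x. G x * indicator (A i) x \<partial>cell L)"
        by (intro Bochner_Integration.integral_sum iA A)
      finally show ?thesis using union.IH by simp
    qed
    have "(\<lambda>n. \<integral>x. G x * indicator (\<Union>i<n. A i) x \<partial>cell L) \<longlonglongrightarrow> (\<integral>x. G x * indicator (\<Union>i. A i) x \<partial>cell L)"
    proof (rule integral_dominated_convergence[where w="\<lambda>x. \<bar>G x\<bar>"])
      show "(\<lambda>x. G x * indicator (\<Union>i. A i) x) \<in> borel_measurable (cell L)"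
        by (intro borel_measurable_integrable iA sets.countable_UN) (use A in auto)
      show "(\<lambda>x. G x * indicator (\<Union>i<n. A i) x) \<in> borel_measurable (cell L)" for n
        by (intro borel_measurable_integrable iA sets.finite_UN) (use A in auto)
      show "AE x in cell L. (\<lambda>n. G x * indicator (\<Union>i<n. A i) x) \<longlonglongrightarrow> G x * indicator (\<Union>i. A i) x"
        by (intro AE_I2 tendsto_intros LIMSEQ_indicator_UN)
      show "AE x in cell L. norm (G x * indicator (\<Union>i<n. A i) x) \<le> \<bar>G x\<bar>" for n
        by (intro AE_I2) (simp add: indicator_def)
    qed (use int in simp)
    then show ?case by (simp add: fin LIMSEQ_const_iff)
  qed
qed

text \<open>\<open>G\<close> is the density of the zero signed measure. Uniqueness of densities is
  applied to a Borel version of \<open>G\<close> extended by 0 outside the cell, and the result is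
  carried back to the completed measure.\<close>

lemma orthogonal_imp_AE_0: "AE x in cell L. G x = 0"
proof -
  define G0 where "G0 x = indicator (cbox 0 L) x * G x" for x
  have i0: "integrable lebesgue G0"
    using int by (simp add: integrable_restrict_space G0_def[abs_def])
  obtain G1 where G1: "G1 \<in> borel_measurable lborel" "AE x in lborel. G0 x = G1 x"
    using completion_ex_borel_measurable_real[OF borel_measurable_integrable[OF i0]] by blast
  have ae: "AE x in lebesgue. G0 x = G1 x" using G1(2) by (rule AE_completion)
  have G1m: "G1 \<in> borel_measurable lebesgue" using G1(1) by (intro borel_measurable_lebesgueI) simp
  have "integrable lebesgue G1" using i0 G1m ae by (rule integrable_cong_AE_imp)
  then have i1: "integrable lborel G1" using integrable_completion[OF G1(1)] by simp
  have "AE x in lborel. G1 x = 0"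
  proof (rule density_unique_real[OF i1])
    fix A :: "(real^3) set" assume A: "A \<in> sets lborel"
    have "(\<integral>x\<in>A. G1 x \<partial>lborel) = (\<integral>x. indicator A x *\<^sub>R G1 x \<partial>lebesgue)"
      unfolding set_lebesgue_integral_def using A G1(1) by (intro integral_completion[symmetric]) simp
    also have "\<dots> = (\<integral>x. indicator (cbox 0 L) x *\<^sub>R (G x * indicator A x) \<partial>lebesgue)"
    proof (rule integral_cong_AE)
      show "(\<lambda>x. indicator A x *\<^sub>R G1 x) \<in> borel_measurable lebesgue"
        using A G1(1) by (intro borel_measurable_lebesgueI) simp
      have "(\<lambda>x. G0 x * indicator A x) \<in> borel_measurable lebesgue"
        using A borel_measurable_integrable[OF i0]
        by (intro borel_measurable_times borel_measurable_lebesgueI[of "indicator A"]) auto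
      then show "(\<lambda>x. indicator (cbox 0 L) x *\<^sub>R (G x * indicator A x)) \<in> borel_measurable lebesgue"
        by (simp add: G0_def mult.assoc)
      show "AE x in lebesgue. indicator A x *\<^sub>R G1 x = indicator (cbox 0 L) x *\<^sub>R (G x * indicator A x)"
        using ae
      proof eventually_elim
        case (elim x)
        show ?case unfolding elim[symmetric] by (simp add: G0_def)
      qed
    qed
    also have "\<dots> = (\<integral>x. G x * indicator A x \<partial>cell L)"
      by (simp add: integral_restrict_space)
    also have "\<dots> = 0" using A by (intro orthogonal_borel) simp
    finally show "(\<integral>x\<in>A. G1 x \<partial>lborel) = (\<integral>x\<in>A. 0 \<partial>lborel)" by simp
  qed simp
  then have "AE x in lebesgue. G1 x = 0" by (rule AE_completion)
  then have "AE x in lebesgue. G0 x = 0" using ae by eventually_elim simp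
  then show ?thesis
    by (auto simp: AE_restrict_space_iff G0_def elim: eventually_mono)
qed

end

end

section \<open>Trigonometric fields and weak derivatives\<close>

lemma integral_lborel_prod:
  fixes f :: "'a::euclidean_space \<Rightarrow> real \<Rightarrow> complex"
  assumes f: "\<And>b. b \<in> Basis \<Longrightarrow> integrable lborel (f b)"
  shows "(\<integral>x. (\<Prod>b\<in>Basis. f b (x \<bullet> b)) \<partial>lborel) = (\<Prod>b\<in>Basis. \<integral>y. f b y \<partial>lborel)"
proof -
  interpret product_sigma_finite "\<lambda>_ :: 'a. lborel :: real measure"
    by unfold_locales
  have [measurable]: "f b \<in> borel_measurable borel" if "b \<in> Basis" for b
    using borel_measurable_integrable[OF f[OF that]] by simp
  have "(\<integral>x. (\<Prod>b\<in>Basis. f b (x \<bullet> b)) \<partial>lborel) =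
      (\<integral>y. (\<Prod>b\<in>Basis. f b ((\<Sum>b'\<in>Basis. y b' *\<^sub>R b') \<bullet> b)) \<partial>(\<Pi>\<^sub>M b\<in>(Basis::'a set). lborel))"
    by (subst lborel_eq, subst integral_distr) simp_all
  also have "\<dots> = (\<integral>y. (\<Prod>b\<in>Basis. f b (y b)) \<partial>(\<Pi>\<^sub>M b\<in>(Basis::'a set). lborel))"
    by simp
  also have "\<dots> = (\<Prod>b\<in>Basis. \<integral>y. f b y \<partial>lborel)"
    using f by (intro product_integral_prod) auto
  finally show ?thesis .
qed

lemma integral_exp_period:
  fixes a l :: real and n :: int
  assumes "0 < l" "a * l = 2 * pi * of_int n" "n \<noteq> 0"
  shows "(\<integral>y. indicator {0..l} y *\<^sub>R exp (\<i> * complex_of_real (a * y)) \<partial>lborel) = 0"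
proof -
  have a: "a \<noteq> 0" using assms by auto
  let ?F = "\<lambda>y. exp (\<i> * complex_of_real (a * y)) / (\<i> * complex_of_real a)"
  have "(\<integral>y. indicator {0..l} y *\<^sub>R exp (\<i> * complex_of_real (a * y)) \<partial>lborel) = ?F l - ?F 0"
  proof (rule integral_FTC_Icc)
    fix y :: real
    have "((\<lambda>z. exp (\<i> * complex_of_real a * z) / (\<i> * complex_of_real a)) has_field_derivative
        exp (\<i> * complex_of_real a * of_real y)) (at (of_real y))"
      using a by (auto intro!: derivative_eq_intros)
    from has_vector_derivative_real_field[OF this, of "{0..l}"]
    show "(?F has_vector_derivative exp (\<i> * complex_of_real (a * y))) (at y within {0..l})"
      by (simp add: mult.assoc)
  qed (use assms in \<open>auto intro!: continuous_intros\<close>)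
  also have "exp (\<i> * complex_of_real (a * l)) = 1"
    unfolding assms(2) using exp_integer_2pi[of "of_int n"] by (simp add: mult_ac)
  finally show ?thesis by simp
qed

definition vol :: "real^3 \<Rightarrow> real" where "vol L = (\<Prod>j\<in>UNIV. L $ j)"

text \<open>Finite support and reality, without the divergence condition and the zero mean of
  \<open>trig_field\<close>, because non-solenoidal test modes such as
  \<open>mode 1 p \<beta>\<close> have to be covered as well.\<close>

definition hermitian :: "(int^3 \<Rightarrow> complex^3) \<Rightarrow> bool" where
  "hermitian c \<longleftrightarrow> finite {k. c k \<noteq> 0} \<and> (\<forall>k j. c (- k) $ j = cnj (c k $ j))"

text \<open>Taking the real part makes this a real field for every \<open>c\<close>; for hermitian
  \<open>c\<close> nothing is lost, by \<open>tfun_complex\<close>.\<close>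

definition tfun :: "real^3 \<Rightarrow> (int^3 \<Rightarrow> complex^3) \<Rightarrow> real^3 \<Rightarrow> real^3" where
  "tfun L c x = (\<chi> j. Re (\<Sum>k | c k \<noteq> 0. c k $ j * char L k x))"

definition tfield :: "real^3 \<Rightarrow> (int^3 \<Rightarrow> complex^3) \<Rightarrow> vfield" where
  "tfield L c = abs_vfield (tfun L c)"

lemma sum_supp:
  assumes "finite K" "{k. c k \<noteq> (0 :: complex^3)} \<subseteq> K" "\<And>k. c k = 0 \<Longrightarrow> f k = 0"
  shows "sum f {k. c k \<noteq> 0} = sum f K"
  by (rule sum.mono_neutral_left) (use assms in auto)

lemma tfun_eq_sum:
  assumes "finite K" "{k. c k \<noteq> 0} \<subseteq> K"
  shows "tfun L c x $ j = Re (\<Sum>k\<in>K. c k $ j * char L k x)"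
  unfolding tfun_def vec_lambda_beta by (subst sum_supp[OF assms]) auto

text \<open>The substitution of -k for k shows that the sum equals its own conjugate.\<close>

lemma tfun_complex:
  assumes "hermitian c"
  shows "complex_of_real (tfun L c x $ j) = (\<Sum>k | c k \<noteq> 0. c k $ j * char L k x)"
proof -
  let ?S = "\<Sum>k | c k \<noteq> 0. c k $ j * char L k x"
  have h: "c (- k) $ j = cnj (c k $ j)" for k j using assms by (simp add: hermitian_def)
  have nz: "c (- k) \<noteq> 0 \<longleftrightarrow> c k \<noteq> 0" for k
    using h[of k] h[of "- k"] by (auto simp: vec_eq_iff)
  have "cnj ?S = (\<Sum>k | c k \<noteq> 0. c (- k) $ j * char L (- k) x)"
    by (simp add: h cnj_char[symmetric])
  also have "\<dots> = ?S"
    by (rule sum.reindex_bij_witness[of _ uminus uminus]) (auto simp: nz)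
  finally have "?S \<in> \<real>" by (simp add: Reals_cnj_iff)
  then show ?thesis by (simp add: tfun_def del: Re_sum)
qed

lemma continuous_on_tfun: "continuous_on S (tfun L c)"
  unfolding tfun_def by (intro continuous_intros continuous_on_vec_lambda)

lemma measurable_tfun [measurable]: "tfun L c \<in> borel_measurable lebesgue"
  by (intro borel_measurable_lebesgueI borel_measurable_continuous_onI continuous_on_tfun)

lemma rep_tfield: "AE x in lebesgue. rep_vfield (tfield L c) x = tfun L c x"
  unfolding tfield_def by (rule rep_abs_vfield) simp

lemma hermitian_add:
  assumes "hermitian c" "hermitian d" shows "hermitian (\<lambda>k. c k + d k)"
proof -
  have "{k. c k + d k \<noteq> 0} \<subseteq> {k. c k \<noteq> 0} \<union> {k. d k \<noteq> 0}" by auto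
  then show ?thesis using assms by (auto simp: hermitian_def intro: finite_subset)
qed

lemma hermitian_scaleR:
  assumes "hermitian c" shows "hermitian (\<lambda>k. a *\<^sub>R c k)"
proof -
  have "{k. a *\<^sub>R c k \<noteq> 0} \<subseteq> {k. c k \<noteq> 0}" by auto
  then show ?thesis using assms by (auto simp: hermitian_def intro: finite_subset)
qed

lemma tfield_add:
  assumes "hermitian c" "hermitian d"
  shows "tfield L (\<lambda>k. c k + d k) = tfield L c + tfield L d"
proof -
  let ?K = "{k. c k \<noteq> 0} \<union> {k. d k \<noteq> 0}"
  have K: "finite ?K" using assms by (simp add: hermitian_def)
  have "tfun L (\<lambda>k. c k + d k) x $ j = tfun L c x $ j + tfun L d x $ j" for x j
    using tfun_eq_sum[OF K, of c L x j] tfun_eq_sum[OF K, of d L x j] tfun_eq_sum[OF K, of "\<lambda>k. c k + d k" L x j]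
    by (force simp: distrib_right sum.distrib)
  then have eq: "tfun L (\<lambda>k. c k + d k) x = tfun L c x + tfun L d x" for x
    by (simp add: vec_eq_iff)
  show ?thesis
  proof (rule vfield_eqI)
    show "AE x in lebesgue. rep_vfield (tfield L (\<lambda>k. c k + d k)) x = rep_vfield (tfield L c + tfield L d) x"
      using rep_tfield[of L c] rep_tfield[of L d] rep_tfield[of L "\<lambda>k. c k + d k"] rep_plus_vfield[of "tfield L c" "tfield L d"]
      by eventually_elim (simp add: eq)
  qed
qed

lemma tfield_scaleR:
  assumes "hermitian c" shows "tfield L (\<lambda>k. a *\<^sub>R c k) = a *\<^sub>R tfield L c"
proof -
  have K: "finite {k. c k \<noteq> 0}" using assms by (simp add: hermitian_def)
  have "tfun L (\<lambda>k. a *\<^sub>R c k) x $ j = a * tfun L c x $ j" for x j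
  proof -
    have "tfun L (\<lambda>k. a *\<^sub>R c k) x $ j = Re (\<Sum>k | c k \<noteq> 0. (a *\<^sub>R c k) $ j * char L k x)"
      by (rule tfun_eq_sum[OF K]) auto
    also have "\<dots> = Re (a *\<^sub>R (\<Sum>k | c k \<noteq> 0. c k $ j * char L k x))"
      by (simp add: scaleR_sum_right)
    finally show ?thesis by (simp add: tfun_def del: Re_sum)
  qed
  then have eq: "tfun L (\<lambda>k. a *\<^sub>R c k) x = a *\<^sub>R tfun L c x" for x
    by (simp add: vec_eq_iff)
  show ?thesis
  proof (rule vfield_eqI)
    show "AE x in lebesgue. rep_vfield (tfield L (\<lambda>k. a *\<^sub>R c k)) x = rep_vfield (a *\<^sub>R tfield L c) x"
      using rep_tfield[of L c] rep_tfield[of L "\<lambda>k. a *\<^sub>R c k"] rep_scaleR_vfield[of a "tfield L c"]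
      by eventually_elim (simp add: eq)
  qed
qed

lemma fourier_eq: "fourier L u k $ i = complex_of_real (1 / vol L) * (\<integral>x. complex_of_real (rep_vfield u x $ i) * char L (- k) x \<partial>cell L)"
  by (simp add: fourier_def vol_def set_integral_cell wave_minus)

definition pd_coeff :: "real^3 \<Rightarrow> 3 \<Rightarrow> (int^3 \<Rightarrow> complex^3) \<Rightarrow> int^3 \<Rightarrow> complex^3" where
  "pd_coeff L j c k = (\<chi> i. \<i> * complex_of_real (wave L k $ j) * c k $ i)"

lemma hermitian_pd_coeff:
  assumes "hermitian c" shows "hermitian (pd_coeff L j c)"
proof -
  have "{k. pd_coeff L j c k \<noteq> 0} \<subseteq> {k. c k \<noteq> 0}" by (auto simp: pd_coeff_def vec_eq_iff)
  then show ?thesis using assms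
    by (auto simp: hermitian_def pd_coeff_def wave_minus intro: finite_subset)
qed

definition lap_coeff :: "real^3 \<Rightarrow> (int^3 \<Rightarrow> complex^3) \<Rightarrow> int^3 \<Rightarrow> complex^3" where
  "lap_coeff L c k = (norm (wave L k))\<^sup>2 *\<^sub>R c k"

lemma hermitian_lap_coeff:
  assumes "hermitian c" shows "hermitian (lap_coeff L c)"
proof -
  have "{k. lap_coeff L c k \<noteq> 0} \<subseteq> {k. c k \<noteq> 0}" by (auto simp: lap_coeff_def vec_eq_iff)
  then show ?thesis using assms
    by (auto simp: hermitian_def lap_coeff_def wave_minus intro: finite_subset)
qed

context torus
begin

lemma vol_pos: "vol L > 0"
  unfolding vol_def using pos by (intro prod_pos) auto

text \<open>For k \<noteq> 0 the integral factorizes over the coordinates, and the factor of a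
  coordinate with \<open>k $ j \<noteq> 0\<close> runs over full periods of an exponential.\<close>

lemma integral_char: "(\<integral>x. char L k x \<partial>cell L) = (if k = 0 then complex_of_real (vol L) else 0)"
proof (cases "k = 0")
  case True
  have ne: "cbox 0 L \<noteq> {}" using pos by (auto simp: interval_ne_empty_cart less_imp_le)
  have "(\<integral>x. char L k x \<partial>cell L) = of_real (measure lebesgue (cbox 0 L))"
    using True by (simp add: wave_zero measure_restrict_space scaleR_conv_of_real)
  also have "measure lebesgue (cbox 0 L) = vol L"
    using content_cbox_cart[OF ne] by (simp add: vol_def)
  finally show ?thesis using True by simp
next
  case False
  then obtain j where j: "k $ j \<noteq> 0" by (auto simp: vec_eq_iff)
  define f where "f b y = indicator {0..L \<bullet> b} y *\<^sub>R exp (\<i> * complex_of_real ((wave L k \<bullet> b) * y))" for b y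
  have prod: "indicator (cbox 0 L) x *\<^sub>R char L k x = (\<Prod>b\<in>Basis. f b (x \<bullet> b))" for x
  proof -
    have "char L k x = exp (\<Sum>b\<in>Basis. \<i> * complex_of_real ((wave L k \<bullet> b) * (x \<bullet> b)))"
      by (simp add: euclidean_inner[of "wave L k" x] sum_distrib_left)
    also have "\<dots> = (\<Prod>b\<in>Basis. exp (\<i> * complex_of_real ((wave L k \<bullet> b) * (x \<bullet> b))))"
      by (rule exp_sum) simp
    finally have e: "char L k x = \<dots>" .
    show ?thesis
    proof (cases "x \<in> cbox 0 L")
      case True
      then have "f b (x \<bullet> b) = exp (\<i> * complex_of_real ((wave L k \<bullet> b) * (x \<bullet> b)))" if "b \<in> Basis" for b
        using that by (simp add: f_def mem_box)
      then show ?thesis using True unfolding e by simp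
    next
      case F: False
      then obtain b where b: "b \<in> Basis" "x \<bullet> b \<notin> {0..L \<bullet> b}" by (auto simp: mem_box)
      then have "f b (x \<bullet> b) = 0" by (simp add: f_def)
      then have "(\<Prod>b\<in>Basis. f b (x \<bullet> b)) = 0"
        using b(1) by (intro prod_zero) auto
      then show ?thesis using F by simp
    qed
  qed
  have int: "integrable lborel (f b)" for b
    unfolding f_def by (intro borel_integrable_compact) (auto intro!: continuous_intros)
  have b: "axis j 1 \<in> (Basis :: (real^3) set)" by simp
  have "(\<integral>x. char L k x \<partial>cell L) = (\<integral>x. indicator (cbox 0 L) x *\<^sub>R char L k x \<partial>lebesgue)"
    by (simp add: integral_restrict_space)
  also have "\<dots> = (\<integral>x. indicator (cbox 0 L) x *\<^sub>R char L k x \<partial>lborel)"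
    by (intro integral_completion)
       (auto intro!: borel_measurable_scaleR borel_measurable_continuous_onI continuous_on_char)
  also have "\<dots> = (\<Prod>b\<in>Basis. \<integral>y. f b y \<partial>lborel)"
    unfolding prod by (intro integral_lborel_prod int)
  also have "\<dots> = 0"
  proof (rule prod_zero)
    have "(\<integral>y. f (axis j 1) y \<partial>lborel) = 0"
      unfolding f_def
      by (rule integral_exp_period[where n="k $ j"])
         (use pos[of j] j in \<open>simp_all add: inner_axis wave_def\<close>)
    then show "\<exists>b\<in>Basis. (\<integral>y. f b y \<partial>lborel) = 0" using b by blast
  qed simp
  finally show ?thesis using False by simp
qed

lemma char_periodic: "char L k (x + axis j (L $ j)) = char L k x"
proof -
  have "wave L k \<bullet> axis j (L $ j) = 2 * pi * of_int (k $ j)"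
    using pos[of j] by (simp add: inner_axis wave_def)
  then have "\<i> * complex_of_real (wave L k \<bullet> (x + axis j (L $ j))) = \<i> * complex_of_real (wave L k \<bullet> x) + 2 * of_int (k $ j) * pi * \<i>"
    by (simp add: inner_add_right algebra_simps)
  moreover have "exp (2 * of_int (k $ j) * pi * \<i>) = 1"
    using exp_integer_2pi[of "of_int (k $ j)"] by (simp add: mult_ac)
  ultimately show ?thesis by (simp only: exp_add mult_1_right)
qed

lemma tfun_periodic: "periodic L (tfun L c)"
  by (simp add: periodic_def tfun_def char_periodic)

lemma tfield_L2: "tfield L c \<in> L2 L"
  by (rule L2_I[OF rep_tfield tfun_periodic])
     (intro integrable_cell_continuous continuous_intros continuous_on_tfun)

lemma integrable_char_cell: "integrable (cell L) (char L k)"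
  by (intro integrable_cell_continuous continuous_on_char)

lemma fourier_tfield:
  assumes c: "hermitian c" shows "fourier L (tfield L c) k = c k"
proof -
  have "fourier L (tfield L c) k $ i = c k $ i" for i
  proof -
    have "(\<integral>x. complex_of_real (rep_vfield (tfield L c) x $ i) * char L (- k) x \<partial>cell L) =
      (\<integral>x. (\<Sum>l | c l \<noteq> 0. c l $ i * char L (l - k) x) \<partial>cell L)"
    proof (rule integral_cong_AE)
      show "AE x in cell L. complex_of_real (rep_vfield (tfield L c) x $ i) * char L (- k) x
         = (\<Sum>l | c l \<noteq> 0. c l $ i * char L (l - k) x)"
        using AE_cell[OF rep_tfield[of L c]]
      proof eventually_elim
        case (elim x)
        have "char L l x * char L (- k) x = char L (l - k) x" for l
          using char_mult[of L l x "- k"] by simp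
        then show ?case unfolding elim tfun_complex[OF c]
          by (simp only: sum_distrib_right mult.assoc)
      qed
    qed (auto intro!: borel_measurable_times borel_measurable_sum measurable_char)
    also have "\<dots> = (\<Sum>l | c l \<noteq> 0. c l $ i * (\<integral>x. char L (l - k) x \<partial>cell L))"
      using integrable_char_cell by (subst Bochner_Integration.integral_sum) auto
    also have "\<dots> = (\<Sum>l | c l \<noteq> 0. if l = k then c k $ i * vol L else 0)"
      unfolding integral_char by (intro sum.cong) auto
    also have "\<dots> = c k $ i * vol L"
      using c by (simp add: hermitian_def sum.delta)
    finally show ?thesis using vol_pos by (simp add: fourier_eq)
  qed
  then show ?thesis by (simp add: vec_eq_iff)
qed

lemma fourier_char_integral:
  assumes "v \<in> L2 L"
  shows "(\<integral>x. complex_of_real (rep_vfield v x $ i) * char L k x \<partial>cell L) = vol L * cnj (fourier L v k $ i)"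
proof -
  have "cnj (fourier L v k $ i) = complex_of_real (1 / vol L) * (\<integral>x. cnj (complex_of_real (rep_vfield v x $ i) * char L (- k) x) \<partial>cell L)"
    unfolding fourier_eq by (simp del: complex_cnj_mult integral_cnj add: integral_cnj[symmetric] complex_cnj_mult[of "complex_of_real _ / _"])
  also have "(\<integral>x. cnj (complex_of_real (rep_vfield v x $ i) * char L (- k) x) \<partial>cell L) = (\<integral>x. complex_of_real (rep_vfield v x $ i) * char L k x \<partial>cell L)"
    by (simp only: complex_cnj_mult complex_cnj_complex_of_real cnj_char minus_minus)
  finally show ?thesis using vol_pos by simp
qed

text \<open>Parseval's identity against a finite trigonometric field. The sum is finite even for
  arbitrary \<open>v\<close>, and it turns orthogonality claims into claims about
  coefficients.\<close>

lemma L2_inner_tfield: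
  assumes v: "v \<in> L2 L" and c: "hermitian c"
  shows "L2_inner L v (tfield L c) = vol L * Re (\<Sum>k | c k \<noteq> 0. \<Sum>i\<in>UNIV. c k $ i * cnj (fourier L v k $ i))"
proof -
  have int: "integrable (cell L) (\<lambda>x. c k $ i * (complex_of_real (rep_vfield v x $ i) * char L k x))" for k i
    by (intro integrable_mult_right integrable_component_char v)
  have "complex_of_real (L2_inner L v (tfield L c)) = (\<integral>x. complex_of_real (rep_vfield v x \<bullet> tfun L c x) \<partial>cell L)"
    by (subst L2_inner_cong[OF _ rep_tfield]) (simp_all add: integral_complex_of_real)
  also have "\<dots> = (\<integral>x. (\<Sum>k | c k \<noteq> 0. \<Sum>i\<in>UNIV. c k $ i * (complex_of_real (rep_vfield v x $ i) * char L k x)) \<partial>cell L)"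
    by (subst sum.swap) (simp add: inner_vec_def tfun_complex[OF c] sum_distrib_left mult_ac)
  also have "\<dots> = (\<Sum>k | c k \<noteq> 0. \<Sum>i\<in>UNIV. c k $ i * (vol L * cnj (fourier L v k $ i)))"
    using int by (simp add: Bochner_Integration.integral_sum fourier_char_integral[OF v] del: integrable_mult_right_iff)
  also have "\<dots> = vol L * (\<Sum>k | c k \<noteq> 0. \<Sum>i\<in>UNIV. c k $ i * cnj (fourier L v k $ i))"
    by (simp add: sum_distrib_left mult_ac)
  finally have "Re (complex_of_real (L2_inner L v (tfield L c))) = Re (vol L * (\<Sum>k | c k \<noteq> 0. \<Sum>i\<in>UNIV. c k $ i * cnj (fourier L v k $ i)))"
    by simp
  then show ?thesis by (simp del: Re_sum)
qed

lemma fourier_add: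
  assumes "u \<in> L2 L" "v \<in> L2 L" shows "fourier L (u + v) k = fourier L u k + fourier L v k"
proof -
  have "(\<integral>x. complex_of_real (rep_vfield (u + v) x $ i) * char L (- k) x \<partial>cell L) =
     (\<integral>x. complex_of_real (rep_vfield u x $ i) * char L (- k) x + complex_of_real (rep_vfield v x $ i) * char L (- k) x \<partial>cell L)" for i
  proof (rule integral_cong_AE)
    show "AE x in cell L. complex_of_real (rep_vfield (u + v) x $ i) * char L (- k) x =
      complex_of_real (rep_vfield u x $ i) * char L (- k) x + complex_of_real (rep_vfield v x $ i) * char L (- k) x"
      using AE_cell[OF rep_plus_vfield[of u v]] by eventually_elim (simp add: algebra_simps)
  qed (auto intro!: borel_measurable_times borel_measurable_add measurable_char)
  then show ?thesis
    using assms by (simp add: vec_eq_iff fourier_eq integrable_component_char distrib_left)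
qed

lemma fourier_scaleR:
  "fourier L (a *\<^sub>R u) k = a *\<^sub>R fourier L u k"
proof -
  have "(\<integral>x. complex_of_real (rep_vfield (a *\<^sub>R u) x $ i) * char L (- k) x \<partial>cell L) =
     (\<integral>x. complex_of_real a * (complex_of_real (rep_vfield u x $ i) * char L (- k) x) \<partial>cell L)" for i
  proof (rule integral_cong_AE)
    show "AE x in cell L. complex_of_real (rep_vfield (a *\<^sub>R u) x $ i) * char L (- k) x =
      complex_of_real a * (complex_of_real (rep_vfield u x $ i) * char L (- k) x)"
      using AE_cell[OF rep_scaleR_vfield[of a u]] by eventually_elim (simp add: algebra_simps)
  qed (auto intro!: borel_measurable_times borel_measurable_add measurable_char)
  then have "fourier L (a *\<^sub>R u) k $ i = a *\<^sub>R (fourier L u k $ i)" for i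
    unfolding fourier_eq by (simp add: scaleR_conv_of_real[of a "_ :: complex"])
  then show ?thesis by (simp add: vec_eq_iff)
qed

lemma fourier_diff:
  assumes "u \<in> L2 L" "v \<in> L2 L" shows "fourier L (u - v) k = fourier L u k - fourier L v k"
  using fourier_add[OF assms(1) L2.closed(4)[OF assms(2), of "-1"]] fourier_scaleR[of "-1" v k] by simp

text \<open>Completeness of the exponentials, componentwise. It makes the weak derivative unique, so
  that the definite description \<open>pd\<close> can be evaluated.\<close>

lemma fourier_inj:
  assumes "u \<in> L2 L" "v \<in> L2 L" "\<And>k. fourier L u k = fourier L v k" shows "u = v"
proof (rule AE_cell_imp_eq[OF assms(1,2)])
  let ?w = "u - v"
  have w: "?w \<in> L2 L" using assms L2.closed by auto
  have "AE x in cell L. rep_vfield ?w x $ i = 0" for i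
  proof (rule orthogonal_imp_AE_0)
    show "integrable (cell L) (\<lambda>x. rep_vfield ?w x $ i)" by (rule integrable_rep_component[OF w])
    show "(\<integral>x. complex_of_real (rep_vfield ?w x $ i) * char L k x \<partial>cell L) = 0" for k
      unfolding fourier_char_integral[OF w] using assms by (simp add: fourier_diff)
  qed
  then have "AE x in cell L. \<forall>i. rep_vfield ?w x $ i = 0" by (simp add: AE_all_countable)
  then show "AE x in cell L. rep_vfield u x = rep_vfield v x"
    using AE_cell[OF rep_diff_vfield[of u v]] by eventually_elim (simp add: vec_eq_iff)
qed

section \<open>Weak derivatives and the inner products on the Sobolev space\<close>

lemma pd_eq: "has_pd L j u g \<Longrightarrow> pd L j u = g"
  unfolding pd_def by (rule the_equality) (auto simp: has_pd_def intro!: fourier_inj)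

lemma has_pd_pd: "u \<in> H1 L \<Longrightarrow> has_pd L j u (pd L j u)"
  using pd_eq unfolding H1_def by blast

lemma pd_L2: "u \<in> H1 L \<Longrightarrow> pd L j u \<in> L2 L"
  using has_pd_pd by (auto simp: has_pd_def)

lemma H1_L2: "u \<in> H1 L \<Longrightarrow> u \<in> L2 L"
  by (simp add: H1_def)

lemma fourier_pd: "u \<in> H1 L \<Longrightarrow> fourier L (pd L j u) k $ i = \<i> * complex_of_real (wave L k $ j) * fourier L u k $ i"
  using has_pd_pd[of u j] by (simp add: has_pd_def)

lemma has_pd_tfield:
  assumes "hermitian c" shows "has_pd L j (tfield L c) (tfield L (pd_coeff L j c))"
  using assms by (simp add: has_pd_def tfield_L2 fourier_tfield hermitian_pd_coeff pd_coeff_def)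

lemma tfield_H1: "hermitian c \<Longrightarrow> tfield L c \<in> H1 L"
  using has_pd_tfield tfield_L2 by (auto simp: H1_def)

lemma pd_tfield: "hermitian c \<Longrightarrow> pd L j (tfield L c) = tfield L (pd_coeff L j c)"
  by (intro pd_eq has_pd_tfield)

lemma tfield_H2: "hermitian c \<Longrightarrow> tfield L c \<in> H2 L"
  by (simp add: H2_def tfield_H1 pd_tfield hermitian_pd_coeff)

lemma has_pd_add:
  assumes "u \<in> H1 L" "v \<in> H1 L" shows "has_pd L j (u + v) (pd L j u + pd L j v)"
  unfolding has_pd_def using assms
  by (simp add: L2.closed pd_L2 fourier_add H1_L2 vec_eq_iff fourier_pd algebra_simps)

lemma has_pd_scaleR:
  assumes "u \<in> H1 L" shows "has_pd L j (a *\<^sub>R u) (a *\<^sub>R pd L j u)"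
  unfolding has_pd_def using assms
  by (simp add: L2.closed pd_L2 fourier_scaleR H1_L2 vec_eq_iff fourier_pd algebra_simps)

lemmas pd_add = pd_eq[OF has_pd_add]
lemmas pd_scaleR = pd_eq[OF has_pd_scaleR]

lemma subspace_H1: "subspace (H1 L)"
proof -
  have "hermitian (\<lambda>_. 0)" by (simp add: hermitian_def)
  from tfield_scaleR[OF this, of L 0] tfield_H1[OF this] have "0 \<in> H1 L" by simp
  moreover have "u + v \<in> H1 L" if "u \<in> H1 L" "v \<in> H1 L" for u v
    using has_pd_add[OF that] that L2.closed(2) by (auto simp: H1_def)
  moreover have "a *\<^sub>R u \<in> H1 L" if "u \<in> H1 L" for a u
    using has_pd_scaleR[OF that] that L2.closed(4) by (auto simp: H1_def)
  ultimately show ?thesis by (simp add: subspace_def)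
qed

lemma pd_diff:
  assumes "u \<in> H1 L" "v \<in> H1 L" shows "pd L j (u - v) = pd L j u - pd L j v"
  using pd_add[OF assms(1) subspace_scale[OF subspace_H1 assms(2), of "-1"]] pd_scaleR[OF assms(2), of j "-1"] by simp

text \<open>Its norm is \<open>H1_norm L\<close> on \<open>H1 L\<close>; it exhibits
  \<open>Vspace L\<close> as a closure in a semi-inner product space and hence as a
  subspace.\<close>

definition full_inner :: "vfield \<Rightarrow> vfield \<Rightarrow> real" where
  "full_inner u v = L2_inner L u v + grad_inner L u v"

sublocale grad: semi_inner "H1 L" "grad_inner L"
  rewrites "semi_inner.nrm (grad_inner L) = grad_norm L"
proof -
  show *: "semi_inner (H1 L) (grad_inner L)"
  proof
    show "subspace (H1 L)" by (rule subspace_H1)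
    show "grad_inner L x y = grad_inner L y x" if "x \<in> H1 L" "y \<in> H1 L" for x y
      unfolding grad_inner_def using that by (intro sum.cong L2.commute pd_L2) auto
    show "grad_inner L (x + y) z = grad_inner L x z + grad_inner L y z"
      if "x \<in> H1 L" "y \<in> H1 L" "z \<in> H1 L" for x y z
      using that by (simp add: grad_inner_def pd_add L2.add_left pd_L2 sum.distrib)
    show "grad_inner L (a *\<^sub>R x) z = a * grad_inner L x z" if "x \<in> H1 L" "z \<in> H1 L" for a x z
      using that by (simp add: grad_inner_def pd_scaleR L2.scale_left pd_L2 sum_distrib_left)
    show "0 \<le> grad_inner L x x" if "x \<in> H1 L" for x
      using that by (auto simp: grad_inner_def intro!: sum_nonneg L2.nonneg pd_L2)
  qed
  show "semi_inner.nrm (grad_inner L) = grad_norm L"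
    by (rule ext) (simp add: semi_inner.nrm_def[OF *] grad_norm_def)
qed

lemma H1_semi_inner: "semi_inner (H1 L) full_inner"
proof
  show "subspace (H1 L)" by (rule subspace_H1)
qed (simp_all add: full_inner_def L2.commute grad.commute H1_L2 L2.add_left grad.add_left L2.scale_left
    grad.scale_left L2.nonneg grad.nonneg distrib_left)

lemma H1_norm_eq: "u \<in> H1 L \<Longrightarrow> H1_norm L u = semi_inner.nrm full_inner u"
  by (simp add: H1_norm_def semi_inner.nrm_def[OF H1_semi_inner] full_inner_def L2.nrm_sq grad.nrm_sq H1_L2)

lemma L2_norm_le_H1_norm: "L2_norm L u \<le> H1_norm L u"
proof (cases "0 \<le> L2_norm L u")
  case True
  have "sqrt ((L2_norm L u)\<^sup>2) \<le> H1_norm L u"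
    unfolding H1_norm_def by (intro real_sqrt_le_mono) simp
  then show ?thesis using True by simp
qed (use real_sqrt_ge_zero[of "(L2_norm L u)\<^sup>2 + (grad_norm L u)\<^sup>2"] in \<open>simp add: H1_norm_def not_le\<close>)

end

section \<open>Leray projection and Stokes operator\<close>

lemma rep_Jop: "AE x in lebesgue. rep_vfield (Jop u) x = cross3 (axis 3 1) (rep_vfield u x)"
proof -
  have "(\<lambda>z::real^3. cross3 (axis 3 1) z) \<in> borel_measurable borel"
    by (intro borel_measurable_continuous_onI continuous_on_cross continuous_intros)
  then have "(\<lambda>x. cross3 (axis 3 1) (rep_vfield u x)) \<in> borel_measurable lebesgue"
    using measurable_rep_vfield by (rule measurable_compose[rotated])
  then show ?thesis
    unfolding Jop_def by (simp, intro rep_abs_vfield)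
qed

section \<open>Modes that depend on the first coordinate only\<close>

definition ek :: "int \<Rightarrow> int^3" where "ek p = axis 1 p"

text \<open>Coefficients of the real field \<open>2 * Re (\<beta> * char L (ek p) x)\<close> in
  direction \<open>i\<close>. For p = 0 the two summands overlap and add up to 2 Re \<beta>, so that
  \<open>rmode_mult\<close>, which produces the frequency p - q, needs no exception.\<close>

definition mode :: "3 \<Rightarrow> int \<Rightarrow> complex \<Rightarrow> int^3 \<Rightarrow> complex^3" where
  "mode i p \<beta> k = (if k = ek p then axis i \<beta> else 0) + (if k = - ek p then axis i (cnj \<beta>) else 0)"

lemma ek_uminus: "- ek p = ek (- p)" and ek_add: "ek p + ek q = ek (p + q)"
  by (simp_all add: ek_def vec_eq_iff axis_def)

lemma ek_inj: "ek p = ek q \<longleftrightarrow> p = q"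
  by (auto simp: ek_def vec_eq_iff axis_def)

lemma ek_eq_0: "ek p = 0 \<longleftrightarrow> p = 0"
  by (auto simp: ek_def vec_eq_iff axis_def)

lemma wave_ek: "wave L (ek p) $ j = (if j = 1 then 2 * pi * of_int p / L $ 1 else 0)"
  by (simp add: wave_def ek_def axis_def)

lemma mode_eq_0: "k \<noteq> ek p \<Longrightarrow> k \<noteq> ek (- p) \<Longrightarrow> mode i p \<beta> k = 0"
  by (simp add: mode_def ek_uminus)

lemma mode_component: "j \<noteq> i \<Longrightarrow> mode i p \<beta> k $ j = 0"
  by (simp add: mode_def axis_def)

lemma hermitian_mode: "hermitian (mode i p \<beta>)"
proof -
  have "{k. mode i p \<beta> k \<noteq> 0} \<subseteq> {ek p, ek (- p)}" using mode_eq_0 by blast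
  moreover have "mode i p \<beta> (- k) $ j = cnj (mode i p \<beta> k $ j)" for k j
  proof -
    have "- k = ek p \<longleftrightarrow> k = - ek p" "- k = - ek p \<longleftrightarrow> k = ek p"
      by (metis minus_minus, simp)
    then show ?thesis by (simp add: mode_def axis_def add.commute)
  qed
  ultimately show ?thesis by (auto simp: hermitian_def intro: finite_subset)
qed

definition rmode :: "real^3 \<Rightarrow> int \<Rightarrow> complex \<Rightarrow> real^3 \<Rightarrow> real" where
  "rmode L p \<beta> x = 2 * Re (\<beta> * char L (ek p) x)"

lemma tfun_mode: "tfun L (mode i p \<beta>) x = axis i (rmode L p \<beta> x)"
proof -
  have "tfun L (mode i p \<beta>) x $ j = axis i (rmode L p \<beta> x) $ j" for j
  proof -
    let ?K = "{ek p, ek (- p)}"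
    have K: "finite ?K" "{k. mode i p \<beta> k \<noteq> 0} \<subseteq> ?K" using mode_eq_0 by blast+
    have c: "char L (ek (- p)) x = cnj (char L (ek p) x)" by (simp only: cnj_char ek_uminus)
    show ?thesis
    proof (cases "p = 0")
      case True
      have "ek 0 = 0" by (simp add: ek_eq_0)
      then show ?thesis
        using True unfolding tfun_eq_sum[OF K] by (simp add: mode_def rmode_def axis_def wave_zero)
    next
      case False
      then have ne: "ek p \<noteq> ek (- p)" by (simp add: ek_inj)
      have "(\<Sum>k\<in>?K. mode i p \<beta> k $ j * char L k x) = axis i \<beta> $ j * char L (ek p) x + axis i (cnj \<beta>) $ j * cnj (char L (ek p) x)"
        using ne unfolding c[symmetric] by (simp add: mode_def ek_uminus)
      then show ?thesis
        unfolding tfun_eq_sum[OF K] by (simp add: rmode_def axis_def)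
    qed
  qed
  then show ?thesis by (simp add: vec_eq_iff)
qed

text \<open>The product-to-sum formula 2 Re a * 2 Re b = 2 Re (a b) + 2 Re (a cnj b). Because of it,
  orthogonality to single modes extends to products of amplitudes.\<close>

lemma rmode_mult: "rmode L p \<beta> x * rmode L q \<gamma> x = rmode L (p + q) (\<beta> * \<gamma>) x + rmode L (p - q) (\<beta> * cnj \<gamma>) x"
proof -
  have 1: "char L (ek (p + q)) x = char L (ek p) x * char L (ek q) x"
    by (simp only: char_mult ek_add)
  have 2: "char L (ek (p - q)) x = char L (ek p) x * cnj (char L (ek q) x)"
    by (simp only: char_mult ek_add cnj_char ek_uminus) simp
  have "2 * Re a * (2 * Re b) = 2 * Re (a * b) + 2 * Re (a * cnj b)" for a b by simp
  from this[of "\<beta> * char L (ek p) x" "\<gamma> * char L (ek q) x"]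
  show ?thesis unfolding rmode_def 1 2 by (simp only: complex_cnj_mult mult_ac)
qed

lemma rmode_le: "\<bar>rmode L p \<beta> x\<bar> \<le> 2 * norm \<beta>"
  using abs_Re_le_cmod[of "\<beta> * char L (ek p) x"] by (simp add: rmode_def norm_mult)

lemma measurable_rmode [measurable]: "rmode L p \<beta> \<in> borel_measurable (cell L)"
  unfolding rmode_def by (intro measurable_cell_continuous continuous_intros)

lemma pd_coeff_mode:
  "pd_coeff L j (mode i p \<beta>) = mode i p (\<i> * complex_of_real (wave L (ek p) $ j) * \<beta>)"
proof (cases "p = 0")
  case True
  have "ek 0 = 0" by (simp add: ek_eq_0)
  then have "pd_coeff L j (mode i p \<beta>) k $ l = mode i p (\<i> * complex_of_real (wave L (ek p) $ j) * \<beta>) k $ l" for k l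
    using True by (auto simp: pd_coeff_def mode_def axis_def wave_zero)
  then show ?thesis by (simp add: fun_eq_iff vec_eq_iff)
next
  case False
  then have "ek p \<noteq> - ek p" by (simp add: ek_uminus ek_inj)
  then have "pd_coeff L j (mode i p \<beta>) k $ l = mode i p (\<i> * complex_of_real (wave L (ek p) $ j) * \<beta>) k $ l" for k l
    by (auto simp: pd_coeff_def mode_def axis_def wave_minus)
  then show ?thesis by (simp add: fun_eq_iff vec_eq_iff)
qed

lemma mode_zero: "mode i p 0 = (\<lambda>_. 0)"
  by (simp add: mode_def fun_eq_iff vec_eq_iff axis_def)

text \<open>The coefficient 1/2 yields cos(2 pi m x_1 / L_1) e_3.\<close>

definition shear :: "real^3 \<Rightarrow> nat \<Rightarrow> vfield" where
  "shear L m = tfield L (mode 3 (int m) (1/2))"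

text \<open>The eigenvalue of the Stokes operator at \<open>shear L m\<close>, hence the decay rate
  of this mode.\<close>

definition freq :: "real^3 \<Rightarrow> nat \<Rightarrow> real" where
  "freq L m = (norm (wave L (ek (int m))))\<^sup>2"

context torus
begin

definition solen :: "(int^3 \<Rightarrow> complex^3) \<Rightarrow> bool" where
  "solen c \<longleftrightarrow> hermitian c \<and> c 0 = 0 \<and> (\<forall>k. k \<noteq> 0 \<longrightarrow> c k \<in> Xspace L k)"

lemma trig_space_eq: "trig_space L = {tfield L c | c. solen c}"
proof (intro equalityI subsetI)
  fix u assume "u \<in> trig_space L"
  then obtain f c where u: "u = abs_vfield f" and t: "trig_field L c f" by (auto simp: trig_space_def)
  then have s: "solen c" by (auto simp: trig_field_def solen_def hermitian_def)
  then have "complex_of_real (f x $ j) = complex_of_real (tfun L c x $ j)" for x j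
    using t by (subst tfun_complex) (auto simp: trig_field_def solen_def)
  then have "f = tfun L c" by (auto simp: fun_eq_iff vec_eq_iff)
  then show "u \<in> {tfield L c | c. solen c}" using u s by (auto simp: tfield_def)
next
  fix u assume "u \<in> {tfield L c | c. solen c}"
  then obtain c where "u = abs_vfield (tfun L c)" and s: "solen c" by (auto simp: tfield_def)
  moreover have "trig_field L c (tfun L c)"
    using s by (auto simp: trig_field_def solen_def tfun_complex hermitian_def)
  ultimately show "u \<in> trig_space L" by (auto simp: trig_space_def)
qed

lemma solen_hermitian: "solen c \<Longrightarrow> hermitian c"
  by (simp add: solen_def)

lemma solen_add: "solen c \<Longrightarrow> solen d \<Longrightarrow> solen (\<lambda>k. c k + d k)"
  by (simp add: solen_def hermitian_add Xspace_def distrib_right sum.distrib)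

lemma solen_scaleR:
  assumes "solen c" shows "solen (\<lambda>k. a *\<^sub>R c k)"
proof -
  have "(\<Sum>j\<in>UNIV. (a *\<^sub>R z) $ j * complex_of_real (wave L k $ j)) = a *\<^sub>R (\<Sum>j\<in>UNIV. z $ j * complex_of_real (wave L k $ j))" for z k
    by (simp add: scaleR_sum_right)
  then show ?thesis using assms by (simp add: solen_def hermitian_scaleR Xspace_def)
qed

lemma solen_zero: "solen (\<lambda>_. 0)"
  by (simp add: solen_def hermitian_def Xspace_def)

lemma subspace_trig: "subspace (trig_space L)"
proof -
  have "0 \<in> trig_space L"
    using tfield_scaleR[of "\<lambda>_. 0" L 0] solen_zero solen_hermitian unfolding trig_space_eq by force
  moreover have "u + v \<in> trig_space L" if "u \<in> trig_space L" "v \<in> trig_space L" for u v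
  proof -
    obtain c d where "u = tfield L c" "v = tfield L d" and cd: "solen c" "solen d"
      using \<open>u \<in> _\<close> \<open>v \<in> _\<close> unfolding trig_space_eq by blast
    then have "u + v = tfield L (\<lambda>k. c k + d k)" by (simp add: tfield_add solen_hermitian)
    then show ?thesis using solen_add[OF cd] unfolding trig_space_eq by blast
  qed
  moreover have "a *\<^sub>R u \<in> trig_space L" if "u \<in> trig_space L" for a u
  proof -
    obtain c where "u = tfield L c" and c: "solen c"
      using \<open>u \<in> _\<close> unfolding trig_space_eq by blast
    then have "a *\<^sub>R u = tfield L (\<lambda>k. a *\<^sub>R c k)" by (simp add: tfield_scaleR solen_hermitian)
    then show ?thesis using solen_scaleR[OF c, of a] unfolding trig_space_eq by blast
  qed
  ultimately show ?thesis by (simp add: subspace_def)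
qed

lemma trig_H1: "trig_space L \<subseteq> H1 L"
  unfolding trig_space_eq using tfield_H1 solen_hermitian by blast

lemma trig_L2: "trig_space L \<subseteq> L2 L"
  using trig_H1 H1_L2 by blast

section \<open>The closures H and V of the solenoidal trigonometric fields, and the Leray
  projection\<close>

lemma subspace_Hspace: "subspace (Hspace L)"
  unfolding Hspace_def by (rule L2.subspace_closure_in[OF subspace_trig trig_L2])

lemma subspace_Vspace: "subspace (Vspace L)"
proof -
  interpret full: semi_inner "H1 L" full_inner by (rule H1_semi_inner)
  have "H1_norm L (u - v) = full.nrm (u - v)" if "u \<in> H1 L" "v \<in> trig_space L" for u v
    using that trig_H1 grad.closed(3) by (intro H1_norm_eq) blast
  then have "Vspace L = closure_in (H1 L) full.nrm (trig_space L)"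
    unfolding Vspace_def closure_in_def by (intro Collect_cong conj_cong refl all_cong bex_cong) auto
  then show ?thesis using full.subspace_closure_in[OF subspace_trig trig_H1] by simp
qed

lemma V_H1: "u \<in> Vspace L \<Longrightarrow> u \<in> H1 L"
  by (simp add: Vspace_def closure_in_def)

lemma H_L2: "u \<in> Hspace L \<Longrightarrow> u \<in> L2 L"
  by (simp add: Hspace_def closure_in_def)

lemma V_H: "u \<in> Vspace L \<Longrightarrow> u \<in> Hspace L"
  unfolding Vspace_def Hspace_def closure_in_def using H1_L2 L2_norm_le_H1_norm
  by (auto intro: le_less_trans) (meson le_less_trans)

lemma trig_V: "u \<in> trig_space L \<Longrightarrow> u \<in> Vspace L"
proof -
  assume u: "u \<in> trig_space L"
  have "H1_norm L 0 = 0"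
    using L2.nrm_zero grad.nrm_zero by (simp add: H1_norm_def)
  then show ?thesis
    using u trig_H1 unfolding Vspace_def closure_in_def by (auto intro!: bexI[of _ u])
qed

lemmas H_closed = subspace_0[OF subspace_Hspace] subspace_add[OF subspace_Hspace] subspace_diff[OF subspace_Hspace]
  subspace_scale[OF subspace_Hspace] subspace_sum[OF subspace_Hspace]

text \<open>By density \<open>z\<close> is orthogonal to all of \<open>Hspace L\<close>, in
  particular to itself.\<close>

lemma H_eq_0:
  assumes "z \<in> Hspace L" "\<And>c. solen c \<Longrightarrow> L2_inner L z (tfield L c) = 0" shows "z = 0"
proof -
  have "L2_inner L z z = 0"
  proof (rule L2.closure_in_orthogonal)
    show "z \<in> closure_in (L2 L) (L2_norm L) (trig_space L)" using assms(1) by (simp add: Hspace_def)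
    show "L2_inner L v z = 0" if "v \<in> trig_space L" for v
      using that assms L2.commute[OF _ H_L2] trig_L2 unfolding trig_space_eq by auto
  qed (use trig_L2 H_L2[OF assms(1)] in auto)
  then show ?thesis
    using H_L2[OF assms(1)] by (intro L2_norm_eq_0) (simp_all add: L2_norm_def)
qed

text \<open>Existence is what gives the definite description \<open>leray\<close> a meaning. The
  Cauchy sequences of the projection theorem converge in L2, and their limits stay in
  \<open>Hspace L\<close> because a closure is closed.\<close>

lemma leray_exists:
  assumes "u \<in> L2 L"
  shows "\<exists>v. v \<in> Hspace L \<and> (\<forall>w\<in>Hspace L. L2_inner L (u - v) w = 0)"
proof -
  have "\<exists>p\<in>Hspace L. \<forall>h\<in>Hspace L. L2_inner L (u - p) h = 0"
  proof (rule L2.projection_exists[OF subspace_Hspace _ assms])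
    show "Hspace L \<subseteq> L2 L" using H_L2 by blast
    fix h :: "nat \<Rightarrow> vfield"
    assume h: "\<And>n. h n \<in> Hspace L" and C: "\<And>e. e > 0 \<Longrightarrow> \<exists>N. \<forall>m\<ge>N. \<forall>n\<ge>N. L2_norm L (h m - h n) < e"
    obtain l where l: "l \<in> L2 L" "(\<lambda>n. L2_norm L (h n - l)) \<longlonglongrightarrow> 0"
      using L2_complete[OF H_L2[OF h] C] by blast
    have "l \<in> Hspace L"
      unfolding Hspace_def
    proof (rule L2.closure_in_idem[OF l(1) trig_L2])
      fix e :: real assume "e > 0"
      then have "\<forall>\<^sub>F n in sequentially. L2_norm L (h n - l) < e"
        using order_tendstoD(2)[OF l(2)] by simp
      then obtain n where "L2_norm L (h n - l) < e" by (auto simp: eventually_sequentially)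
      then have "L2_norm L (l - h n) < e"
        using L2.nrm_minus[OF L2.closed(3)[OF H_L2[OF h] l(1)], of n] by simp
      then show "\<exists>v\<in>closure_in (L2 L) (L2_norm L) (trig_space L). L2_norm L (l - v) < e"
        using h unfolding Hspace_def by blast
    qed
    then show "\<exists>l\<in>Hspace L. (\<lambda>n. L2_norm L (h n - l)) \<longlonglongrightarrow> 0" using l by blast
  qed
  then show ?thesis by blast
qed

lemma leray_unique:
  assumes "u \<in> L2 L" "v \<in> Hspace L" "\<And>w. w \<in> Hspace L \<Longrightarrow> L2_inner L (u - v) w = 0"
    "v' \<in> Hspace L" "\<And>w. w \<in> Hspace L \<Longrightarrow> L2_inner L (u - v') w = 0"
  shows "v' = v"
proof -
  have z: "v' - v \<in> Hspace L" using assms H_closed by blast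
  have "L2_inner L (v' - v) (v' - v) = L2_inner L (u - v) (v' - v) - L2_inner L (u - v') (v' - v)"
    using assms(1) H_L2[OF assms(2)] H_L2[OF assms(4)] H_L2[OF z] L2.closed(3)
    by (simp add: L2.diff_left)
  also have "\<dots> = 0" using assms(3)[OF z] assms(5)[OF z] by simp
  finally have "v' - v = 0" using H_L2[OF z] by (intro L2_norm_eq_0) (simp_all add: L2_norm_def)
  then show ?thesis by simp
qed

lemma leray:
  assumes "u \<in> L2 L"
  shows leray_H: "leray L u \<in> Hspace L" and leray_orth: "\<And>w. w \<in> Hspace L \<Longrightarrow> L2_inner L (u - leray L u) w = 0"
proof -
  have "\<exists>!v. v \<in> Hspace L \<and> (\<forall>w\<in>Hspace L. L2_inner L (u - v) w = 0)"
    using leray_exists[OF assms] leray_unique[OF assms] by blast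
  then have "leray L u \<in> Hspace L \<and> (\<forall>w\<in>Hspace L. L2_inner L (u - leray L u) w = 0)"
    unfolding leray_def by (rule theI')
  then show "leray L u \<in> Hspace L" "\<And>w. w \<in> Hspace L \<Longrightarrow> L2_inner L (u - leray L u) w = 0" by auto
qed

lemma leray_id:
  assumes "u \<in> Hspace L" shows "leray L u = u"
proof (rule leray_unique[OF H_L2[OF assms] assms])
  show "L2_inner L (u - u) w = 0" if "w \<in> Hspace L" for w
    using L2.zero_left[OF H_L2[OF that]] by simp
qed (use leray[OF H_L2[OF assms]] in auto)

lemma Jop_L2:
  assumes "u \<in> L2 L" shows "Jop u \<in> L2 L"
proof (rule L2_I[OF rep_Jop])
  show "periodic L (\<lambda>x. cross3 (axis 3 1) (rep_vfield u x))"
    using assms periodic_compose2[of L "rep_vfield u" "rep_vfield u" "\<lambda>x y. cross3 (axis 3 1) x"] by (simp add: L2_iff)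
  have "(\<lambda>z::real^3. cross3 (axis 3 1) z) \<in> borel_measurable borel"
    by (intro borel_measurable_continuous_onI continuous_on_cross continuous_intros)
  then have m: "(\<lambda>x. cross3 (axis 3 1) (rep_vfield u x)) \<in> borel_measurable (cell L)"
    using measurable_rep_cell by (rule measurable_compose[rotated])
  have "(norm (cross3 (axis 3 1) z))\<^sup>2 \<le> (norm z)\<^sup>2" for z :: "real^3"
    using norm_cross[of "axis 3 1" z] by (simp add: power_mult_distrib)
  then have 1: "AE x in cell L. norm ((norm (cross3 (axis 3 1) (rep_vfield u x)))\<^sup>2) \<le> norm ((norm (rep_vfield u x))\<^sup>2)"
    by (intro AE_I2) simp
  have 2: "integrable (cell L) (\<lambda>x. (norm (rep_vfield u x))\<^sup>2)" using assms by (simp add: L2_iff)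
  show "integrable (cell L) (\<lambda>x. (norm (cross3 (axis 3 1) (rep_vfield u x)))\<^sup>2)"
    by (rule Bochner_Integration.integrable_bound[OF 2 borel_measurable_power[OF measurable_compose[OF m borel_measurable_norm]] 1])
qed

section \<open>Rotation and Stokes operator on special fields, and orthogonality to modes in
  x_1\<close>

definition vertical :: "vfield \<Rightarrow> bool" where
  "vertical w \<longleftrightarrow> (AE x in lebesgue. rep_vfield w x $ 1 = 0 \<and> rep_vfield w x $ 2 = 0)"

lemma Sop_vertical:
  assumes v: "v \<in> Hspace L" and w: "w \<in> Hspace L" "vertical w"
  shows "L2_inner L (Sop L v) w = 0"
proof -
  have J: "Jop v \<in> L2 L" using Jop_L2 H_L2 v by blast
  have "L2_inner L (Jop v - leray L (Jop v)) w = 0" using leray_orth[OF J w(1)] .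
  then have "L2_inner L (Sop L v) w = L2_inner L (Jop v) w"
    using J H_L2[OF leray_H[OF J]] H_L2[OF w(1)] by (simp add: Sop_def leray_id[OF v] L2.diff_left)
  also have "\<dots> = 0"
    unfolding L2_inner_eq
  proof (rule integral_eq_zero_AE)
    show "AE x in cell L. rep_vfield (Jop v) x \<bullet> rep_vfield w x = 0"
      using AE_cell[OF rep_Jop[of v]] AE_cell[OF w(2)[unfolded vertical_def]]
      by eventually_elim (simp add: cross3_def inner_vec_def sum_3 axis_def)
  qed
  finally show ?thesis .
qed

lemma Sop_vertical_0:
  assumes w: "w \<in> Hspace L" "vertical w" shows "Sop L w = 0"
proof -
  have "Jop w = 0"
  proof (rule vfield_eqI)
    show "AE x in lebesgue. rep_vfield (Jop w) x = rep_vfield 0 x"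
      using rep_Jop[of w] w(2)[unfolded vertical_def] rep_zero_vfield
      by eventually_elim (simp add: cross3_def vec_eq_iff forall_3 axis_def)
  qed
  then show ?thesis by (simp add: Sop_def leray_id w H_closed)
qed

lemma L2_inner_tfield_zero:
  assumes "v \<in> L2 L" "hermitian c" "\<And>k i. c k $ i * cnj (fourier L v k $ i) = 0"
  shows "L2_inner L v (tfield L c) = 0"
  unfolding L2_inner_tfield[OF assms(1,2)] by (simp only: assms(3) sum.neutral_const) simp

text \<open>The description fixes only the coefficients with k \<noteq> 0. Uniqueness holds
  nevertheless, since elements of \<open>Hspace L\<close> are determined by their pairings with
  fields whose coefficient at 0 vanishes.\<close>

lemma stokes_eq:
  assumes v: "v \<in> Hspace L" "\<And>k. fourier L v k = (norm (wave L k))\<^sup>2 *\<^sub>R fourier L u k"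
  shows "stokes L u = v"
  unfolding stokes_def
proof (rule the_equality)
  have eq: "(\<chi> i. complex_of_real ((norm (wave L k))\<^sup>2) * fourier L u k $ i) = fourier L v k" for k
    by (simp add: v(2) vec_eq_iff scaleR_conv_of_real[of _ "_ :: complex"])
  show "v \<in> Hspace L \<and> (\<forall>k. k \<noteq> 0 \<longrightarrow> fourier L v k = (\<chi> i. complex_of_real ((norm (wave L k))\<^sup>2) * fourier L u k $ i))"
    unfolding eq using v(1) by simp
  fix v' assume "v' \<in> Hspace L \<and> (\<forall>k. k \<noteq> 0 \<longrightarrow> fourier L v' k = (\<chi> i. complex_of_real ((norm (wave L k))\<^sup>2) * fourier L u k $ i))"
  then have v': "v' \<in> Hspace L" "\<And>k. k \<noteq> 0 \<Longrightarrow> fourier L v' k = fourier L v k" unfolding eq by auto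
  have "v' - v = 0"
  proof (rule H_eq_0)
    show z: "v' - v \<in> Hspace L" using v v' H_closed by blast
    fix c assume c: "solen c"
    have "c k $ i * cnj (fourier L (v' - v) k $ i) = 0" for k i
    proof (cases "k = 0")
      case True
      then show ?thesis using c by (simp add: solen_def)
    next
      case False
      then show ?thesis using v'(2) by (simp add: fourier_diff H_L2 v(1) v'(1))
    qed
    then show "L2_inner L (v' - v) (tfield L c) = 0"
      by (intro L2_inner_tfield_zero H_L2[OF z] solen_hermitian c)
  qed
  then show "v' = v" by simp
qed

lemma L2_inner_tfield':
  assumes "v \<in> L2 L" "hermitian c" "finite K" "{k. c k \<noteq> 0} \<subseteq> K"
  shows "L2_inner L v (tfield L c) = vol L * Re (\<Sum>k\<in>K. \<Sum>i\<in>UNIV. c k $ i * cnj (fourier L v k $ i))"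
  unfolding L2_inner_tfield[OF assms(1,2)]
  by (subst sum_supp[OF assms(3,4)]) auto

text \<open>Integration by parts on the Fourier side: each of the two derivatives contributes a
  factor \<open>wave L k $ j\<close>, and summing over j gives the squared length of the wave
  vector.\<close>

lemma grad_inner_tfield:
  assumes v: "v \<in> H1 L" and c: "hermitian c"
  shows "grad_inner L v (tfield L c) = L2_inner L v (tfield L (lap_coeff L c))"
proof -
  let ?K = "{k. c k \<noteq> 0}"
  have K: "finite ?K" using c by (simp add: hermitian_def)
  have p: "{k. pd_coeff L j c k \<noteq> 0} \<subseteq> ?K" for j by (auto simp: pd_coeff_def vec_eq_iff)
  have l: "{k. lap_coeff L c k \<noteq> 0} \<subseteq> ?K" by (auto simp: lap_coeff_def)
  have n: "complex_of_real ((norm (wave L k))\<^sup>2) = (\<Sum>j\<in>UNIV. complex_of_real (wave L k $ j) * complex_of_real (wave L k $ j))" for k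
    by (simp add: power2_norm_eq_inner inner_vec_def)
  have "grad_inner L v (tfield L c) = (\<Sum>j\<in>UNIV. vol L * Re (\<Sum>k\<in>?K. \<Sum>i\<in>UNIV. pd_coeff L j c k $ i * cnj (fourier L (pd L j v) k $ i)))"
    unfolding grad_inner_def pd_tfield[OF c]
    by (intro sum.cong refl L2_inner_tfield' pd_L2 v hermitian_pd_coeff c K p)
  also have "\<dots> = vol L * Re (\<Sum>j\<in>UNIV. \<Sum>k\<in>?K. \<Sum>i\<in>UNIV. complex_of_real (wave L k $ j) * complex_of_real (wave L k $ j) * (c k $ i * cnj (fourier L v k $ i)))"
    by (simp add: sum_distrib_left pd_coeff_def fourier_pd[OF v] mult_ac)
  also have "(\<Sum>j\<in>UNIV. \<Sum>k\<in>?K. \<Sum>i\<in>UNIV. complex_of_real (wave L k $ j) * complex_of_real (wave L k $ j) * (c k $ i * cnj (fourier L v k $ i)))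
     = (\<Sum>k\<in>?K. \<Sum>i\<in>UNIV. complex_of_real ((norm (wave L k))\<^sup>2) * (c k $ i * cnj (fourier L v k $ i)))"
    unfolding n sum_distrib_right by (subst sum.swap) (intro sum.cong refl sum.swap)
  also have "\<dots> = (\<Sum>k\<in>?K. \<Sum>i\<in>UNIV. lap_coeff L c k $ i * cnj (fourier L v k $ i))"
    by (simp add: lap_coeff_def scaleR_conv_of_real[of _ "_ :: complex"] mult_ac)
  finally show ?thesis
    using L2_inner_tfield'[OF H1_L2[OF v] hermitian_lap_coeff[OF c] K l] by simp
qed

text \<open>For a trigonometric field the divergence condition at a nonzero wave vector parallel to
  e_1 says that the first component of the coefficient vanishes; at k = 0 it vanishes by the zero
  mean. Density extends this to \<open>Hspace L\<close>.\<close>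

lemma H_orth_mode:
  assumes v: "v \<in> Hspace L" shows "L2_inner L v (tfield L (mode 1 p \<beta>)) = 0"
proof (rule L2.closure_in_orthogonal)
  show "v \<in> closure_in (L2 L) (L2_norm L) (trig_space L)" using v by (simp add: Hspace_def)
  fix u assume "u \<in> trig_space L"
  then obtain c where u: "u = tfield L c" and c: "solen c" unfolding trig_space_eq by blast
  have "mode 1 p \<beta> k $ i * cnj (c k $ i) = 0" for k i
  proof (cases "i = 1 \<and> (k = ek p \<or> k = ek (- p))")
    case True
    have "c k $ 1 = 0"
    proof (cases "k = 0")
      case F: False
      then have "c k \<in> Xspace L k" using c by (simp add: solen_def)
      moreover have "wave L k $ 1 \<noteq> 0" "wave L k $ 2 = 0" "wave L k $ 3 = 0"
        using True F pos[of 1] by (auto simp: wave_ek ek_eq_0)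
      ultimately show ?thesis by (simp add: Xspace_def sum_3)
    qed (use c in \<open>simp add: solen_def\<close>)
    then show ?thesis using True by simp
  next
    case False
    then show ?thesis using mode_component[of i 1 p \<beta> k] mode_eq_0[of k p 1 \<beta>] by auto
  qed
  then show "L2_inner L u (tfield L (mode 1 p \<beta>)) = 0"
    unfolding u by (intro L2_inner_tfield_zero tfield_L2 hermitian_mode) (simp only: fourier_tfield solen_hermitian c)
qed (use trig_L2 tfield_L2 in auto)

text \<open>The wave vectors of the mode have no component in direction \<open>j\<close>, so the
  derivative has zero coefficients there. This is integration by parts in a periodic direction along
  which the mode is constant.\<close>

lemma pd_orth_mode:
  assumes v: "v \<in> H1 L" and j: "j \<noteq> 1" shows "L2_inner L (pd L j v) (tfield L (mode i p \<beta>)) = 0"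
proof -
  have "mode i p \<beta> k $ l * cnj (fourier L (pd L j v) k $ l) = 0" for k l
  proof (cases "k = ek p \<or> k = ek (- p)")
    case True
    then have "wave L k $ j = 0" using j by (auto simp: wave_ek)
    then show ?thesis by (simp add: fourier_pd[OF v])
  next
    case False
    then show ?thesis using mode_eq_0[of k p i \<beta>] by simp
  qed
  then show ?thesis
    by (intro L2_inner_tfield_zero pd_L2[OF v] hermitian_mode)
qed

lemma L2_inner_mode:
  "L2_inner L v (tfield L (mode i p \<beta>)) = (\<integral>x. rep_vfield v x $ i * rmode L p \<beta> x \<partial>cell L)"
  by (subst L2_inner_cong[OF _ rep_tfield]) (simp_all add: tfun_mode inner_axis)

lemma integrable_component_rmode:
  assumes "v \<in> L2 L" shows "integrable (cell L) (\<lambda>x. rep_vfield v x $ i * rmode L p \<beta> x)"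
  using rmode_le by (intro integrable_mult_bounded integrable_rep_component assms) auto

lemma integral_component_rmode_mult:
  assumes v: "v \<in> L2 L" and z: "\<And>p \<beta>. L2_inner L v (tfield L (mode i p \<beta>)) = 0"
  shows "(\<integral>x. rep_vfield v x $ i * (rmode L p \<beta> x * rmode L q \<gamma> x) \<partial>cell L) = 0"
    and "integrable (cell L) (\<lambda>x. rep_vfield v x $ i * (rmode L p \<beta> x * rmode L q \<gamma> x))"
  using z integrable_component_rmode[OF v]
  by (simp_all add: rmode_mult distrib_left L2_inner_mode)

end

section \<open>Vertical shear flows\<close>

lemma rep_sum_vfield:
  assumes "finite M"
  shows "AE x in lebesgue. rep_vfield (\<Sum>m\<in>M. c m *\<^sub>R f m) x = (\<Sum>m\<in>M. c m *\<^sub>R rep_vfield (f m) x)"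
  using assms
proof (induction M)
  case empty
  show ?case using rep_zero_vfield by simp
next
  case (insert m M)
  show ?case
    using insert.IH rep_plus_vfield[of "c m *\<^sub>R f m" "\<Sum>m\<in>M. c m *\<^sub>R f m"] rep_scaleR_vfield[of "c m" "f m"]
    by eventually_elim (simp add: insert.hyps)
qed

definition comb :: "real^3 \<Rightarrow> nat set \<Rightarrow> (nat \<Rightarrow> real) \<Rightarrow> vfield" where
  "comb L M c = (\<Sum>m\<in>M. c m *\<^sub>R shear L m)"

definition amp :: "real^3 \<Rightarrow> nat set \<Rightarrow> (nat \<Rightarrow> real) \<Rightarrow> real^3 \<Rightarrow> real" where
  "amp L M c x = (\<Sum>m\<in>M. c m * rmode L (int m) (1/2) x)"

definition amp_pd :: "real^3 \<Rightarrow> nat set \<Rightarrow> (nat \<Rightarrow> real) \<Rightarrow> real^3 \<Rightarrow> real" where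
  "amp_pd L M c x = (\<Sum>m\<in>M. c m * rmode L (int m) (\<i> * complex_of_real (wave L (ek (int m)) $ 1) * (1/2)) x)"

definition adv :: "real^3 \<Rightarrow> vfield \<Rightarrow> vfield \<Rightarrow> real^3 \<Rightarrow> real^3" where
  "adv L u v x = (\<Sum>i\<in>UNIV. (rep_vfield u x $ i) *\<^sub>R rep_vfield (pd L i v) x)"

lemma bform_eq: "bform L u v w = (\<integral>x. adv L u v x \<bullet> rep_vfield w x \<partial>cell L)"
  by (simp add: bform_def adv_def set_integral_cell)

lemma sum_axis: "(\<Sum>m\<in>M. c m *\<^sub>R axis i (f m :: real)) = axis i (\<Sum>m\<in>M. c m * f m)"
  by (simp add: vec_eq_iff axis_def)

lemma amp_le: "\<bar>amp L M c x\<bar> \<le> (\<Sum>m\<in>M. \<bar>c m\<bar>)"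
proof -
  have "\<bar>amp L M c x\<bar> \<le> (\<Sum>m\<in>M. \<bar>c m * rmode L (int m) (1/2) x\<bar>)"
    unfolding amp_def by (rule sum_abs)
  also have "\<dots> \<le> (\<Sum>m\<in>M. \<bar>c m\<bar>)"
  proof (rule sum_mono)
    fix m
    show "\<bar>c m * rmode L (int m) (1/2) x\<bar> \<le> \<bar>c m\<bar>"
      using rmode_le[of L "int m" "1/2" x] by (simp add: abs_mult mult_left_le)
  qed
  finally show ?thesis .
qed

lemma measurable_amp [measurable]: "amp L M c \<in> borel_measurable (cell L)"
  unfolding amp_def[abs_def] by (intro borel_measurable_sum borel_measurable_times borel_measurable_const measurable_rmode)

lemma measurable_adv [measurable]: "adv L u v \<in> borel_measurable (cell L)"
  unfolding adv_def[abs_def] by (intro borel_measurable_sum borel_measurable_scaleR measurable_rep_component measurable_rep_cell)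

lemma rep_shear: "AE x in lebesgue. rep_vfield (shear L m) x = axis 3 (rmode L (int m) (1/2) x)"
  using rep_tfield[of L "mode 3 (int m) (1/2)"] by (simp add: shear_def tfun_mode)

lemma rep_comb:
  assumes "finite M" shows "AE x in lebesgue. rep_vfield (comb L M c) x = axis 3 (amp L M c x)"
proof -
  have "AE x in lebesgue. \<forall>m. rep_vfield (shear L m) x = axis 3 (rmode L (int m) (1/2) x)"
    using rep_shear by (simp add: AE_all_countable)
  then show ?thesis
    using rep_sum_vfield[OF assms, of c "shear L"]
    by eventually_elim (simp add: comb_def amp_def sum_axis)
qed

lemma lap_coeff_mode: "lap_coeff L (mode i p \<beta>) = (\<lambda>k. (norm (wave L (ek p)))\<^sup>2 *\<^sub>R mode i p \<beta> k)"
proof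
  fix k
  have "wave L (ek (- p)) = - wave L (ek p)" by (simp add: wave_minus[symmetric] ek_uminus)
  then show "lap_coeff L (mode i p \<beta>) k = (norm (wave L (ek p)))\<^sup>2 *\<^sub>R mode i p \<beta> k"
    using mode_eq_0[of k p i \<beta>] by (cases "k = ek p \<or> k = ek (- p)") (auto simp: lap_coeff_def)
qed

context torus
begin

lemma solen_mode_3: "m > 0 \<Longrightarrow> solen (mode 3 (int m) \<beta>)"
proof -
  assume m: "m > 0"
  have "mode 3 (int m) \<beta> k \<in> Xspace L k" for k
  proof (cases "k = ek (int m) \<or> k = ek (- int m)")
    case True
    then have "wave L k $ 3 = 0" by (auto simp: wave_ek)
    then show ?thesis by (simp add: Xspace_def sum_3 mode_component)
  qed (simp add: mode_eq_0 Xspace_def)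
  moreover have "mode 3 (int m) \<beta> 0 = 0"
    using m ek_eq_0[of "int m"] ek_eq_0[of "- int m"] by (intro mode_eq_0) auto
  ultimately show ?thesis by (simp add: solen_def hermitian_mode)
qed

lemma shear_trig: "m > 0 \<Longrightarrow> shear L m \<in> trig_space L"
  unfolding trig_space_eq shear_def using solen_mode_3 by blast

lemma pd_shear: "pd L j (shear L m) = tfield L (mode 3 (int m) (\<i> * complex_of_real (wave L (ek (int m)) $ j) * (1/2)))"
  unfolding shear_def by (simp only: pd_tfield hermitian_mode pd_coeff_mode)

lemma shear_H1: "shear L m \<in> H1 L"
  by (simp add: shear_def tfield_H1 hermitian_mode)

lemma shear_L2: "shear L m \<in> L2 L"
  by (simp add: shear_def tfield_L2)

lemma grad_inner_shear: "v \<in> H1 L \<Longrightarrow> grad_inner L v (shear L m) = freq L m * L2_inner L v (shear L m)"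
  unfolding shear_def freq_def
  by (simp add: grad_inner_tfield hermitian_mode lap_coeff_mode tfield_scaleR L2.scale_right H1_L2 tfield_L2)

lemma comb_trig: "(\<And>m. m \<in> M \<Longrightarrow> m > 0) \<Longrightarrow> comb L M c \<in> trig_space L"
  unfolding comb_def by (intro subspace_sum[OF subspace_trig] subspace_scale[OF subspace_trig] shear_trig)

lemma comb_H1: "comb L M c \<in> H1 L"
  unfolding comb_def by (intro grad.closed shear_H1)

lemma comb_L2: "comb L M c \<in> L2 L"
  by (intro H1_L2 comb_H1)

lemma comb_vertical: "finite M \<Longrightarrow> vertical (comb L M c)"
  unfolding vertical_def by (rule eventually_mono[OF rep_comb[of M L c]]) (auto simp: axis_def)

lemma shear_vertical: "vertical (shear L m)"
  unfolding vertical_def by (rule eventually_mono[OF rep_shear[of L m]]) (auto simp: axis_def)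

lemma pd_comb:
  assumes "finite M" shows "pd L j (comb L M c) = (\<Sum>m\<in>M. c m *\<^sub>R pd L j (shear L m))"
  using assms
proof (induction M)
  case empty
  have "pd L j (0 *\<^sub>R shear L 1) = 0 *\<^sub>R pd L j (shear L 1)" by (rule pd_scaleR[OF shear_H1])
  then show ?case by (simp add: comb_def)
next
  case (insert m M)
  have "comb L (insert m M) c = c m *\<^sub>R shear L m + comb L M c" using insert by (simp add: comb_def)
  then show ?case
    using insert grad.closed(4)[OF shear_H1] by (simp add: pd_add comb_H1 pd_scaleR shear_H1)
qed

lemma rep_pd_comb_1:
  assumes "finite M" shows "AE x in lebesgue. rep_vfield (pd L 1 (comb L M c)) x = axis 3 (amp_pd L M c x)"
proof -
  have "AE x in lebesgue. \<forall>m. rep_vfield (pd L 1 (shear L m)) x = axis 3 (rmode L (int m) (\<i> * complex_of_real (wave L (ek (int m)) $ 1) * (1/2)) x)"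
    unfolding pd_shear AE_all_countable using rep_tfield by (simp only: tfun_mode[symmetric]) blast
  then show ?thesis
    unfolding pd_comb[OF assms]
    using rep_sum_vfield[OF assms, of c "\<lambda>m. pd L 1 (shear L m)"]
    by eventually_elim (simp add: amp_pd_def sum_axis)
qed

lemma pd_comb_0:
  assumes "finite M" "j \<noteq> 1" shows "pd L j (comb L M c) = 0"
proof -
  have "tfield L (\<lambda>_. 0) = 0"
    using tfield_scaleR[of "\<lambda>_. 0" L 0] by (simp add: hermitian_def)
  then have "pd L j (shear L m) = 0" for m
    using assms(2) by (simp add: pd_shear wave_ek mode_zero)
  then show ?thesis by (simp add: pd_comb[OF assms(1)])
qed

section \<open>The trilinear form in the presence of shear flows\<close>

lemma bform_comb_comb:
  assumes "finite M" shows "bform L (comb L M c) (comb L M c) z = 0"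
  unfolding bform_eq
proof (rule integral_eq_zero_AE)
  have "AE x in cell L. rep_vfield (pd L 3 (comb L M c)) x = 0"
    using AE_cell[OF rep_zero_vfield] by (simp add: pd_comb_0[OF assms])
  then show "AE x in cell L. adv L (comb L M c) (comb L M c) x \<bullet> rep_vfield z x = 0"
    using AE_cell[OF rep_comb[OF assms, of L c]]
    by eventually_elim (simp add: adv_def sum_3 axis_def)
qed

lemma integrable_adv:
  assumes u: "u \<in> L2 L" and v: "v \<in> H1 L"
  shows "integrable (cell L) (adv L u v)"
  unfolding adv_def[abs_def]
proof (rule Bochner_Integration.integrable_sum)
  fix i
  show "integrable (cell L) (\<lambda>x. (rep_vfield u x $ i) *\<^sub>R rep_vfield (pd L i v) x)"
  proof (rule Bochner_Integration.integrable_bound)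
    show "integrable (cell L) (\<lambda>x. (norm (rep_vfield u x))\<^sup>2 + (norm (rep_vfield (pd L i v) x))\<^sup>2)"
      using u pd_L2[OF v, of i] by (simp add: L2_iff)
    have "norm ((a $ i) *\<^sub>R b) \<le> (norm a)\<^sup>2 + (norm b)\<^sup>2" for a b :: "real^3"
    proof -
      have "norm ((a $ i) *\<^sub>R b) \<le> norm a * norm b"
        using component_le_norm_cart[of a i] by (simp add: mult_right_mono)
      then show ?thesis
        using sum_squares_bound[of "norm a" "norm b"] norm_ge_zero[of a] norm_ge_zero[of b]
          mult_nonneg_nonneg[OF norm_ge_zero[of a] norm_ge_zero[of b]] by linarith
    qed
    then show "AE x in cell L. norm ((rep_vfield u x $ i) *\<^sub>R rep_vfield (pd L i v) x)
        \<le> norm ((norm (rep_vfield u x))\<^sup>2 + (norm (rep_vfield (pd L i v) x))\<^sup>2)"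
      by (intro AE_I2) (simp add: abs_of_nonneg)
  qed (intro borel_measurable_scaleR measurable_rep_component measurable_rep_cell)
qed

lemma integrable_adv_component:
  assumes "u \<in> L2 L" "v \<in> H1 L" shows "integrable (cell L) (\<lambda>x. adv L u v x $ i)"
  using integrable_bounded_linear[OF bounded_linear_vec_nth integrable_adv[OF assms]] .

lemma integrable_adv_bounded:
  assumes "u \<in> L2 L" "v \<in> H1 L" "\<phi> \<in> borel_measurable (cell L)" "\<And>x. \<bar>\<phi> x\<bar> \<le> B"
  shows "integrable (cell L) (\<lambda>x. adv L u v x $ i * \<phi> x)"
  using assms by (intro integrable_mult_bounded[where B=B] integrable_adv_component) auto

lemma bform_axis_3:
  assumes "AE x in lebesgue. rep_vfield w x = axis 3 (\<phi> x)" "\<phi> \<in> borel_measurable (cell L)"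
  shows "bform L u v w = (\<integral>x. adv L u v x $ 3 * \<phi> x \<partial>cell L)"
  unfolding bform_eq
proof (rule integral_cong_AE)
  show "AE x in cell L. adv L u v x \<bullet> rep_vfield w x = adv L u v x $ 3 * \<phi> x"
    using AE_cell[OF assms(1)] by eventually_elim (simp add: inner_axis)
  show "(\<lambda>x. adv L u v x $ 3 * \<phi> x) \<in> borel_measurable (cell L)"
    using assms(2) borel_measurable_inner[OF measurable_adv[of L u v] borel_measurable_const[of "axis 3 1"]]
    by (intro borel_measurable_times) (simp_all add: inner_axis)
qed (intro borel_measurable_inner measurable_adv measurable_rep_cell)

text \<open>Linearity in the third slot is not automatic for the Bochner integral, which is 0 on
  non-integrable functions; it holds here because the amplitudes are bounded, so that each summand
  is integrable.\<close>

lemma bform_sum: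
  assumes M: "finite M" and v: "v \<in> H1 L"
  shows "bform L v v (comb L M c) = (\<Sum>m\<in>M. c m * bform L v v (shear L m))"
proof -
  have int: "integrable (cell L) (\<lambda>x. c m * (adv L v v x $ 3 * rmode L (int m) (1/2) x))" for m
    using rmode_le by (intro integrable_mult_right integrable_adv_bounded H1_L2 v measurable_rmode)
  have "bform L v v (comb L M c) = (\<integral>x. (\<Sum>m\<in>M. c m * (adv L v v x $ 3 * rmode L (int m) (1/2) x)) \<partial>cell L)"
    unfolding bform_axis_3[OF rep_comb[OF M] measurable_amp] amp_def by (simp add: sum_distrib_left mult_ac)
  also have "\<dots> = (\<Sum>m\<in>M. \<integral>x. c m * (adv L v v x $ 3 * rmode L (int m) (1/2) x) \<partial>cell L)"
    by (rule Bochner_Integration.integral_sum) (rule int)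
  also have "\<dots> = (\<Sum>m\<in>M. c m * bform L v v (shear L m))"
    unfolding bform_axis_3[OF rep_shear measurable_rmode] by simp
  finally show ?thesis .
qed

lemma L2_norm_sq_eq: "(L2_norm L u)\<^sup>2 = (\<integral>x. (norm (rep_vfield u x))\<^sup>2 \<partial>cell L)"
  by (simp add: L2_norm_def L2_inner_eq power2_norm_eq_inner)

lemma grad_norm_sq_eq:
  assumes "w \<in> H1 L" shows "(grad_norm L w)\<^sup>2 = (\<integral>x. (\<Sum>i\<in>UNIV. (norm (rep_vfield (pd L i w) x))\<^sup>2) \<partial>cell L)"
proof -
  have "(grad_norm L w)\<^sup>2 = (\<Sum>i\<in>UNIV. L2_inner L (pd L i w) (pd L i w))"
    using assms by (simp add: grad.nrm_sq grad_inner_def)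
  also have "\<dots> = (\<Sum>i\<in>UNIV. \<integral>x. (norm (rep_vfield (pd L i w) x))\<^sup>2 \<partial>cell L)"
    by (simp add: L2_inner_eq power2_norm_eq_inner)
  also have "\<dots> = (\<integral>x. (\<Sum>i\<in>UNIV. (norm (rep_vfield (pd L i w) x))\<^sup>2) \<partial>cell L)"
    using pd_L2[OF assms] by (intro Bochner_Integration.integral_sum[symmetric]) (auto simp: L2_iff)
  finally show ?thesis .
qed

text \<open>Young's inequality with the weight chosen so that the gradient enters with factor 1 and can be
  absorbed by the dissipation.\<close>

lemma bform_diagonal_le:
  assumes w: "w \<in> H1 L" and m: "\<phi> \<in> borel_measurable (cell L)" and A: "\<And>x. \<bar>\<phi> x\<bar> \<le> A"
  shows "(\<integral>x. adv L w w x $ 3 * \<phi> x \<partial>cell L) \<le> (grad_norm L w)\<^sup>2 + A\<^sup>2 / 4 * (L2_norm L w)\<^sup>2"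
proof -
  let ?g = "\<lambda>x. \<Sum>i\<in>UNIV. (norm (rep_vfield (pd L i w) x))\<^sup>2" and ?n = "\<lambda>x. (norm (rep_vfield w x))\<^sup>2"
  have ig: "integrable (cell L) ?g"
    using pd_L2[OF w] by (intro Bochner_Integration.integrable_sum) (auto simp: L2_iff)
  have inn: "integrable (cell L) ?n" using H1_L2[OF w] by (simp add: L2_iff)
  have le: "adv L w w x $ 3 * \<phi> x \<le> ?g x + A\<^sup>2 / 4 * ?n x" for x
  proof -
    have t: "a * b * p \<le> b\<^sup>2 + A\<^sup>2 / 4 * a\<^sup>2" if "\<bar>p\<bar> \<le> A" for a b p :: real
    proof -
      have "a * b * p \<le> \<bar>a * b * p\<bar>" by simp
      also have "\<dots> = \<bar>a * b\<bar> * \<bar>p\<bar>" by (simp add: abs_mult)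
      also have "\<dots> \<le> \<bar>a * b\<bar> * A" using that by (rule mult_left_mono) simp
      finally have "a * b * p \<le> \<bar>a * b\<bar> * A" .
      moreover have "0 \<le> (\<bar>b\<bar> - A / 2 * \<bar>a\<bar>)\<^sup>2" by simp
      then have "\<bar>a\<bar> * \<bar>b\<bar> * A \<le> \<bar>b\<bar>\<^sup>2 + A\<^sup>2 / 4 * \<bar>a\<bar>\<^sup>2"
        by (simp add: power2_diff power_mult_distrib power_divide algebra_simps)
      ultimately show ?thesis by (simp add: abs_mult)
    qed
    have "adv L w w x $ 3 * \<phi> x = (\<Sum>i\<in>UNIV. rep_vfield w x $ i * rep_vfield (pd L i w) x $ 3 * \<phi> x)"
      by (simp add: adv_def sum_distrib_right)
    also have "\<dots> \<le> (\<Sum>i\<in>UNIV. (rep_vfield (pd L i w) x $ 3)\<^sup>2 + A\<^sup>2 / 4 * (rep_vfield w x $ i)\<^sup>2)"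
      by (intro sum_mono t A)
    also have "\<dots> = (\<Sum>i\<in>UNIV. (rep_vfield (pd L i w) x $ 3)\<^sup>2) + A\<^sup>2 / 4 * ?n x"
    proof -
      have n: "?n x = (\<Sum>i\<in>UNIV. (rep_vfield w x $ i)\<^sup>2)"
        unfolding power2_norm_eq_inner inner_vec_def by (simp add: power2_eq_square)
      show ?thesis by (simp only: sum.distrib sum_distrib_left n)
    qed
    also have "(\<Sum>i\<in>UNIV. (rep_vfield (pd L i w) x $ 3)\<^sup>2) \<le> ?g x"
    proof (rule sum_mono)
      fix i
      show "(rep_vfield (pd L i w) x $ 3)\<^sup>2 \<le> (norm (rep_vfield (pd L i w) x))\<^sup>2"
        using component_le_norm_cart[of "rep_vfield (pd L i w) x" 3] by (metis abs_ge_zero power2_abs power_mono)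
    qed
    finally show ?thesis by simp
  qed
  have "(\<integral>x. adv L w w x $ 3 * \<phi> x \<partial>cell L) \<le> (\<integral>x. ?g x + A\<^sup>2 / 4 * ?n x \<partial>cell L)"
    using le by (intro integral_mono integrable_adv_bounded[OF H1_L2[OF w] w m A]
        Bochner_Integration.integrable_add integrable_mult_right ig inn)
  also have "\<dots> = (grad_norm L w)\<^sup>2 + A\<^sup>2 / 4 * (L2_norm L w)\<^sup>2"
    using ig inn by (simp add: grad_norm_sq_eq[OF w] L2_norm_sq_eq del: integrable_sum)
  finally show ?thesis .
qed

text \<open>Expanding the product of two finite mode sums reduces to \<open>rmode_mult\<close>.
  Integrability is stated along with it because the trilinear integral is later split into three
  parts.\<close>

lemma integral_component_sums:
  assumes v: "v \<in> L2 L" and z: "\<And>p \<beta>. L2_inner L v (tfield L (mode i p \<beta>)) = 0"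
    and \<phi>: "\<phi> = (\<lambda>x. \<Sum>m\<in>M. c m * rmode L (p m) (\<beta> m) x)" and \<psi>: "\<psi> = (\<lambda>x. \<Sum>m\<in>N. d m * rmode L (q m) (\<gamma> m) x)"
  shows "integrable (cell L) (\<lambda>x. rep_vfield v x $ i * (\<phi> x * \<psi> x))"
    "(\<integral>x. rep_vfield v x $ i * (\<phi> x * \<psi> x) \<partial>cell L) = 0"
proof -
  let ?f = "\<lambda>m l x. (c m * d l) * (rep_vfield v x $ i * (rmode L (p m) (\<beta> m) x * rmode L (q l) (\<gamma> l) x))"
  have eq: "(\<lambda>x. rep_vfield v x $ i * (\<phi> x * \<psi> x)) = (\<lambda>x. \<Sum>m\<in>M. \<Sum>l\<in>N. ?f m l x)"
  proof
    fix x
    have "\<phi> x * \<psi> x = (\<Sum>m\<in>M. \<Sum>l\<in>N. (c m * rmode L (p m) (\<beta> m) x) * (d l * rmode L (q l) (\<gamma> l) x))"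
      unfolding \<phi> \<psi> by (rule sum_product)
    then show "rep_vfield v x $ i * (\<phi> x * \<psi> x) = (\<Sum>m\<in>M. \<Sum>l\<in>N. ?f m l x)"
      by (simp add: sum_distrib_left mult_ac)
  qed
  have int: "integrable (cell L) (?f m l)" for m l
    by (intro integrable_mult_right integral_component_rmode_mult[OF v z])
  show "integrable (cell L) (\<lambda>x. rep_vfield v x $ i * (\<phi> x * \<psi> x))"
    unfolding eq by (intro Bochner_Integration.integrable_sum int)
  have "(\<integral>x. (\<Sum>m\<in>M. \<Sum>l\<in>N. ?f m l x) \<partial>cell L) = (\<Sum>m\<in>M. \<Sum>l\<in>N. \<integral>x. ?f m l x \<partial>cell L)"
    by (simp only: Bochner_Integration.integral_sum Bochner_Integration.integrable_sum int)
  also have "\<dots> = 0" by (simp add: integral_component_rmode_mult[OF v z])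
  finally show "(\<integral>x. rep_vfield v x $ i * (\<phi> x * \<psi> x) \<partial>cell L) = 0" unfolding eq .
qed

text \<open>The coefficient sum enters through a free bound \<open>A\<close>, so that one constant,
  the sum at time 0, serves for all later times.\<close>

lemma bform_le:
  assumes v: "v \<in> Vspace L" and M: "finite M" "\<And>m. m \<in> M \<Longrightarrow> m > 0" and A: "(\<Sum>m\<in>M. \<bar>c m\<bar>) \<le> A"
  shows "bform L v v (comb L M c) \<le> (grad_norm L (v - comb L M c))\<^sup>2 + A\<^sup>2 / 4 * (L2_norm L (v - comb L M c))\<^sup>2"
proof -
  let ?u = "comb L M c"
  define w where "w = v - ?u"
  have wV: "w \<in> Vspace L" unfolding w_def
    by (intro subspace_diff[OF subspace_Vspace] v trig_V comb_trig M)
  have w1: "w \<in> H1 L" and wH: "w \<in> Hspace L" and w2: "w \<in> L2 L"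
    using wV V_H1 V_H H1_L2 by auto
  let ?\<phi> = "amp L M c" and ?\<psi> = "amp_pd L M c"
  have pd_w: "pd L j w = pd L j v - pd L j ?u" for j
    unfolding w_def by (rule pd_diff[OF V_H1[OF v] comb_H1])
  have A': "\<bar>?\<phi> x\<bar> \<le> A" for x using amp_le[of L M c x] A by linarith
  have zw: "L2_inner L w (tfield L (mode 1 p \<beta>)) = 0" for p \<beta> by (rule H_orth_mode[OF wH])
  have zp: "L2_inner L (pd L 3 w) (tfield L (mode 3 p \<beta>)) = 0" for p \<beta>
    by (rule pd_orth_mode[OF w1]) simp
  have amp: "?\<phi> = (\<lambda>x. \<Sum>m\<in>M. c m * rmode L (int m) (1/2) x)"
    and amp_pd: "?\<psi> = (\<lambda>x. \<Sum>m\<in>M. c m * rmode L (int m) (\<i> * complex_of_real (wave L (ek (int m)) $ 1) * (1/2)) x)"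
    by (rule ext, simp only: amp_def amp_pd_def)+
  note i1 = integral_component_sums[OF w2 zw amp_pd amp]
  note i3 = integral_component_sums[OF pd_L2[OF w1] zp amp amp]
  note i0 = integrable_adv_bounded[OF w2 w1 measurable_amp A', of 3]
  have "bform L v v ?u = (\<integral>x. adv L v v x $ 3 * ?\<phi> x \<partial>cell L)"
    by (rule bform_axis_3[OF rep_comb[OF M(1)] measurable_amp])
  \<comment> \<open>Expansion of (v . grad) v for v = w + \<phi> e_3: the shear transporting
    \<open>w\<close> gives \<phi> times the x_3-derivative of w_3, and \<open>w\<close> transporting
    the shear gives w_1 \<psi>, with \<psi> the x_1-derivative of \<phi>; the shear does not
    transport itself. A further factor \<phi> comes from the third slot.\<close>
  also have "\<dots> = (\<integral>x. adv L w w x $ 3 * ?\<phi> x + rep_vfield (pd L 3 w) x $ 3 * (?\<phi> x * ?\<phi> x)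
      + rep_vfield w x $ 1 * (?\<psi> x * ?\<phi> x) \<partial>cell L)"
  proof (rule integral_cong_AE)
    show "(\<lambda>x. adv L v v x $ 3 * ?\<phi> x) \<in> borel_measurable (cell L)"
      by (rule borel_measurable_integrable, rule integrable_adv_bounded[OF H1_L2 _ measurable_amp A'])
         (use V_H1[OF v] in auto)
    show "(\<lambda>x. adv L w w x $ 3 * ?\<phi> x + rep_vfield (pd L 3 w) x $ 3 * (?\<phi> x * ?\<phi> x)
      + rep_vfield w x $ 1 * (?\<psi> x * ?\<phi> x)) \<in> borel_measurable (cell L)"
      by (intro borel_measurable_integrable Bochner_Integration.integrable_add i0 i1 i3)
    have p2: "pd L 2 w = pd L 2 v" and p3: "pd L 3 w = pd L 3 v"
      using pd_w[of 2] pd_w[of 3] pd_comb_0[OF M(1), of 2 c] pd_comb_0[OF M(1), of 3 c] by auto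
    show "AE x in cell L. adv L v v x $ 3 * ?\<phi> x = adv L w w x $ 3 * ?\<phi> x + rep_vfield (pd L 3 w) x $ 3 * (?\<phi> x * ?\<phi> x)
      + rep_vfield w x $ 1 * (?\<psi> x * ?\<phi> x)"
      using AE_cell[OF rep_comb[OF M(1), of L c]] AE_cell[OF rep_pd_comb_1[OF M(1), of c]]
        AE_cell[OF rep_diff_vfield[of v ?u]] AE_cell[OF rep_diff_vfield[of "pd L 1 v" "pd L 1 ?u"]]
    proof eventually_elim
      case (elim x)
      have "rep_vfield v x = rep_vfield w x + axis 3 (?\<phi> x)"
        using elim by (simp add: w_def)
      moreover have "rep_vfield (pd L 1 v) x = rep_vfield (pd L 1 w) x + axis 3 (?\<psi> x)"
        using elim by (simp add: pd_w)
      ultimately show ?case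
        by (simp add: adv_def sum_3 p2 p3 axis_def algebra_simps)
    qed
  qed
  also have "\<dots> = (\<integral>x. adv L w w x $ 3 * ?\<phi> x \<partial>cell L)"
    using i0 i1 i3 by simp
  also have "\<dots> \<le> (grad_norm L w)\<^sup>2 + A\<^sup>2 / 4 * (L2_norm L w)\<^sup>2"
    by (rule bform_diagonal_le[OF w1 measurable_amp A'])
  finally show ?thesis by (simp add: w_def)
qed

lemma fourier_comb:
  assumes "finite M" shows "fourier L (comb L M c) k = (\<Sum>m\<in>M. c m *\<^sub>R mode 3 (int m) (1/2) k)"
  using assms
proof (induction M)
  case empty
  have "fourier L (0 *\<^sub>R shear L 1) k = 0 *\<^sub>R fourier L (shear L 1) k" by (rule fourier_scaleR)
  then show ?case by (simp add: comb_def)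
next
  case (insert m M)
  have "comb L (insert m M) c = c m *\<^sub>R shear L m + comb L M c" using insert by (simp add: comb_def)
  then show ?case
    using insert L2.closed(4)[OF shear_L2]
    by (simp add: fourier_add comb_L2 fourier_scaleR) (simp add: shear_def fourier_tfield hermitian_mode)
qed

lemma stokes_comb:
  assumes M: "finite M" "\<And>m. m \<in> M \<Longrightarrow> m > 0"
  shows "stokes L (comb L M c) = comb L M (\<lambda>m. c m * freq L m)"
proof (rule stokes_eq)
  show "comb L M (\<lambda>m. c m * freq L m) \<in> Hspace L"
    by (intro V_H trig_V comb_trig M)
  have eq: "(norm (wave L k))\<^sup>2 *\<^sub>R mode 3 (int m) (1/2) k = freq L m *\<^sub>R mode 3 (int m) (1/2) k" for m k
    using lap_coeff_mode[of L 3 "int m" "1/2"] by (simp add: lap_coeff_def fun_eq_iff freq_def)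
  show "fourier L (comb L M (\<lambda>m. c m * freq L m)) k = (norm (wave L k))\<^sup>2 *\<^sub>R fourier L (comb L M c) k" for k
    unfolding fourier_comb[OF M(1)] scaleR_sum_right scaleR_left_commute[of "(norm (wave L k))\<^sup>2"] eq
    by (simp only: scaleR_scaleR)
qed

end

section \<open>Decaying shear flows as global regular solutions\<close>

context torus
begin

text \<open>This is -A z as an element of V'. With z = u(t) it is the time derivative of the
  decaying flow; the value 0 outside \<open>Vspace L\<close> is the convention of
  \<open>Vdual\<close>.\<close>

definition grad_functional :: "vfield \<Rightarrow> vfield \<Rightarrow> real" where
  "grad_functional z w = (if w \<in> Vspace L then - grad_inner L z w else 0)"

lemma grad_functional_bound:
  assumes "z \<in> Vspace L" "w \<in> Vspace L"
  shows "\<bar>grad_functional z w\<bar> \<le> grad_norm L z * grad_norm L w"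
  using grad.Cauchy_Schwarz[OF V_H1 V_H1] assms by (simp add: grad_functional_def)

lemma grad_functional_Vdual:
  assumes z: "z \<in> Vspace L" shows "grad_functional z \<in> Vdual L"
  unfolding Vdual_def
proof (intro CollectI conjI ballI allI impI)
  fix v w assume vw: "v \<in> Vspace L" "w \<in> Vspace L"
  then have "v + w \<in> Vspace L" by (intro subspace_add[OF subspace_Vspace])
  then show "grad_functional z (v + w) = grad_functional z v + grad_functional z w"
    using vw z by (simp add: grad_functional_def grad.add_right V_H1)
next
  fix a v assume v: "v \<in> Vspace L"
  then have "a *\<^sub>R v \<in> Vspace L" by (intro subspace_scale[OF subspace_Vspace])
  then show "grad_functional z (a *\<^sub>R v) = a * grad_functional z v"
    using v z by (simp add: grad_functional_def grad.scale_right V_H1)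
next
  show "\<exists>C. \<forall>v\<in>Vspace L. \<bar>grad_functional z v\<bar> \<le> C * grad_norm L v"
    using grad_functional_bound[OF z] by blast
qed (simp add: grad_functional_def)

text \<open>Cauchy-Schwarz gives the upper bound, attained at z divided by its norm, or at z itself
  if the norm is 0. Continuity in V' thereby becomes continuity in
  \<open>grad_norm L\<close>.\<close>

lemma Vdual_norm_grad_functional:
  assumes z: "z \<in> Vspace L" shows "Vdual_norm L (grad_functional z) = grad_norm L z"
proof -
  let ?S = "{\<bar>grad_functional z v\<bar> | v. v \<in> Vspace L \<and> grad_norm L v \<le> 1}"
  have N0: "0 \<le> grad_norm L z" using grad.nrm_nonneg V_H1 z by blast
  have ub: "s \<le> grad_norm L z" if s: "s \<in> ?S" for s
  proof -
    obtain v where v: "v \<in> Vspace L" "grad_norm L v \<le> 1" "s = \<bar>grad_functional z v\<bar>" using s by blast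
    have "s \<le> grad_norm L z * grad_norm L v" unfolding v(3) by (rule grad_functional_bound[OF z v(1)])
    also have "\<dots> \<le> grad_norm L z * 1" using v(2) N0 by (intro mult_left_mono) auto
    finally show ?thesis by simp
  qed
  have "grad_norm L z \<in> ?S"
  proof (cases "grad_norm L z = 0")
    case True
    have "\<bar>grad_functional z z\<bar> = grad_norm L z"
      using True z grad_functional_bound[OF z z] by simp
    then show ?thesis using True z by force
  next
    case False
    let ?v = "(1 / grad_norm L z) *\<^sub>R z"
    have vV: "?v \<in> Vspace L" using z by (intro subspace_scale[OF subspace_Vspace])
    have n: "grad_norm L ?v = 1" using False N0 V_H1[OF z] by (simp add: grad.nrm_scale)
    have "grad_functional z ?v = - (1 / grad_norm L z * grad_inner L z z)"
      using vV V_H1[OF z] unfolding grad_functional_def by (simp add: grad.scale_right)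
    also have "grad_inner L z z = grad_norm L z * grad_norm L z"
      using grad.nrm_sq[OF V_H1[OF z]] by (simp add: power2_eq_square)
    finally have "\<bar>grad_functional z ?v\<bar> = grad_norm L z" using False N0 by simp
    then show ?thesis using vV n by (metis (mono_tags, lifting) mem_Collect_eq order_refl)
  qed
  then show ?thesis
    unfolding Vdual_norm_def using ub by (intro cSup_eq_maximum)
qed

lemma grad_functional_diff:
  assumes "y \<in> Vspace L" "z \<in> Vspace L"
  shows "grad_functional y - grad_functional z = grad_functional (y - z)"
  by (rule ext) (use assms in \<open>simp add: grad_functional_def grad.diff_left V_H1\<close>)

text \<open>Defined for all real \<open>t\<close>, so that two-sided derivatives exist at every
  time, as \<open>distr_deriv_of_DERIV\<close> demands.\<close>

definition heat_coeff :: "(nat \<Rightarrow> real) \<Rightarrow> real \<Rightarrow> nat \<Rightarrow> real" where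
  "heat_coeff a t m = a m * exp (- freq L m * t)"

definition heat :: "nat set \<Rightarrow> (nat \<Rightarrow> real) \<Rightarrow> real \<Rightarrow> vfield" where
  "heat M a t = comb L M (heat_coeff a t)"

lemma heat_coeff_DERIV: "((\<lambda>t. heat_coeff a t m) has_real_derivative - freq L m * heat_coeff a t m) (at t)"
  unfolding heat_coeff_def by (auto intro!: derivative_eq_intros)

lemma continuous_on_heat_coeff [continuous_intros]: "continuous_on T (\<lambda>t. heat_coeff a t m)"
  unfolding heat_coeff_def by (intro continuous_intros)

lemma freq_nonneg: "0 \<le> freq L m"
  by (simp add: freq_def)

lemma heat_eq_sum: "heat M a t = (\<Sum>m\<in>M. heat_coeff a t m *\<^sub>R shear L m)"
  by (simp add: heat_def comb_def)

lemma comb_diff: "comb L M c - comb L M d = comb L M (\<lambda>m. c m - d m)"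
  by (simp add: comb_def sum_subtractf scaleR_left_diff_distrib)

context
  fixes M :: "nat set"
  assumes M: "finite M" "\<And>m. m \<in> M \<Longrightarrow> m > 0"
begin

lemma heat_trig: "heat M a t \<in> trig_space L"
  unfolding heat_def by (intro comb_trig M)

lemma heat_H1: "heat M a t \<in> H1 L"
  unfolding heat_def by (rule comb_H1)

lemma heat_L2: "heat M a t \<in> L2 L"
  by (intro H1_L2 heat_H1)

lemma L2_inner_heat: "w \<in> L2 L \<Longrightarrow> L2_inner L (heat M a t) w = (\<Sum>m\<in>M. heat_coeff a t m * L2_inner L (shear L m) w)"
  unfolding heat_eq_sum by (intro L2.sum_left shear_L2)

lemma grad_inner_heat:
  assumes w: "w \<in> H1 L"
  shows "grad_inner L (heat M a t) w = (\<Sum>m\<in>M. freq L m * heat_coeff a t m * L2_inner L (shear L m) w)"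
proof -
  have "grad_inner L (shear L m) w = freq L m * L2_inner L (shear L m) w" for m
    using grad_inner_shear[OF w] grad.commute[OF w shear_H1] L2.commute[OF H1_L2[OF w] shear_L2] by simp
  then show ?thesis
    unfolding heat_eq_sum by (simp add: grad.sum_left shear_H1 w mult_ac)
qed

lemma L2_inner_heat_DERIV:
  assumes w: "w \<in> L2 L"
  shows "((\<lambda>t. L2_inner L (heat M a t) w) has_real_derivative
    (\<Sum>m\<in>M. (- freq L m * heat_coeff a t m) * L2_inner L (shear L m) w)) (at t)"
  unfolding L2_inner_heat[OF w] by (intro DERIV_sum DERIV_cmult_right heat_coeff_DERIV)

lemma distr_deriv_heat:
  assumes w: "w \<in> L2 L"
  shows "distr_deriv (\<lambda>t. L2_inner L (heat M a t) w) (\<lambda>t. \<Sum>m\<in>M. (- freq L m * heat_coeff a t m) * L2_inner L (shear L m) w)"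
  by (rule distr_deriv_of_DERIV[OF L2_inner_heat_DERIV[OF w]]) (intro continuous_intros)

lemma energy_heat:
  assumes t: "s \<le> t"
  shows "(L2_norm L (heat M a t))\<^sup>2 / 2 + (LINT \<tau>:{s..t}|lebesgue. (grad_norm L (heat M a \<tau>))\<^sup>2) = (L2_norm L (heat M a s))\<^sup>2 / 2"
proof -
  let ?c = "heat_coeff a" and ?G = "\<lambda>m l. L2_inner L (shear L m) (shear L l)"
  have E: "(L2_norm L (heat M a \<tau>))\<^sup>2 = (\<Sum>m\<in>M. \<Sum>l\<in>M. ?c \<tau> m * ?c \<tau> l * ?G m l)" for \<tau>
    unfolding L2.nrm_sq[OF heat_L2]
    by (subst L2_inner_heat[OF heat_L2]) (simp add: heat_eq_sum L2.sum_right shear_L2 sum_distrib_left mult_ac)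
  \<comment> \<open>Self-adjointness of the Stokes operator on two shear modes. It lets the double
    sum be symmetrized, so that orthogonality of distinct modes does not have to be invoked.\<close>
  have sym: "freq L m * ?G m l = freq L l * ?G m l" for m l
    using grad_inner_shear[OF shear_H1, of m l] grad_inner_shear[OF shear_H1, of l m]
      grad.commute[OF shear_H1 shear_H1, of m l] L2.commute[OF shear_L2 shear_L2, of m l] by simp
  have D: "(grad_norm L (heat M a \<tau>))\<^sup>2 = (\<Sum>m\<in>M. \<Sum>l\<in>M. freq L m * (?c \<tau> m * ?c \<tau> l * ?G m l))" for \<tau>
    unfolding grad.nrm_sq[OF heat_H1]
    by (subst grad_inner_heat[OF heat_H1]) (simp add: heat_eq_sum L2.sum_right shear_L2 sum_distrib_left mult_ac)
  have "(LINT \<tau>:{s..t}|lebesgue. (grad_norm L (heat M a \<tau>))\<^sup>2) = - (L2_norm L (heat M a t))\<^sup>2 / 2 - (- (L2_norm L (heat M a s))\<^sup>2 / 2)"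
  proof (rule set_integral_FTC[OF t])
    show "continuous_on {s..t} (\<lambda>\<tau>. (grad_norm L (heat M a \<tau>))\<^sup>2)"
      unfolding D by (intro continuous_intros)
    fix \<tau>
    have "((\<lambda>\<tau>. (L2_norm L (heat M a \<tau>))\<^sup>2) has_real_derivative
      (\<Sum>m\<in>M. \<Sum>l\<in>M. ((- freq L m * ?c \<tau> m) * ?c \<tau> l + (- freq L l * ?c \<tau> l) * ?c \<tau> m) * ?G m l)) (at \<tau>)"
      unfolding E by (intro DERIV_sum DERIV_cmult_right DERIV_mult heat_coeff_DERIV)
    moreover have "(\<Sum>m\<in>M. \<Sum>l\<in>M. ((- freq L m * ?c \<tau> m) * ?c \<tau> l + (- freq L l * ?c \<tau> l) * ?c \<tau> m) * ?G m l)
      = - 2 * (grad_norm L (heat M a \<tau>))\<^sup>2"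
      unfolding D sum_distrib_left
    proof (intro sum.cong refl)
      fix m l
      have "((- freq L m * ?c \<tau> m) * ?c \<tau> l + (- freq L l * ?c \<tau> l) * ?c \<tau> m) * ?G m l
        = - (?c \<tau> m * ?c \<tau> l) * (freq L m * ?G m l) - (?c \<tau> m * ?c \<tau> l) * (freq L l * ?G m l)"
        by (simp add: algebra_simps)
      then show "((- freq L m * ?c \<tau> m) * ?c \<tau> l + (- freq L l * ?c \<tau> l) * ?c \<tau> m) * ?G m l
        = - 2 * (freq L m * (?c \<tau> m * ?c \<tau> l * ?G m l))"
        by (simp only: sym[of m l, symmetric]) (simp add: algebra_simps)
    qed
    ultimately have "((\<lambda>\<tau>. (L2_norm L (heat M a \<tau>))\<^sup>2) has_real_derivative - 2 * (grad_norm L (heat M a \<tau>))\<^sup>2) (at \<tau>)"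
      by simp
    from DERIV_cmult[OF this, of "-1/2"]
    show "((\<lambda>\<tau>. - (L2_norm L (heat M a \<tau>))\<^sup>2 / 2) has_real_derivative (grad_norm L (heat M a \<tau>))\<^sup>2) (at \<tau>)"
      by simp
  qed
  then show ?thesis by simp
qed

lemma grad_norm_heat_tendsto: "((\<lambda>s. grad_norm L (heat M a s - heat M a t)) \<longlongrightarrow> 0) (at t within T)"
  unfolding heat_eq_sum
proof (rule grad.nrm_sum_tendsto)
  show "((\<lambda>t. heat_coeff a t m) \<longlongrightarrow> heat_coeff a t m) (at t within T)" for m
    using DERIV_isCont[OF heat_coeff_DERIV] by (simp add: isCont_def tendsto_within_subset[OF _ subset_UNIV])
qed (rule shear_H1)

lemma continuous_grad_norm_heat: "continuous_on T (\<lambda>t. grad_norm L (heat M a t))"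
  unfolding heat_eq_sum by (intro grad.nrm_sum_continuous shear_H1 continuous_on_heat_coeff)

lemma leray_hopf_heat: "leray_hopf L \<Omega> (heat M a)"
proof -
  have V: "heat M a t \<in> Vspace L" for t by (rule trig_V[OF heat_trig])
  have H: "heat M a t \<in> Hspace L" for t by (rule V_H[OF V])
  have vert: "vertical (heat M a t)" for t unfolding heat_def by (rule comb_vertical[OF M(1)])
  have gf: "grad_functional (heat M a t) w = (\<Sum>m\<in>M. (- freq L m * heat_coeff a t m) * L2_inner L (shear L m) w)"
    if "w \<in> Vspace L" for t w
    using that by (simp add: grad_functional_def grad_inner_heat V_H1 sum_negf)
  have dist: "distr_deriv (\<lambda>t. L2_inner L (heat M a t) w) (\<lambda>t. grad_functional (heat M a t) w)" if "w \<in> Vspace L" for w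
    using distr_deriv_heat[OF H1_L2[OF V_H1[OF that]]] gf[OF that] by simp
  show ?thesis
    unfolding leray_hopf_def Let_def
  proof (intro conjI allI ballI impI H)
    fix w assume w: "w \<in> Hspace L"
    show "continuous_on {0..} (\<lambda>t. L2_inner L (heat M a t) w)"
      unfolding L2_inner_heat[OF H_L2[OF w]] by (intro continuous_intros)
  next
    show "Lp_loc 2 (Vspace L) (grad_norm L) (heat M a)"
      by (rule Lp_loc_continuous)
         (use V grad_norm_heat_tendsto continuous_grad_norm_heat grad.nrm_zero grad.nrm_nonneg[OF heat_H1] in auto)
  next
    have N: "Vdual_norm L (grad_functional (heat M a s) - grad_functional (heat M a t)) = grad_norm L (heat M a s - heat M a t)" for s t
      by (simp add: grad_functional_diff[OF V V] Vdual_norm_grad_functional subspace_diff[OF subspace_Vspace V V])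
    \<comment> \<open>The derivative is the norm-continuous curve -A u(t) in V', so the exponent 4/3
      requires no estimate of the nonlinear term.\<close>
    have "Lp_loc (4/3) (Vdual L) (Vdual_norm L) (\<lambda>t. grad_functional (heat M a t))"
    proof (rule Lp_loc_continuous)
      show "Vdual_norm L (grad_functional (heat M a t) - grad_functional (heat M a t)) = 0" for t
        unfolding N by (simp add: grad.nrm_zero)
      show "((\<lambda>s. Vdual_norm L (grad_functional (heat M a s) - grad_functional (heat M a t))) \<longlongrightarrow> 0) (at t within {0..})" for t
        unfolding N by (rule grad_norm_heat_tendsto)
      show "continuous_on {0..} (\<lambda>t. Vdual_norm L (grad_functional (heat M a t)))"
        unfolding Vdual_norm_grad_functional[OF V] by (rule continuous_grad_norm_heat)
      show "0 \<le> Vdual_norm L (grad_functional (heat M a t))" for t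
        unfolding Vdual_norm_grad_functional[OF V] by (rule grad.nrm_nonneg[OF heat_H1])
    qed (use grad_functional_Vdual[OF V] in auto)
    then show "\<exists>u'. Lp_loc (4/3) (Vdual L) (Vdual_norm L) u' \<and> (\<forall>w\<in>Vspace L. distr_deriv (\<lambda>t. L2_inner L (heat M a t) w) (\<lambda>t. u' t w))"
      using dist by blast
  next
    fix w assume w: "w \<in> Vspace L"
    have "- (grad_inner L (heat M a t) w + bform L (heat M a t) (heat M a t) w + \<Omega> * L2_inner L (Sop L (heat M a t)) w)
      = grad_functional (heat M a t) w" for t
      using w by (simp add: grad_functional_def Sop_vertical_0[OF H vert] L2.zero_left H_L2 V_H)
         (simp add: heat_def bform_comb_comb[OF M(1)])
    then show "distr_deriv (\<lambda>t. L2_inner L (heat M a t) w)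
       (\<lambda>t. - (grad_inner L (heat M a t) w + bform L (heat M a t) (heat M a t) w + \<Omega> * L2_inner L (Sop L (heat M a t)) w))"
      using dist[OF w] by simp
  next
    show "(L2_norm L (heat M a t))\<^sup>2 / 2 + (LINT \<tau>:{0..t}|lebesgue. (grad_norm L (heat M a \<tau>))\<^sup>2) \<le> (L2_norm L (heat M a 0))\<^sup>2 / 2"
      if "0 \<le> t" for t
      using energy_heat[OF that] by simp
    show "AE t\<^sub>0 in lebesgue. 0 < t\<^sub>0 \<longrightarrow> (\<forall>t\<ge>t\<^sub>0. (L2_norm L (heat M a t))\<^sup>2 / 2
        + (LINT \<tau>:{t\<^sub>0..t}|lebesgue. (grad_norm L (heat M a \<tau>))\<^sup>2) \<le> (L2_norm L (heat M a t\<^sub>0))\<^sup>2 / 2)"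
      using energy_heat by (intro AE_I2) simp
  qed
qed

lemma global_regular_heat: "global_regular L \<Omega> (heat M a)"
  unfolding global_regular_def
proof (intro conjI allI impI leray_hopf_heat grad_norm_heat_tendsto)
  have V: "heat M a t \<in> Vspace L" for t by (rule trig_V[OF heat_trig])
  show "heat M a t \<in> Vspace L" for t by (rule V)
  have isC: "((\<lambda>t. heat_coeff a t m) \<longlongrightarrow> heat_coeff a t m) (at t within T)" for m t T
    using DERIV_isCont[OF heat_coeff_DERIV] by (simp add: isCont_def tendsto_within_subset[OF _ subset_UNIV])
  have st: "stokes L (heat M a s - heat M a t) = (\<Sum>m\<in>M. (heat_coeff a s m * freq L m) *\<^sub>R shear L m) - (\<Sum>m\<in>M. (heat_coeff a t m * freq L m) *\<^sub>R shear L m)" for s t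
  proof -
    have "stokes L (heat M a s - heat M a t) = stokes L (comb L M (\<lambda>m. heat_coeff a s m - heat_coeff a t m))"
      by (simp only: heat_def comb_diff)
    also have "\<dots> = comb L M (\<lambda>m. (heat_coeff a s m - heat_coeff a t m) * freq L m)"
      by (rule stokes_comb[OF M])
    finally show ?thesis by (simp add: comb_def sum_subtractf scaleR_left_diff_distrib left_diff_distrib)
  qed
  have st1: "stokes L (heat M a t) = (\<Sum>m\<in>M. (heat_coeff a t m * freq L m) *\<^sub>R shear L m)" for t
    using stokes_comb[OF M, of "heat_coeff a t"] by (simp add: heat_def comb_def)
  show "Lp_loc 2 (stokes_dom L) (\<lambda>v. L2_norm L (stokes L v)) (heat M a)"
  proof (rule Lp_loc_continuous)
    show "heat M a t \<in> stokes_dom L" for t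
      using V heat_trig[of a t] tfield_H2 solen_hermitian unfolding stokes_dom_def trig_space_eq by auto
    show "L2_norm L (stokes L (heat M a t - heat M a t)) = 0" for t
      unfolding st by (simp add: L2.nrm_zero)
    show "((\<lambda>s. L2_norm L (stokes L (heat M a s - heat M a t))) \<longlongrightarrow> 0) (at t within {0..})" for t
      unfolding st by (rule L2.nrm_sum_tendsto[OF shear_L2]) (intro tendsto_intros isC)
    show "continuous_on {0..} (\<lambda>t. L2_norm L (stokes L (heat M a t)))"
      unfolding st1 by (intro L2.nrm_sum_continuous shear_L2 continuous_intros)
    show "0 \<le> L2_norm L (stokes L (heat M a t))" for t
      unfolding st1 by (intro L2.nrm_nonneg L2.closed shear_L2)
  qed simp
  let ?u' = "\<lambda>t. \<Sum>m\<in>M. (- freq L m * heat_coeff a t m) *\<^sub>R shear L m"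
  have "Lp_loc 2 (Hspace L) (L2_norm L) ?u'"
  proof (rule Lp_loc_continuous)
    show "?u' t \<in> Hspace L" for t
      by (intro H_closed V_H trig_V shear_trig M)
    show "((\<lambda>s. L2_norm L (?u' s - ?u' t)) \<longlongrightarrow> 0) (at t within {0..})" for t
      by (rule L2.nrm_sum_tendsto[OF shear_L2]) (intro tendsto_intros isC)
    show "continuous_on {0..} (\<lambda>t. L2_norm L (?u' t))"
      by (intro L2.nrm_sum_continuous shear_L2 continuous_intros)
    show "0 \<le> L2_norm L (?u' t)" for t
      by (intro L2.nrm_nonneg L2.closed shear_L2)
  qed (simp_all add: L2.nrm_zero)
  moreover have "distr_deriv (\<lambda>t. L2_inner L (heat M a t) w) (\<lambda>t. L2_inner L (?u' t) w)" if "w \<in> Hspace L" for w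
  proof -
    have "L2_inner L (?u' t) w = (\<Sum>m\<in>M. (- freq L m * heat_coeff a t m) * L2_inner L (shear L m) w)" for t
      by (rule L2.sum_left[OF shear_L2 H_L2[OF that]])
    then show ?thesis using distr_deriv_heat[OF H_L2[OF that], of a] by (simp only:)
  qed
  ultimately show "\<exists>u'. Lp_loc 2 (Hspace L) (L2_norm L) u' \<and>
      (\<forall>w\<in>Hspace L. distr_deriv (\<lambda>t. L2_inner L (heat M a t) w) (\<lambda>t. L2_inner L (u' t) w))"
    by blast
qed

end

end

section \<open>Uniqueness\<close>

text \<open>Starting from the constant \<open>B\<close>, the n-th application of \<open>step\<close>
  improves the bound to B (C t)^n / n!, a multiple of a term of the exponential series. Quantifying
  \<open>step\<close> over continuous majorants \<kappa> keeps \<open>E\<close> itself out of all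
  integrals, so its regularity in time does not have to be discussed.\<close>

lemma iterated_Gronwall:
  fixes E :: "real \<Rightarrow> real"
  assumes C: "0 \<le> C" and B: "\<And>t. 0 \<le> t \<Longrightarrow> E t \<le> B"
    and step: "\<And>t \<kappa>. 0 \<le> t \<Longrightarrow> continuous_on {0..t} \<kappa> \<Longrightarrow> (\<And>\<tau>. 0 \<le> \<tau> \<Longrightarrow> \<tau> \<le> t \<Longrightarrow> E \<tau> \<le> \<kappa> \<tau>)
      \<Longrightarrow> E t \<le> (LINT \<tau>:{0..t}|lebesgue. C * \<kappa> \<tau>)"
    and t: "0 \<le> t"
  shows "E t \<le> 0"
proof -
  have bound: "E t \<le> B * ((C * t) ^ n / fact n)" if "0 \<le> t" for n t
    using that
  proof (induction n arbitrary: t)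
    case 0
    then show ?case using B by simp
  next
    case (Suc n)
    have "E t \<le> (LINT \<tau>:{0..t}|lebesgue. C * (B * ((C * \<tau>) ^ n / fact n)))"
    proof (rule step)
      show "continuous_on {0..t} (\<lambda>\<tau>. B * ((C * \<tau>) ^ n / fact n))"
        by (intro continuous_intros) auto
    qed (use Suc in auto)
    also have "\<dots> = B * ((C * t) ^ Suc n / fact (Suc n)) - B * ((C * 0) ^ Suc n / fact (Suc n))"
    proof (rule set_integral_FTC)
      fix \<tau> :: real
      have "((\<lambda>\<tau>. B * ((C * \<tau>) ^ Suc n / fact (Suc n))) has_real_derivative
          B * (real (Suc n) * (C * (C * \<tau>) ^ (Suc n - Suc 0)) / fact (Suc n))) (at \<tau>)"
        by (intro DERIV_cmult DERIV_cdivide DERIV_power DERIV_cmult_Id)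
      moreover have "real (Suc n) * (C * (C * \<tau>) ^ (Suc n - Suc 0)) / fact (Suc n) = C * ((C * \<tau>) ^ n / fact n)"
        by (simp add: fact_Suc del: of_nat_Suc)
      ultimately show "((\<lambda>\<tau>. B * ((C * \<tau>) ^ Suc n / fact (Suc n))) has_real_derivative C * (B * ((C * \<tau>) ^ n / fact n))) (at \<tau>)"
        by (simp only: mult.left_commute[of B C])
      show "continuous_on {0..t} (\<lambda>\<tau>. C * (B * ((C * \<tau>) ^ n / fact n)))"
        by (intro continuous_intros) auto
    qed (use Suc in auto)
    finally show ?case by simp
  qed
  have "(\<lambda>n. B * (inverse (fact n) * (C * t) ^ n)) \<longlonglongrightarrow> B * 0"
    by (intro tendsto_intros summable_LIMSEQ_zero summable_exp)
  then have "(\<lambda>n. B * ((C * t) ^ n / fact n)) \<longlonglongrightarrow> 0"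
    by (simp add: field_simps)
  then show ?thesis
    using bound[OF t] by (intro LIMSEQ_le_const) auto
qed

context torus
begin

lemma L2_norm_diff_expand:
  assumes "u \<in> L2 L" "v \<in> L2 L"
  shows "(L2_norm L (u - v))\<^sup>2 = (L2_norm L u)\<^sup>2 + (L2_norm L v)\<^sup>2 - 2 * L2_inner L u v"
  using assms L2.closed(3)[OF assms] L2.commute[OF assms]
  by (simp add: L2.nrm_sq L2.diff_left L2.diff_right)

lemma grad_norm_diff_expand:
  assumes "u \<in> H1 L" "v \<in> H1 L"
  shows "(grad_norm L (u - v))\<^sup>2 = (grad_norm L u)\<^sup>2 + (grad_norm L v)\<^sup>2 - 2 * grad_inner L u v"
  using assms grad.closed(3)[OF assms] grad.commute[OF assms]
  by (simp add: grad.nrm_sq grad.diff_left grad.diff_right)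

context
  fixes M :: "nat set"
  assumes M: "finite M" "\<And>m. m \<in> M \<Longrightarrow> m > 0"
begin

text \<open>The weak equation for \<open>v\<close> only allows time-independent test fields; the exponentials in
  \<open>heat\<close> enter through the product rule for distributional derivatives.\<close>

lemma inner_heat_increment:
  fixes a :: "nat \<Rightarrow> real"
  assumes v: "global_regular L \<Omega> v" and st: "0 < s" "s \<le> t"
  defines "G \<equiv> \<lambda>\<tau>. - 2 * grad_inner L (v \<tau>) (heat M a \<tau>) - bform L (v \<tau>) (v \<tau>) (heat M a \<tau>)"
  shows "set_integrable lebesgue {s..t} G"
    and "L2_inner L (v t) (heat M a t) - L2_inner L (v s) (heat M a s) = (LINT \<tau>:{s..t}|lebesgue. G \<tau>)"
proof -
  have lh: "leray_hopf L \<Omega> v" and V: "\<And>t. 0 \<le> t \<Longrightarrow> v t \<in> Vspace L"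
    using v by (auto simp: global_regular_def)
  have H: "v t \<in> Hspace L" if "0 \<le> t" for t using V_H[OF V[OF that]] .
  define f where "f m t = L2_inner L (v t) (shear L m)" for m t
  define g where "g m t = - (grad_inner L (v t) (shear L m) + bform L (v t) (v t) (shear L m) + \<Omega> * L2_inner L (Sop L (v t)) (shear L m))" for m t
  \<comment> \<open>The derivative of \<open>f m t * exp (- freq L m * t)\<close> in the
    distribution sense: \<open>g m\<close> from the weak equation, and
    \<open>- freq L m * f m\<close> from the exponential.\<close>
  define k where "k m t = (g m t + (- freq L m) * f m t) * exp (- freq L m * t)" for m t
  have sV: "shear L m \<in> Vspace L" if "m \<in> M" for m by (rule trig_V[OF shear_trig[OF M(2)[OF that]]])
  have dd: "distr_deriv (\<lambda>t. f m t * exp (- freq L m * t)) (k m)" if "m \<in> M" for m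
  proof -
    have "distr_deriv (f m) (g m)"
      using lh sV[OF that] unfolding leray_hopf_def f_def[abs_def] g_def[abs_def] by blast
    then show ?thesis unfolding k_def[abs_def] by (rule distr_deriv_mult_exp)
  qed
  have fc: "continuous_on {0<..} (\<lambda>t. f m t * exp (- freq L m * t))" if "m \<in> M" for m
  proof -
    have "continuous_on {0..} (f m)"
      using lh V_H[OF sV[OF that]] unfolding leray_hopf_def f_def[abs_def] by blast
    then have "continuous_on {0<..} (f m)" by (rule continuous_on_subset) auto
    then show ?thesis by (intro continuous_intros)
  qed
  have P: "L2_inner L (v \<tau>) (heat M a \<tau>) = (\<Sum>m\<in>M. a m * (f m \<tau> * exp (- freq L m * \<tau>)))" if "0 \<le> \<tau>" for \<tau>
    unfolding heat_eq_sum f_def using H_L2[OF H[OF that]]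
    by (simp add: L2.sum_right shear_L2 heat_coeff_def mult_ac)
  have G: "G \<tau> = (\<Sum>m\<in>M. a m * k m \<tau>)" if "0 \<le> \<tau>" for \<tau>
  proof -
    \<comment> \<open>Rotation drops out by \<open>Sop_vertical\<close>. Since
      \<open>shear L m\<close> is an eigenfunction, its frequency times the L2 pairing is the
      gradient pairing, so the damping of \<open>heat\<close> doubles the term coming from the weak
      equation; hence the factor 2.\<close>
    have k: "k m \<tau> = (- 2 * grad_inner L (v \<tau>) (shear L m) - bform L (v \<tau>) (v \<tau>) (shear L m)) * exp (- freq L m * \<tau>)" if "m \<in> M" for m
      using Sop_vertical[OF H[OF \<open>0 \<le> \<tau>\<close>] V_H[OF sV[OF that]] shear_vertical] grad_inner_shear[OF V_H1[OF V[OF \<open>0 \<le> \<tau>\<close>]], of m]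
      by (simp add: k_def g_def f_def)
    have "G \<tau> = (\<Sum>m\<in>M. heat_coeff a \<tau> m * (- 2 * grad_inner L (v \<tau>) (shear L m) - bform L (v \<tau>) (v \<tau>) (shear L m)))"
      unfolding G_def using V_H1[OF V[OF that]]
      by (simp add: heat_def bform_sum[OF M(1)])
         (simp add: comb_def grad.sum_right shear_H1 sum_subtractf right_diff_distrib sum_distrib_left sum_negf mult_ac)
    also have "\<dots> = (\<Sum>m\<in>M. a m * k m \<tau>)"
      by (intro sum.cong refl) (simp add: k heat_coeff_def mult_ac)
    finally show ?thesis .
  qed
  have ki: "set_integrable lebesgue {s..t} (\<lambda>\<tau>. a m * k m \<tau>)" if "m \<in> M" for m
    using dd[OF that] st unfolding distr_deriv_def by (intro set_integrable_mult_right) blast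
  have i: "set_integrable lebesgue {s..t} (\<lambda>\<tau>. \<Sum>m\<in>M. a m * k m \<tau>)"
    using ki unfolding set_integrable_def scaleR_sum_right by (intro Bochner_Integration.integrable_sum)
  have e: "indicator {s..t} \<tau> *\<^sub>R G \<tau> = indicator {s..t} \<tau> *\<^sub>R (\<Sum>m\<in>M. a m * k m \<tau>)" for \<tau>
    using G[of \<tau>] st by (auto simp: indicator_def)
  show "set_integrable lebesgue {s..t} G"
    using i unfolding set_integrable_def e .
  have "L2_inner L (v t) (heat M a t) - L2_inner L (v s) (heat M a s)
      = (\<Sum>m\<in>M. a m * (f m t * exp (- freq L m * t) - f m s * exp (- freq L m * s)))"
    using st by (simp add: P sum_subtractf right_diff_distrib)
  also have "\<dots> = (\<Sum>m\<in>M. a m * (LINT \<tau>:{s..t}|lebesgue. k m \<tau>))"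
    by (intro sum.cong refl) (simp only: distr_deriv_FTC[OF dd fc st])
  also have "\<dots> = (\<Sum>m\<in>M. LINT \<tau>:{s..t}|lebesgue. a m * k m \<tau>)"
    by simp
  also have "\<dots> = (LINT \<tau>:{s..t}|lebesgue. \<Sum>m\<in>M. a m * k m \<tau>)"
    using ki unfolding set_lebesgue_integral_def set_integrable_def scaleR_sum_right
    by (intro Bochner_Integration.integral_sum[symmetric])
  also have "\<dots> = (LINT \<tau>:{s..t}|lebesgue. G \<tau>)"
    unfolding set_lebesgue_integral_def e ..
  finally show "L2_inner L (v t) (heat M a t) - L2_inner L (v s) (heat M a s) = (LINT \<tau>:{s..t}|lebesgue. G \<tau>)" .
qed

text \<open>The weak equation lives on t > 0, so the comparison starts at a time s > 0, and s tends
  to 0 by weak continuity of \<open>v\<close>. The resulting estimate is for E/2 with the factor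
  A^2/4 of \<open>bform_le\<close>, whence the Gronwall constant A^2/2.\<close>

lemma heat_unique:
  assumes v: "global_regular L \<Omega> v" and v0: "v 0 = heat M a 0" and t: "0 \<le> t"
  shows "v t = heat M a t"
proof -
  have lh: "leray_hopf L \<Omega> v" and V: "\<And>t. 0 \<le> t \<Longrightarrow> v t \<in> Vspace L"
    using v by (auto simp: global_regular_def)
  have H1v: "v t \<in> H1 L" and L2v: "v t \<in> L2 L" if "0 \<le> t" for t
    using V_H1[OF V[OF that]] H1_L2 by auto
  let ?u = "heat M a"
  have u1: "?u t \<in> H1 L" and u2: "?u t \<in> L2 L" for t
    by (rule heat_H1[OF M], assumption, rule heat_L2[OF M], assumption)
  define E where "E t = (L2_norm L (v t - ?u t))\<^sup>2" for t
  define A where "A = (\<Sum>m\<in>M. \<bar>a m\<bar>)"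
  define N where "N = (L2_norm L (?u 0))\<^sup>2"
  have ev: "(L2_norm L (v t))\<^sup>2 / 2 + (LINT \<tau>:{0..t}|lebesgue. (grad_norm L (v \<tau>))\<^sup>2) \<le> N / 2" if "0 \<le> t" for t
    using lh that unfolding leray_hopf_def Let_def v0 N_def by blast
  have eu: "(L2_norm L (?u t))\<^sup>2 / 2 + (LINT \<tau>:{0..t}|lebesgue. (grad_norm L (?u \<tau>))\<^sup>2) = N / 2" if "0 \<le> t" for t
    using energy_heat[OF M that] by (simp add: N_def)
  have iv: "set_integrable lebesgue {0..t} (\<lambda>\<tau>. (grad_norm L (v \<tau>))\<^sup>2)" if "0 < t" for t
  proof -
    have "set_integrable lebesgue {0..t} (\<lambda>\<tau>. grad_norm L (v \<tau>) powr 2)"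
      using lh that unfolding leray_hopf_def Lp_loc_def by blast
    moreover have "indicator {0..t} \<tau> *\<^sub>R (grad_norm L (v \<tau>) powr 2) = indicator {0..t} \<tau> *\<^sub>R (grad_norm L (v \<tau>))\<^sup>2" for \<tau>
      using grad.nrm_nonneg[OF H1v, of \<tau>] by (auto simp: indicator_def)
    ultimately show ?thesis unfolding set_integrable_def by (simp only:)
  qed
  have iu: "set_integrable lebesgue {s..t} (\<lambda>\<tau>. (grad_norm L (?u \<tau>))\<^sup>2)" for s t
    by (intro set_integrable_lebesgue_continuous continuous_intros continuous_grad_norm_heat[OF M])
  have nn: "0 \<le> (LINT \<tau>:{0..t}|lebesgue. (h \<tau>)\<^sup>2)" for t and h :: "real \<Rightarrow> real"
    unfolding set_lebesgue_integral_def by (intro Bochner_Integration.integral_nonneg) simp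
  \<comment> \<open>|v - u|^2 \<le> 2 |v|^2 + 2 |u|^2, and both squared norms stay below the common
    initial value \<open>N\<close>.\<close>
  have B: "E t \<le> 4 * N" if "0 \<le> t" for t
  proof -
    have "(L2_norm L (v t))\<^sup>2 \<le> N" "(L2_norm L (?u t))\<^sup>2 \<le> N"
      using ev[OF that] eu[OF that] nn[where t=t and h="\<lambda>\<tau>. grad_norm L (v \<tau>)"] nn[where t=t and h="\<lambda>\<tau>. grad_norm L (?u \<tau>)"] by linarith+
    moreover have "E t \<le> 2 * (L2_norm L (v t))\<^sup>2 + 2 * (L2_norm L (?u t))\<^sup>2"
    proof -
      have "0 \<le> (L2_norm L (v t + ?u t))\<^sup>2" by simp
      also have "(L2_norm L (v t + ?u t))\<^sup>2 = (L2_norm L (v t))\<^sup>2 + (L2_norm L (?u t))\<^sup>2 + 2 * L2_inner L (v t) (?u t)"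
        using L2v[OF that] u2[of t] L2.closed(2)[OF L2v[OF that] u2[of t]] L2.commute[OF L2v[OF that] u2[of t]]
        by (simp add: L2.nrm_sq L2.add_left L2.add_right)
      finally show ?thesis unfolding E_def L2_norm_diff_expand[OF L2v[OF that] u2] by simp
    qed
    ultimately show ?thesis by linarith
  qed
  have pointwise: "- ((grad_norm L (v \<tau>))\<^sup>2 + (grad_norm L (?u \<tau>))\<^sup>2
      + (- 2 * grad_inner L (v \<tau>) (?u \<tau>) - bform L (v \<tau>) (v \<tau>) (?u \<tau>))) \<le> A\<^sup>2 / 4 * E \<tau>" if "0 \<le> \<tau>" for \<tau>
  proof -
    \<comment> \<open>Damping only shrinks the coefficients, so their initial sum bounds the
      amplitude at all later times.\<close>
    have "(\<Sum>m\<in>M. \<bar>heat_coeff a \<tau> m\<bar>) \<le> A"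
      unfolding A_def
    proof (rule sum_mono)
      fix m
      have "exp (- freq L m * \<tau>) \<le> 1" using freq_nonneg[of m] that by simp
      then show "\<bar>heat_coeff a \<tau> m\<bar> \<le> \<bar>a m\<bar>" by (simp add: heat_coeff_def abs_mult mult_left_le)
    qed
    from bform_le[OF V[OF that] M this]
    have "bform L (v \<tau>) (v \<tau>) (?u \<tau>) \<le> (grad_norm L (v \<tau> - ?u \<tau>))\<^sup>2 + A\<^sup>2 / 4 * E \<tau>"
      by (simp add: E_def heat_def)
    then show ?thesis
      unfolding grad_norm_diff_expand[OF H1v[OF that] u1] by linarith
  qed
  have "E t \<le> 0"
  proof (rule iterated_Gronwall[where E=E and t=t and C="A\<^sup>2 / 2" and B="4 * N"])
    fix t :: real and \<kappa> :: "real \<Rightarrow> real"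
    assume t: "0 \<le> t" and \<kappa>: "continuous_on {0..t} \<kappa>" and le: "\<And>\<tau>. 0 \<le> \<tau> \<Longrightarrow> \<tau> \<le> t \<Longrightarrow> E \<tau> \<le> \<kappa> \<tau>"
    let ?K = "LINT \<tau>:{0..t}|lebesgue. A\<^sup>2 / 4 * \<kappa> \<tau>"
    have E0: "0 \<le> E \<tau>" for \<tau> by (simp add: E_def)
    have i\<kappa>: "set_integrable lebesgue {0..t} (\<lambda>\<tau>. A\<^sup>2 / 4 * \<kappa> \<tau>)"
      by (intro set_integrable_lebesgue_continuous continuous_intros \<kappa>)
    have \<kappa>0: "0 \<le> A\<^sup>2 / 4 * \<kappa> \<tau>" if "0 \<le> \<tau>" "\<tau> \<le> t" for \<tau>
      using order_trans[OF E0 le[OF that]] by simp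
    have half: "E t / 2 \<le> ?K"
    \<comment> \<open>At t = 0 there is no s with 0 < s \<le> t, but E 0 = 0 by the common initial
      value.\<close>
    proof (cases "t = 0")
      case True
      have "E 0 = 0" unfolding E_def v0 by (simp add: L2.nrm_zero)
      moreover have "0 \<le> ?K"
        unfolding set_lebesgue_integral_def
      proof (rule Bochner_Integration.integral_nonneg)
        show "0 \<le> indicator {0..t} \<tau> *\<^sub>R (A\<^sup>2 / 4 * \<kappa> \<tau>)" for \<tau>
          using \<kappa>0[of \<tau>] by (cases "\<tau> \<in> {0..t}") (simp_all del: times_divide_eq_left)
      qed
      ultimately show ?thesis using True by simp
    next
      case False
      \<comment> \<open>The dissipation and the majorant are nonnegative, so their integrals over
        [s,t] may be compared with those over [0,t]. The only remaining dependence on s is the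
        pairing at time s, which tends to \<open>N\<close>.\<close>
      have main: "E t / 2 \<le> N - L2_inner L (v s) (?u s) + ?K" if s: "0 < s" "s \<le> t" for s
      proof -
        let ?G = "\<lambda>\<tau>. - 2 * grad_inner L (v \<tau>) (?u \<tau>) - bform L (v \<tau>) (v \<tau>) (?u \<tau>)"
        have tp: "0 < t" using s by simp
        note inc = inner_heat_increment[OF v s, of a]
        have sub: "(LINT \<tau>:{s..t}|lebesgue. f \<tau>) \<le> (LINT \<tau>:{0..t}|lebesgue. f \<tau>)"
          if "set_integrable lebesgue {0..t} f" "\<And>\<tau>. 0 \<le> \<tau> \<Longrightarrow> \<tau> \<le> t \<Longrightarrow> 0 \<le> f \<tau>" for f :: "real \<Rightarrow> real"
        proof -
          have "set_integrable lebesgue {s..t} f"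
            by (rule set_integrable_subset[OF that(1)]) (use s in auto)
          then show ?thesis
            using that s unfolding set_lebesgue_integral_def set_integrable_def
            by (intro integral_mono) (auto simp: indicator_def)
        qed
        have iv': "set_integrable lebesgue {s..t} (\<lambda>\<tau>. (grad_norm L (v \<tau>))\<^sup>2)"
          by (rule set_integrable_subset[OF iv[OF tp]]) (use s in auto)
        have i\<kappa>': "set_integrable lebesgue {s..t} (\<lambda>\<tau>. A\<^sup>2 / 4 * \<kappa> \<tau>)"
          by (rule set_integrable_subset[OF i\<kappa>]) (use s in auto)
        have i2: "set_integrable lebesgue {s..t} (\<lambda>\<tau>. (grad_norm L (v \<tau>))\<^sup>2 + (grad_norm L (?u \<tau>))\<^sup>2)"
          by (rule set_integral_add(1)[OF iv' iu])
        have i3: "set_integrable lebesgue {s..t} (\<lambda>\<tau>. (grad_norm L (v \<tau>))\<^sup>2 + (grad_norm L (?u \<tau>))\<^sup>2 + ?G \<tau>)"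
          by (rule set_integral_add(1)[OF i2 inc(1)])
        have "- (LINT \<tau>:{s..t}|lebesgue. (grad_norm L (v \<tau>))\<^sup>2 + (grad_norm L (?u \<tau>))\<^sup>2 + ?G \<tau>)
          = (LINT \<tau>:{s..t}|lebesgue. - ((grad_norm L (v \<tau>))\<^sup>2 + (grad_norm L (?u \<tau>))\<^sup>2 + ?G \<tau>))"
          by (rule set_integral_uminus[symmetric, OF i3])
        also have "\<dots> \<le> (LINT \<tau>:{s..t}|lebesgue. A\<^sup>2 / 4 * \<kappa> \<tau>)"
        proof (rule set_integral_mono[OF _ i\<kappa>'])
          show "set_integrable lebesgue {s..t} (\<lambda>\<tau>. - ((grad_norm L (v \<tau>))\<^sup>2 + (grad_norm L (?u \<tau>))\<^sup>2 + ?G \<tau>))"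
            using i3 unfolding set_integrable_def scaleR_minus_right by (rule Bochner_Integration.integrable_minus)
          fix \<tau> assume "\<tau> \<in> {s..t}"
          then have \<tau>: "0 \<le> \<tau>" "\<tau> \<le> t" using s by auto
          have "A\<^sup>2 / 4 * E \<tau> \<le> A\<^sup>2 / 4 * \<kappa> \<tau>" using le[OF \<tau>] by (intro mult_left_mono) auto
          then show "- ((grad_norm L (v \<tau>))\<^sup>2 + (grad_norm L (?u \<tau>))\<^sup>2 + ?G \<tau>) \<le> A\<^sup>2 / 4 * \<kappa> \<tau>"
            using pointwise[OF \<tau>(1)] by linarith
        qed
        also have "\<dots> \<le> ?K"
          by (rule sub[OF i\<kappa> \<kappa>0])
        finally have "- ((LINT \<tau>:{s..t}|lebesgue. (grad_norm L (v \<tau>))\<^sup>2) + (LINT \<tau>:{s..t}|lebesgue. (grad_norm L (?u \<tau>))\<^sup>2)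
            + (LINT \<tau>:{s..t}|lebesgue. ?G \<tau>)) \<le> ?K"
          by (simp only: set_integral_add(2)[OF i2 inc(1)] set_integral_add(2)[OF iv' iu])
        moreover have "(LINT \<tau>:{s..t}|lebesgue. (grad_norm L (v \<tau>))\<^sup>2) \<le> (LINT \<tau>:{0..t}|lebesgue. (grad_norm L (v \<tau>))\<^sup>2)"
          "(LINT \<tau>:{s..t}|lebesgue. (grad_norm L (?u \<tau>))\<^sup>2) \<le> (LINT \<tau>:{0..t}|lebesgue. (grad_norm L (?u \<tau>))\<^sup>2)"
          by (rule sub[OF iv[OF tp]], simp, rule sub[OF iu], simp)
        moreover have "E t = (L2_norm L (v t))\<^sup>2 + (L2_norm L (?u t))\<^sup>2 - 2 * L2_inner L (v t) (?u t)"
          unfolding E_def by (rule L2_norm_diff_expand[OF L2v[OF t] u2])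
        ultimately show ?thesis
          using ev[OF t] eu[OF t] inc(2) by argo
      qed
      have "((\<lambda>s. L2_inner L (v s) (?u s)) \<longlongrightarrow> L2_inner L (v 0) (?u 0)) (at 0 within {0..})"
      proof -
        have c: "continuous_on {0..} (\<lambda>s. \<Sum>m\<in>M. heat_coeff a s m * L2_inner L (v s) (shear L m))"
        proof (intro continuous_intros)
          fix m assume "m \<in> M"
          then have "shear L m \<in> Hspace L" by (intro V_H trig_V shear_trig M)
          then show "continuous_on {0..} (\<lambda>s. L2_inner L (v s) (shear L m))"
            using lh unfolding leray_hopf_def by blast
        qed
        have "continuous_on {0..} (\<lambda>s. L2_inner L (v s) (?u s))"
          using c by (rule continuous_on_eq) (simp add: heat_eq_sum L2.sum_right shear_L2 L2v)
        then show ?thesis unfolding continuous_on by auto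
      qed
      then have lim: "((\<lambda>s. L2_inner L (v s) (?u s)) \<longlongrightarrow> N) (at_right 0)"
        using L2.nrm_sq[OF u2[of 0]] unfolding v0 N_def
        by (auto intro: tendsto_within_subset[of _ _ _ "{0..}"])
      have "((\<lambda>s. N - L2_inner L (v s) (?u s) + ?K) \<longlongrightarrow> N - N + ?K) (at_right 0)"
        by (intro tendsto_intros lim)
      moreover have "\<forall>\<^sub>F s in at_right 0. E t / 2 \<le> N - L2_inner L (v s) (?u s) + ?K"
        using False t main by (auto simp: eventually_at_right_field intro!: exI[of _ t])
      ultimately have "E t / 2 \<le> N - N + ?K"
        by (intro tendsto_lowerbound) auto
      then show ?thesis by simp
    qed
    have "(LINT \<tau>:{0..t}|lebesgue. A\<^sup>2 / 2 * \<kappa> \<tau>) = 2 * ?K"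
      by simp
    then show "E t \<le> (LINT \<tau>:{0..t}|lebesgue. A\<^sup>2 / 2 * \<kappa> \<tau>)" using half by simp
  qed (use B t in auto)
  then have "L2_norm L (v t - ?u t) = 0" by (simp add: E_def)
  then have "v t - ?u t = 0" by (intro L2_norm_eq_0 L2.closed L2v t u2)
  then show ?thesis by simp
qed

end

section \<open>The invariant spaces, their dimension and how they are told apart\<close>

definition shear_space :: "nat set \<Rightarrow> vfield set" where
  "shear_space S = span (shear L ` S)"

lemma comb_eq_heat: "comb L M a = heat M a 0"
  by (simp add: heat_def heat_coeff_def[abs_def])

lemma shear_space_comb:
  assumes "u \<in> shear_space S"
  obtains M a where "finite M" "M \<subseteq> S" "u = comb L M a"
proof -
  obtain t r where t: "finite t" "t \<subseteq> shear L ` S" "u = (\<Sum>x\<in>t. r x *\<^sub>R x)"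
    using assms unfolding shear_space_def span_explicit by blast
  \<comment> \<open>A set of frequencies on which \<open>shear L\<close> is injective and which has
    the same image, so that a sum over fields can be reindexed by frequencies.\<close>
  obtain M where M: "M \<subseteq> S" "inj_on (shear L) M" "t = shear L ` M"
    using t(2) unfolding subset_image_inj by blast
  have "finite M" using t(1) M by (simp add: finite_image_iff)
  moreover have "u = comb L M (r \<circ> shear L)"
    by (simp add: t(3) M(3) comb_def sum.reindex[OF M(2)])
  ultimately show ?thesis using that M(1) by blast
qed

lemma comb_shear_space: "M \<subseteq> S \<Longrightarrow> comb L M a \<in> shear_space S"
  unfolding comb_def shear_space_def by (intro span_sum span_scale span_base) auto

lemma invariant_shear_space:
  assumes S: "\<And>m. m \<in> S \<Longrightarrow> m > 0"
  shows "invariant_subspace L \<Omega> (shear_space S)"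
  unfolding invariant_subspace_def
proof (intro conjI ballI)
  show "subspace (shear_space S)" by (simp add: shear_space_def)
  show "shear_space S \<subseteq> Vspace L"
    unfolding shear_space_def using S
    by (intro span_minimal subspace_Vspace) (auto intro: trig_V shear_trig)
  fix u0 assume "u0 \<in> shear_space S"
  then obtain M a where M: "finite M" "M \<subseteq> S" and u0: "u0 = heat M a 0"
    by (metis shear_space_comb comb_eq_heat)
  have pos: "m > 0" if "m \<in> M" for m using that M S by auto
  show "\<exists>u. global_regular L \<Omega> u \<and> u 0 = u0 \<and> (\<forall>t\<ge>0. u t \<in> shear_space S) \<and>
      (\<forall>v. global_regular L \<Omega> v \<and> v 0 = u0 \<longrightarrow> (\<forall>t\<ge>0. v t = u t))"
  proof (intro exI[of _ "heat M a"] conjI allI impI)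
    show "global_regular L \<Omega> (heat M a)" by (rule global_regular_heat[OF M(1) pos])
    show "heat M a 0 = u0" by (simp add: u0)
    show "heat M a t \<in> shear_space S" for t
      unfolding heat_def by (rule comb_shear_space[OF M(2)])
    show "v t = heat M a t" if "global_regular L \<Omega> v \<and> v 0 = u0" "0 \<le> t" for v t
      using heat_unique[OF M(1) pos, of \<Omega> v a t] that u0 by blast
  qed
qed

lemma fourier_shear: "m > 0 \<Longrightarrow> l > 0 \<Longrightarrow> fourier L (shear L m) (ek (int l)) $ 3 = (if m = l then 1/2 else 0)"
proof -
  assume "m > 0" "l > 0"
  then have "ek (int l) \<noteq> - ek (int m)" "ek (int l) = ek (int m) \<longleftrightarrow> l = m"
    by (auto simp: ek_uminus ek_inj)
  then show ?thesis by (simp add: shear_def fourier_tfield hermitian_mode mode_def)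
qed

text \<open>The third component of the coefficient at \<open>ek (int l)\<close> detects
  \<open>shear L l\<close> and annihilates the other generators; positivity of the frequencies
  excludes the conjugate wave vector \<open>- ek (int m)\<close>.\<close>

lemma fourier_shear_span:
  assumes "\<And>m. m \<in> S \<Longrightarrow> m > 0" "l > 0" "l \<notin> S" "u \<in> shear_space S"
  shows "fourier L u (ek (int l)) $ 3 = 0"
proof -
  obtain M a where M: "finite M" "M \<subseteq> S" "u = comb L M a" using shear_space_comb[OF assms(4)] .
  have "mode 3 (int m) (1/2) (ek (int l)) $ 3 = 0" if "m \<in> M" for m
  proof -
    have "fourier L (shear L m) (ek (int l)) $ 3 = 0"
      using fourier_shear[of m l] assms that M by auto
    then show ?thesis by (simp add: shear_def fourier_tfield hermitian_mode)
  qed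
  then show ?thesis by (simp add: M(3) fourier_comb[OF M(1)])
qed

lemma shear_mem_iff:
  assumes "\<And>m. m \<in> S \<Longrightarrow> m > 0" "l > 0" shows "shear L l \<in> shear_space S \<longleftrightarrow> l \<in> S"
proof
  assume "shear L l \<in> shear_space S"
  then show "l \<in> S"
    using fourier_shear_span[OF assms(1) assms(2), where u="shear L l"] fourier_shear[of l l] assms(2) by auto
qed (simp add: shear_space_def span_base)

text \<open>A finite spanning set involves only a finite set \<open>K\<close> of frequencies, so
  \<open>shear_space S\<close> would lie in \<open>shear_space K\<close>; a frequency of
  \<open>S\<close> outside \<open>K\<close> contradicts this.\<close>

lemma infinite_dimensional_shear_space:
  assumes S: "\<And>m. m \<in> S \<Longrightarrow> m > 0" and inf: "infinite S"
  shows "infinite_dimensional (shear_space S)"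
  unfolding infinite_dimensional_def
proof
  assume "\<exists>B. finite B \<and> span B = shear_space S"
  then obtain B where B: "finite B" "span B = shear_space S" by blast
  have "\<forall>b\<in>B. \<exists>M. finite M \<and> M \<subseteq> S \<and> b \<in> shear_space M"
  proof
    fix b assume "b \<in> B"
    then have "b \<in> shear_space S" using B span_base by blast
    then show "\<exists>M. finite M \<and> M \<subseteq> S \<and> b \<in> shear_space M"
      by (metis shear_space_comb comb_shear_space order_refl)
  qed
  then obtain M where M: "\<And>b. b \<in> B \<Longrightarrow> finite (M b) \<and> M b \<subseteq> S \<and> b \<in> shear_space (M b)" by metis
  define K where "K = (\<Union>b\<in>B. M b)"
  have K: "finite K" "K \<subseteq> S" using M B(1) by (auto simp: K_def)
  have "shear_space (M b) \<subseteq> shear_space K" if "b \<in> B" for b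
    unfolding shear_space_def by (intro span_mono image_mono) (use that in \<open>auto simp: K_def\<close>)
  then have "B \<subseteq> shear_space K" using M by blast
  then have "shear_space S \<subseteq> shear_space K"
    unfolding B(2)[symmetric] by (intro span_minimal) (auto simp: shear_space_def)
  moreover obtain l where l: "l \<in> S" "l \<notin> K" using inf K by (metis finite_subset subsetI)
  moreover have "shear L l \<in> shear_space S" using l by (simp add: shear_space_def span_base)
  ultimately have "shear L l \<in> shear_space K" by blast
  then show False using shear_mem_iff[of K l] l K S by (metis subsetD)
qed

end

theorem corollary5p3:
  fixes L :: "real^3" and \<Omega> :: real
  assumes "L $ 1 > 0" and "L $ 2 > 0" and "L $ 3 > 0"
    and "Max {L $ 1, L $ 2, L $ 3} = 2 * pi"
  shows "\<exists>F :: vfield set set. infinite F \<and>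
           (\<forall>W\<in>F. invariant_subspace L \<Omega> W \<and> infinite_dimensional W) \<and>
           (\<forall>W\<in>F. \<forall>W'\<in>F. W \<noteq> W' \<longrightarrow> \<not> W \<subseteq> W')"
proof -
  interpret torus L
  proof
    show "L $ j > 0" for j using assms(1-3) exhaust_3[of j] by auto
  qed
  \<comment> \<open>Rows of a bijection between pairs and natural numbers: infinite, and pairwise
    disjoint for distinct \<open>n\<close>. \<open>Suc\<close> keeps out the frequency 0, which
    would give a constant field of nonzero mean.\<close>
  define S where "S n = (\<lambda>j. Suc (prod_encode (n, j))) ` UNIV" for n
  have pos: "m > 0" if "m \<in> S n" for m n using that by (auto simp: S_def)
  have inf: "infinite (S n)" for n
    unfolding S_def by (intro range_inj_infinite) (auto simp: inj_on_def)
  have not_sub: "\<not> shear_space (S n) \<subseteq> shear_space (S n')" if "n \<noteq> n'" for n n'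
  proof
    let ?l = "Suc (prod_encode (n, 0))"
    assume "shear_space (S n) \<subseteq> shear_space (S n')"
    moreover have "shear L ?l \<in> shear_space (S n)"
      using shear_mem_iff[of "S n" ?l] pos by (auto simp: S_def)
    ultimately have "?l \<in> S n'" using shear_mem_iff[of "S n'" ?l] pos by blast
    then show False using that by (auto simp: S_def)
  qed
  show ?thesis
  proof (intro exI[of _ "range (\<lambda>n. shear_space (S n))"] conjI ballI impI)
    show "infinite (range (\<lambda>n. shear_space (S n)))"
      by (intro range_inj_infinite injI) (metis not_sub order_refl)
    fix W assume "W \<in> range (\<lambda>n. shear_space (S n))"
    then obtain n where W: "W = shear_space (S n)" by blast
    show "invariant_subspace L \<Omega> W"
      unfolding W by (rule invariant_shear_space) (rule pos)
    show "infinite_dimensional W"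
      unfolding W by (rule infinite_dimensional_shear_space[OF _ inf]) (rule pos)
    fix W' assume "W' \<in> range (\<lambda>n. shear_space (S n))" and ne: "W \<noteq> W'"
    then obtain n' where W': "W' = shear_space (S n')" by blast
    show "\<not> W \<subseteq> W'"
      using not_sub[of n n'] ne W W' by auto
  qed
qed

end
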